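(* Let $\mathbf{C}$ be a regular Mal'cev category. Then $\mathbf{Rel}(\mathbf{C})$ satisfies the no-broadcasting principle: any special dagger Frobenius structure $(A,\mu,\eta)$ in $\mathbf{Rel}(\mathbf{C})$ that has a broadcasting map is commutative, i.e. $\mu\circ\sigma=\mu$ where $\sigma\colon A\otimes A\to A\otimes A$ is the swap.
   Context: A category is regular when it has finite limits, coequalizers of kernel pairs, and regular epimorphisms are stable under pullback. A category with finite limits is Mal'cev if every reflexive relation $R\rightarrowtail A\times A$ is an equivalence relation. For $\mathbf{C}$ regular, $\mathbf{Rel}(\mathbf{C})$ has the same objects as $\mathbf{C}$; a morphism $R\colon A\to B$ is a subobject $R\rightarrowtail A\times B$; identities are diagonals; $S\circ R$ is the image of $R\times_B S\to A\times C$, i.e. $\{(a,c)\mid (\exists b)\,R(a,b)\wedge S(b,c)\}$ in the internal regular logic. $\mathbf{Rel}(\mathbf{C})$ is a compact dagger category with $\otimes=\times$, $I=1$, $R^\dagger(b,a)\Leftrightarrow R(a,b)$. A special dagger Frobenius structure in a dagger monoidal category is an object $A$ with $\mu\colon A\otimes A\to A$, $\eta\colon I\to A$ satisfying $\mu(\mathrm{id}\otimes\eta)=\mathrm{id}_A=\mu(\eta\otimes\mathrm{id})$, $\mu(\mu\otimes\mathrm{id})=\mu(\mathrm{id}\otimes\mu)$, $\mu\circ\mu^\dagger=\mathrm{id}_A$, and $(\mu\otimes\mathrm{id})(\mathrm{id}\otimes\mu^\dagger)=(\mathrm{id}\otimes\mu)(\mu^\dagger\otimes\mathrm{id})$. The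 tensor product of special dagger Frobenius structures $A,B$ has multiplication $(\mu_A\otimes\mu_B)\circ(\mathrm{id}\otimes\sigma\otimes\mathrm{id})$ and unit $\eta_A\otimes\eta_B$. A morphism $f\colon A\to B$ between special dagger Frobenius structures $(A,\mu_A),(B,\mu_B)$ is completely positive if its Choi matrix $(\mathrm{id}_A\otimes\mu_B)\circ(\mathrm{id}_A\otimes f\otimes\mathrm{id}_B)\circ(\mu_A^\dagger\otimes\mathrm{id}_B)\colon A\otimes B\to A\otimes B$ equals $g^\dagger\circ g$ for some morphism $g\colon A\otimes B\to X$. A broadcasting map for $(A,\mu,\eta)$ is a completely positive morphism $\beta\colon A\to A\otimes A$ with $(\mathrm{id}_A\otimes\eta^\dagger)\circ\beta=\mathrm{id}_A=(\eta^\dagger\otimes\mathrm{id}_A)\circ\beta$. *)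

theory Defs
  imports Main
begin

section \<open>Categories\<close>

record ('o, 'm) category =
  Obj :: "'o set"
  Arr :: "'m set"
  Dom :: "'m \<Rightarrow> 'o"
  Cod :: "'m \<Rightarrow> 'o"
  Id :: "'o \<Rightarrow> 'm"
  Comp :: "'m \<Rightarrow> 'm \<Rightarrow> 'm"  (infixr "\<cdot>\<index>" 70)

definition hom :: "('o, 'm, 'z) category_scheme \<Rightarrow> 'o \<Rightarrow> 'o \<Rightarrow> 'm set" where
  "hom C X Y = {f \<in> Arr C. Dom C f = X \<and> Cod C f = Y}"

locale category =
  fixes C :: "('o, 'm, 'z) category_scheme" (structure)
  assumes Dom_in_Obj: "f \<in> Arr C \<Longrightarrow> Dom C f \<in> Obj C"
    and Cod_in_Obj: "f \<in> Arr C \<Longrightarrow> Cod C f \<in> Obj C"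
    and Id_in_hom: "X \<in> Obj C \<Longrightarrow> Id C X \<in> hom C X X"
    and Comp_in_hom: "f \<in> hom C X Y \<Longrightarrow> g \<in> hom C Y Z \<Longrightarrow> g \<cdot> f \<in> hom C X Z"
    and Comp_Id_right: "f \<in> hom C X Y \<Longrightarrow> f \<cdot> Id C X = f"
    and Comp_Id_left: "f \<in> hom C X Y \<Longrightarrow> Id C Y \<cdot> f = f"
    and Comp_assoc: "f \<in> hom C W X \<Longrightarrow> g \<in> hom C X Y \<Longrightarrow> h \<in> hom C Y Z \<Longrightarrow>
      (h \<cdot> g) \<cdot> f = h \<cdot> (g \<cdot> f)"

definition is_functor ::
  "('i, 'j, 'y) category_scheme \<Rightarrow> ('o, 'm, 'z) category_scheme \<Rightarrow>
    ('i \<Rightarrow> 'o) \<Rightarrow> ('j \<Rightarrow> 'm) \<Rightarrow> bool" where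
  "is_functor J C Fo Fm \<longleftrightarrow>
    (\<forall>i \<in> Obj J. Fo i \<in> Obj C) \<and>
    (\<forall>u \<in> Arr J. Fm u \<in> hom C (Fo (Dom J u)) (Fo (Cod J u))) \<and>
    (\<forall>i \<in> Obj J. Fm (Id J i) = Id C (Fo i)) \<and>
    (\<forall>u \<in> Arr J. \<forall>v \<in> Arr J. Cod J u = Dom J v \<longrightarrow>
      Fm (v \<cdot>\<^bsub>J\<^esub> u) = Fm v \<cdot>\<^bsub>C\<^esub> Fm u)"

definition is_cone ::
  "('i, 'j, 'y) category_scheme \<Rightarrow> ('o, 'm, 'z) category_scheme \<Rightarrow>
    ('i \<Rightarrow> 'o) \<Rightarrow> ('j \<Rightarrow> 'm) \<Rightarrow> 'o \<Rightarrow> ('i \<Rightarrow> 'm) \<Rightarrow> bool" where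
  "is_cone J C Fo Fm X \<pi> \<longleftrightarrow>
    X \<in> Obj C \<and>
    (\<forall>i \<in> Obj J. \<pi> i \<in> hom C X (Fo i)) \<and>
    (\<forall>u \<in> Arr J. Fm u \<cdot>\<^bsub>C\<^esub> \<pi> (Dom J u) = \<pi> (Cod J u))"

definition is_limit ::
  "('i, 'j, 'y) category_scheme \<Rightarrow> ('o, 'm, 'z) category_scheme \<Rightarrow>
    ('i \<Rightarrow> 'o) \<Rightarrow> ('j \<Rightarrow> 'm) \<Rightarrow> 'o \<Rightarrow> ('i \<Rightarrow> 'm) \<Rightarrow> bool" where
  "is_limit J C Fo Fm X \<pi> \<longleftrightarrow>
    is_cone J C Fo Fm X \<pi> \<and>
    (\<forall>Y \<psi>. is_cone J C Fo Fm Y \<psi> \<longrightarrow>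
      (\<exists>!h. h \<in> hom C Y X \<and> (\<forall>i \<in> Obj J. \<pi> i \<cdot>\<^bsub>C\<^esub> h = \<psi> i)))"

text \<open>Every finite category is isomorphic to one whose objects and arrows are natural numbers,
  so it suffices to let the index category range over those.\<close>

definition has_finite_limits :: "('o, 'm, 'z) category_scheme \<Rightarrow> bool" where
  "has_finite_limits C \<longleftrightarrow>
    (\<forall>(J :: (nat, nat) category) Fo Fm.
      category J \<and> finite (Obj J) \<and> finite (Arr J) \<and> is_functor J C Fo Fm \<longrightarrow>
      (\<exists>X \<pi>. is_limit J C Fo Fm X \<pi>))"


section \<open>Regular categories\<close>

context
  fixes C :: "('o, 'm, 'z) category_scheme" (structure)
begin

definition monic :: "'m \<Rightarrow> bool" where
  "monic m \<longleftrightarrow> m \<in> Arr C \<and>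
    (\<forall>X. \<forall>f \<in> hom C X (Dom C m). \<forall>g \<in> hom C X (Dom C m). m \<cdot> f = m \<cdot> g \<longrightarrow> f = g)"

definition is_pullback :: "'m \<Rightarrow> 'm \<Rightarrow> 'm \<Rightarrow> 'm \<Rightarrow> bool" where
  "is_pullback f g p q \<longleftrightarrow>
    f \<in> Arr C \<and> g \<in> Arr C \<and> Cod C f = Cod C g \<and>
    p \<in> hom C (Dom C p) (Dom C f) \<and> q \<in> hom C (Dom C p) (Dom C g) \<and> f \<cdot> p = g \<cdot> q \<and>
    (\<forall>X. \<forall>u \<in> hom C X (Dom C f). \<forall>v \<in> hom C X (Dom C g). f \<cdot> u = g \<cdot> v \<longrightarrow>
      (\<exists>!h. h \<in> hom C X (Dom C p) \<and> p \<cdot> h = u \<and> q \<cdot> h = v))"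

definition is_kernel_pair :: "'m \<Rightarrow> 'm \<Rightarrow> 'm \<Rightarrow> bool" where
  "is_kernel_pair f p q \<longleftrightarrow> is_pullback f f p q"

definition is_coequalizer :: "'m \<Rightarrow> 'm \<Rightarrow> 'm \<Rightarrow> bool" where
  "is_coequalizer u v e \<longleftrightarrow>
    u \<in> Arr C \<and> v \<in> hom C (Dom C u) (Cod C u) \<and>
    e \<in> hom C (Cod C u) (Cod C e) \<and> e \<cdot> u = e \<cdot> v \<and>
    (\<forall>Z. \<forall>h \<in> hom C (Cod C u) Z. h \<cdot> u = h \<cdot> v \<longrightarrow>
      (\<exists>!k. k \<in> hom C (Cod C e) Z \<and> k \<cdot> e = h))"

definition regular_epi :: "'m \<Rightarrow> bool" where
  "regular_epi e \<longleftrightarrow> (\<exists>u v. is_coequalizer u v e)"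

end

locale regular_category = category C
  for C :: "('o, 'm, 'z) category_scheme" (structure) +
  assumes finite_limits: "has_finite_limits C"
    and kernel_pair_coequalizer: "is_kernel_pair C f p q \<Longrightarrow> \<exists>e. is_coequalizer C p q e"
    and regular_epi_stable: "regular_epi C e \<Longrightarrow> is_pullback C f e p q \<Longrightarrow> regular_epi C p"


section \<open>Chosen finite products\<close>

text \<open>The tensor product of relations, and the identification of relations with subobjects of
  products, refer to chosen products \<open>A \<times> B\<close> and a chosen terminal object. The choice is part of
  the data and otherwise arbitrary.\<close>

record ('o, 'm) cartesian_category = "('o, 'm) category" +
  Prod :: "'o \<Rightarrow> 'o \<Rightarrow> 'o"
  Pr1 :: "'o \<Rightarrow> 'o \<Rightarrow> 'm"
  Pr2 :: "'o \<Rightarrow> 'o \<Rightarrow> 'm"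
  Terminal :: 'o

locale chosen_finite_products =
  fixes C :: "('o, 'm, 'z) cartesian_category_scheme" (structure)
  assumes Terminal_in_Obj: "Terminal C \<in> Obj C"
    and Terminal_universal: "X \<in> Obj C \<Longrightarrow> \<exists>!h. h \<in> hom C X (Terminal C)"
    and Prod_in_Obj: "A \<in> Obj C \<Longrightarrow> B \<in> Obj C \<Longrightarrow> Prod C A B \<in> Obj C"
    and Pr1_in_hom: "A \<in> Obj C \<Longrightarrow> B \<in> Obj C \<Longrightarrow> Pr1 C A B \<in> hom C (Prod C A B) A"
    and Pr2_in_hom: "A \<in> Obj C \<Longrightarrow> B \<in> Obj C \<Longrightarrow> Pr2 C A B \<in> hom C (Prod C A B) B"
    and Prod_universal: "A \<in> Obj C \<Longrightarrow> B \<in> Obj C \<Longrightarrow> f \<in> hom C X A \<Longrightarrow> g \<in> hom C X B \<Longrightarrow>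
      \<exists>!h. h \<in> hom C X (Prod C A B) \<and> Pr1 C A B \<cdot> h = f \<and> Pr2 C A B \<cdot> h = g"

context
  fixes C :: "('o, 'm, 'z) cartesian_category_scheme" (structure)
begin

definition pairing :: "'m \<Rightarrow> 'm \<Rightarrow> 'm" where
  "pairing f g = (THE h. h \<in> hom C (Dom C f) (Prod C (Cod C f) (Cod C g)) \<and>
    Pr1 C (Cod C f) (Cod C g) \<cdot> h = f \<and> Pr2 C (Cod C f) (Cod C g) \<cdot> h = g)"

definition diag :: "'o \<Rightarrow> 'm" where
  "diag A = pairing (Id C A) (Id C A)"


section \<open>Mal'cev categories\<close>

definition factors_through :: "'m \<Rightarrow> 'm \<Rightarrow> bool" where
  "factors_through f m \<longleftrightarrow> (\<exists>h \<in> hom C (Dom C f) (Dom C m). m \<cdot> h = f)"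

definition internal_relation :: "'o \<Rightarrow> 'm \<Rightarrow> bool" where
  "internal_relation A r \<longleftrightarrow> monic C r \<and> Cod C r = Prod C A A"

definition reflexive_relation :: "'o \<Rightarrow> 'm \<Rightarrow> bool" where
  "reflexive_relation A r \<longleftrightarrow> internal_relation A r \<and> factors_through (diag A) r"

definition symmetric_relation :: "'o \<Rightarrow> 'm \<Rightarrow> bool" where
  "symmetric_relation A r \<longleftrightarrow> internal_relation A r \<and>
    factors_through (pairing (Pr2 C A A \<cdot> r) (Pr1 C A A \<cdot> r)) r"

definition transitive_relation :: "'o \<Rightarrow> 'm \<Rightarrow> bool" where
  "transitive_relation A r \<longleftrightarrow> internal_relation A r \<and>
    (\<forall>p q. is_pullback C (Pr2 C A A \<cdot> r) (Pr1 C A A \<cdot> r) p q \<longrightarrow>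
      factors_through (pairing (Pr1 C A A \<cdot> r \<cdot> p) (Pr2 C A A \<cdot> r \<cdot> q)) r)"

definition equivalence_relation :: "'o \<Rightarrow> 'm \<Rightarrow> bool" where
  "equivalence_relation A r \<longleftrightarrow>
    reflexive_relation A r \<and> symmetric_relation A r \<and> transitive_relation A r"

definition malcev :: bool where
  "malcev \<longleftrightarrow> has_finite_limits C \<and>
    (\<forall>A \<in> Obj C. \<forall>r. reflexive_relation A r \<longrightarrow> equivalence_relation A r)"


section \<open>Subobjects and internal relations\<close>

text \<open>A subobject is the set of all monomorphisms isomorphic, over their common codomain,
  to a given one.\<close>

definition subobject :: "'m \<Rightarrow> 'm set" where
  "subobject m = {n. monic C n \<and> Cod C n = Cod C m \<and> factors_through n m \<and> factors_through m n}"

text \<open>The image of \<open>f\<close>, as a subobject: all monic parts of factorizations of \<open>f\<close> as a regular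
  epimorphism followed by a monomorphism.\<close>

definition image_subobject :: "'m \<Rightarrow> 'm set" where
  "image_subobject f = {m. monic C m \<and> Cod C m = Cod C f \<and>
    (\<exists>e \<in> hom C (Dom C f) (Dom C m). regular_epi C e \<and> m \<cdot> e = f)}"

text \<open>A morphism \<open>A \<rightarrow> B\<close> of relations is a triple \<open>(A, R, B)\<close> with \<open>R\<close> a subobject of \<open>A \<times> B\<close>;
  recording \<open>A\<close> and \<open>B\<close> is necessary because they need not be determined by the object \<open>A \<times> B\<close>.
  Operations are applied to all representatives of the given subobjects at once; the results
  do not depend on the representatives, so the unions below are unions of equal subobjects.\<close>

definition rel_arrows :: "('o \<times> 'm set \<times> 'o) set" where
  "rel_arrows = {(A, subobject r, B) | A B r.
    A \<in> Obj C \<and> B \<in> Obj C \<and> monic C r \<and> Cod C r = Prod C A B}"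

definition rel_id :: "'o \<Rightarrow> 'o \<times> 'm set \<times> 'o" where
  "rel_id A = (A, subobject (diag A), A)"

fun rel_comp :: "'o \<times> 'm set \<times> 'o \<Rightarrow> 'o \<times> 'm set \<times> 'o \<Rightarrow> 'o \<times> 'm set \<times> 'o" where
  "rel_comp (B', S, D) (A, R, B) =
    (A, \<Union>{image_subobject (pairing (Pr1 C A B \<cdot> r \<cdot> p) (Pr2 C B' D \<cdot> s \<cdot> q)) | r s p q.
          r \<in> R \<and> s \<in> S \<and> is_pullback C (Pr2 C A B \<cdot> r) (Pr1 C B' D \<cdot> s) p q}, D)"

fun rel_tensor :: "'o \<times> 'm set \<times> 'o \<Rightarrow> 'o \<times> 'm set \<times> 'o \<Rightarrow> 'o \<times> 'm set \<times> 'o" where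
  "rel_tensor (A, R, B) (A', R', B') =
    (Prod C A A',
     \<Union>r \<in> R. \<Union>r' \<in> R'.
       (let p = Pr1 C (Dom C r) (Dom C r'); p' = Pr2 C (Dom C r) (Dom C r') in
        subobject (pairing
          (pairing (Pr1 C A B \<cdot> r \<cdot> p) (Pr1 C A' B' \<cdot> r' \<cdot> p'))
          (pairing (Pr2 C A B \<cdot> r \<cdot> p) (Pr2 C A' B' \<cdot> r' \<cdot> p')))),
     Prod C B B')"

fun rel_dagger :: "'o \<times> 'm set \<times> 'o \<Rightarrow> 'o \<times> 'm set \<times> 'o" where
  "rel_dagger (A, R, B) =
    (B, \<Union>r \<in> R. subobject (pairing (Pr2 C A B \<cdot> r) (Pr1 C A B \<cdot> r)), A)"

definition graph :: "'m \<Rightarrow> 'o \<times> 'm set \<times> 'o" where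
  "graph f = (Dom C f, subobject (pairing (Id C (Dom C f)) f), Cod C f)"

definition prod_assoc :: "'o \<Rightarrow> 'o \<Rightarrow> 'o \<Rightarrow> 'm" where
  "prod_assoc A B D =
    (let p = Pr1 C (Prod C A B) D; q = Pr2 C (Prod C A B) D in
     pairing (Pr1 C A B \<cdot> p) (pairing (Pr2 C A B \<cdot> p) q))"

definition prod_swap :: "'o \<Rightarrow> 'o \<Rightarrow> 'm" where
  "prod_swap A B = pairing (Pr2 C A B) (Pr1 C A B)"

end


section \<open>Symmetric monoidal dagger categories and the category of relations\<close>

text \<open>\<open>Assoc A B D : (A \<otimes> B) \<otimes> D \<rightarrow> A \<otimes> (B \<otimes> D)\<close>, \<open>Lunit A : I \<otimes> A \<rightarrow> A\<close>, \<open>Runit A : A \<otimes> I \<rightarrow> A\<close>,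
  \<open>Swap A B : A \<otimes> B \<rightarrow> B \<otimes> A\<close>. In a dagger monoidal category these are unitary, so their inverses
  are written below as daggers.\<close>

record ('o, 'm) dagger_monoidal = "('o, 'm) category" +
  TensorObj :: "'o \<Rightarrow> 'o \<Rightarrow> 'o"  (infixr "\<otimes>\<^sub>o\<index>" 75)
  Tensor :: "'m \<Rightarrow> 'm \<Rightarrow> 'm"  (infixr "\<otimes>\<index>" 75)
  Unit :: 'o
  Assoc :: "'o \<Rightarrow> 'o \<Rightarrow> 'o \<Rightarrow> 'm"
  Lunit :: "'o \<Rightarrow> 'm"
  Runit :: "'o \<Rightarrow> 'm"
  Swap :: "'o \<Rightarrow> 'o \<Rightarrow> 'm"
  Dagger :: "'m \<Rightarrow> 'm"  ("_\<dagger>\<index>" [1000] 999)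

definition Rel ::
  "('o, 'm, 'z) cartesian_category_scheme \<Rightarrow> ('o, 'o \<times> 'm set \<times> 'o) dagger_monoidal" where
  "Rel C = \<lparr>
    Obj = Obj C,
    Arr = rel_arrows C,
    Dom = (\<lambda>(A, R, B). A),
    Cod = (\<lambda>(A, R, B). B),
    Id = rel_id C,
    Comp = rel_comp C,
    TensorObj = Prod C,
    Tensor = rel_tensor C,
    Unit = Terminal C,
    Assoc = (\<lambda>A B D. graph C (prod_assoc C A B D)),
    Lunit = (\<lambda>A. graph C (Pr2 C (Terminal C) A)),
    Runit = (\<lambda>A. graph C (Pr1 C A (Terminal C))),
    Swap = (\<lambda>A B. graph C (prod_swap C A B)),
    Dagger = rel_dagger C\<rparr>"


section \<open>Special dagger Frobenius structures and broadcasting\<close>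

text \<open>The defining equations are usually written as if the monoidal structure were strict;
  the coherence isomorphisms are inserted explicitly here.\<close>

context
  fixes D :: "('o, 'm, 'z) dagger_monoidal_scheme" (structure)
begin

definition special_dagger_frobenius :: "'o \<Rightarrow> 'm \<Rightarrow> 'm \<Rightarrow> bool" where
  "special_dagger_frobenius A \<mu> \<eta> \<longleftrightarrow>
    A \<in> Obj D \<and> \<mu> \<in> hom D (A \<otimes>\<^sub>o A) A \<and> \<eta> \<in> hom D (Unit D) A \<and>
    \<mu> \<cdot> (Id D A \<otimes> \<eta>) = Runit D A \<and>
    \<mu> \<cdot> (\<eta> \<otimes> Id D A) = Lunit D A \<and>
    \<mu> \<cdot> (\<mu> \<otimes> Id D A) = \<mu> \<cdot> (Id D A \<otimes> \<mu>) \<cdot> Assoc D A A A \<and>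
    \<mu> \<cdot> \<mu>\<dagger> = Id D A \<and>
    (\<mu> \<otimes> Id D A) \<cdot> (Assoc D A A A)\<dagger> \<cdot> (Id D A \<otimes> \<mu>\<dagger>) =
      (Id D A \<otimes> \<mu>) \<cdot> Assoc D A A A \<cdot> (\<mu>\<dagger> \<otimes> Id D A)"

text \<open>The middle-four interchange \<open>id \<otimes> \<sigma> \<otimes> id : (A \<otimes> B) \<otimes> (A \<otimes> B) \<rightarrow> (A \<otimes> A) \<otimes> (B \<otimes> B)\<close>.\<close>

definition interchange :: "'o \<Rightarrow> 'o \<Rightarrow> 'm" where
  "interchange A B =
    (Assoc D A A (B \<otimes>\<^sub>o B))\<dagger> \<cdot>
    (Id D A \<otimes> (Assoc D A B B \<cdot> (Swap D B A \<otimes> Id D B) \<cdot> (Assoc D B A B)\<dagger>)) \<cdot>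
    Assoc D A B (A \<otimes>\<^sub>o B)"

definition tensor_mult :: "'o \<Rightarrow> 'm \<Rightarrow> 'o \<Rightarrow> 'm \<Rightarrow> 'm" where
  "tensor_mult A \<mu>\<^sub>A B \<mu>\<^sub>B = (\<mu>\<^sub>A \<otimes> \<mu>\<^sub>B) \<cdot> interchange A B"

definition choi :: "'o \<Rightarrow> 'm \<Rightarrow> 'o \<Rightarrow> 'm \<Rightarrow> 'm \<Rightarrow> 'm" where
  "choi A \<mu>\<^sub>A B \<mu>\<^sub>B f =
    (Id D A \<otimes> \<mu>\<^sub>B) \<cdot> Assoc D A B B \<cdot> ((Id D A \<otimes> f) \<otimes> Id D B) \<cdot> (\<mu>\<^sub>A\<dagger> \<otimes> Id D B)"

definition completely_positive :: "'o \<Rightarrow> 'm \<Rightarrow> 'o \<Rightarrow> 'm \<Rightarrow> 'm \<Rightarrow> bool" where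
  "completely_positive A \<mu>\<^sub>A B \<mu>\<^sub>B f \<longleftrightarrow>
    f \<in> hom D A B \<and>
    (\<exists>X \<in> Obj D. \<exists>g \<in> hom D (A \<otimes>\<^sub>o B) X. choi A \<mu>\<^sub>A B \<mu>\<^sub>B f = g\<dagger> \<cdot> g)"

definition broadcasting_map :: "'o \<Rightarrow> 'm \<Rightarrow> 'm \<Rightarrow> 'm \<Rightarrow> bool" where
  "broadcasting_map A \<mu> \<eta> \<beta> \<longleftrightarrow>
    completely_positive A \<mu> (A \<otimes>\<^sub>o A) (tensor_mult A \<mu> A \<mu>) \<beta> \<and>
    Runit D A \<cdot> (Id D A \<otimes> \<eta>\<dagger>) \<cdot> \<beta> = Id D A \<and>
    Lunit D A \<cdot> (\<eta>\<dagger> \<otimes> Id D A) \<cdot> \<beta> = Id D A"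

definition commutative_mult :: "'o \<Rightarrow> 'm \<Rightarrow> bool" where
  "commutative_mult A \<mu> \<longleftrightarrow> \<mu> \<cdot> Swap D A A = \<mu>"

definition no_broadcasting :: bool where
  "no_broadcasting \<longleftrightarrow>
    (\<forall>A \<mu> \<eta>. special_dagger_frobenius A \<mu> \<eta> \<and> (\<exists>\<beta>. broadcasting_map A \<mu> \<eta> \<beta>) \<longrightarrow>
      commutative_mult A \<mu>)"

end

end

theory Submission
  imports Defs
begin

text \<open>
  A relation \<open>F : A \<rightarrow> B\<close> is determined by the pairs of generalized elements \<open>f : X \<rightarrow> A\<close>, \<open>g : X \<rightarrow> B\<close>
  for which \<open>\<langle>f, g\<rangle>\<close> factors through it. In these terms an equation in \<open>Rel C\<close> is a statement of regular
  logic: converses, tensor products and graphs are evaluated pointwise, and the existential quantifier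
  in a composite becomes the existence of a witness after pulling back along a cover \<open>Y \<rightarrow> X\<close>
  (\<open>related_rel_comp_iff\<close>). Everything below is therefore an argument about elements. The only care it needs is
  that witnesses live over a cover; conclusions descend from there, because relations are local
  (\<open>related_local\<close>) and covers are epic (\<open>cover_epi\<close>).

  Write \<open>m(a, b, c)\<close> for \<open>\<mu>\<close>, \<open>U(u)\<close> for \<open>\<eta>\<close> and \<open>\<beta>(a; b, c)\<close> for the broadcasting map. The unit laws say that
  every \<open>a\<close> has a left unit \<open>l\<close> and a right unit \<open>r\<close>, and that multiplying by an element of \<open>U\<close> changes nothing;
  speciality makes \<open>m\<close> single-valued. One should think of \<open>A\<close> as the arrows of an internal groupoid, with
  \<open>U\<close> the identities. Commutativity follows in two steps.

  First, a broadcasting map forces every arrow to be an endomorphism (\<open>units_agree\<close>). The marginal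
  condition gives \<open>\<beta>(a; a, u)\<close> for some unit \<open>u\<close>. Hence the Choi relation of \<open>\<beta>\<close> relates
  \<open>(a, (r, u))\<close> to \<open>(l, (a, u))\<close>. A relation of the form \<open>g\<^sup>\<dagger> \<circ> g\<close> that relates \<open>p\<close> to \<open>q\<close> also relates \<open>p\<close> to \<open>p\<close>
  and \<open>q\<close> to \<open>q\<close> (\<open>positive_diagonal\<close>). Unfolding the Choi relation at these two diagonal points gives
  \<open>\<beta>(x; r, u)\<close> for some \<open>x\<close>, and \<open>\<beta>(l; y, u)\<close> for some \<open>y\<close>. In the first, both outputs are units, so the two
  marginal conditions yield \<open>r = x = u\<close>; in the second they yield \<open>y = l\<close> and then \<open>l = u\<close>. So \<open>l = r\<close>.

  Second, every relation in a Mal'cev category is difunctional (\<open>malcev_difunctional\<close>). If \<open>a\<close> and \<open>b\<close> have a product,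
  then by associativity the right unit \<open>u\<close> of \<open>a\<close> is a left unit of \<open>b\<close>, and by the first step \<open>u\<close> is a two-sided
  unit of both. The relation \<open>R(a, b)\<close>, saying that \<open>a\<close> and \<open>b\<close> have a common product in both orders, then
  contains \<open>(a, u)\<close>, \<open>(u, u)\<close> and \<open>(u, b)\<close>; by difunctionality it contains \<open>(a, b)\<close> (\<open>mult_commutes\<close>).
\<close>

section \<open>Arrows, pullbacks and coequalizers\<close>

context category
begin

text \<open>Typing is stated with \<open>Dom\<close> and \<open>Cod\<close> instead of hom-sets, so that the side conditions of these rewrite
  rules contain no variables that the rewritten term leaves undetermined, and the simplifier can discharge them.\<close>

lemma Comp_typing [simp]:
  assumes "f \<in> Arr C" "g \<in> Arr C" "Cod C f = Dom C g"
  shows "g \<cdot> f \<in> Arr C" "Dom C (g \<cdot> f) = Dom C f" "Cod C (g \<cdot> f) = Cod C g"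
  using Comp_in_hom[of f "Dom C f" "Cod C f" g "Cod C g"] assms by (auto simp: hom_def)

lemma Comp_assoc_seq [simp]:
  assumes "f \<in> Arr C" "g \<in> Arr C" "h \<in> Arr C" "Cod C f = Dom C g" "Cod C g = Dom C h"
  shows "(h \<cdot> g) \<cdot> f = h \<cdot> (g \<cdot> f)"
  using Comp_assoc[of f "Dom C f" "Cod C f" g "Cod C g" h "Cod C h"] assms by (auto simp: hom_def)

lemma Id_typing [simp]:
  assumes "X \<in> Obj C"
  shows "Id C X \<in> Arr C" "Dom C (Id C X) = X" "Cod C (Id C X) = X"
  using Id_in_hom[OF assms] by (auto simp: hom_def)

lemma Comp_Id [simp]:
  assumes "f \<in> Arr C"
  shows "Dom C f = X \<Longrightarrow> f \<cdot> Id C X = f" "Cod C f = Y \<Longrightarrow> Id C Y \<cdot> f = f"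
  using assms Comp_Id_right[of f X "Cod C f"] Comp_Id_left[of f "Dom C f" Y]
  by (auto simp: hom_def)

declare Dom_in_Obj [simp] Cod_in_Obj [simp]

lemma monic_cancel:
  "monic C m \<Longrightarrow> m \<cdot> f = m \<cdot> g \<Longrightarrow> f \<in> Arr C \<Longrightarrow> g \<in> Arr C \<Longrightarrow> Dom C f = Dom C g \<Longrightarrow>
    Cod C f = Dom C m \<Longrightarrow> Cod C g = Dom C m \<Longrightarrow> f = g"
  unfolding monic_def hom_def by blast

lemma monic_Arr [simp]: "monic C m \<Longrightarrow> m \<in> Arr C"
  by (simp add: monic_def)

lemma monicI:
  assumes "m \<in> Arr C"
    and "\<And>f g. f \<in> Arr C \<Longrightarrow> g \<in> Arr C \<Longrightarrow> Dom C f = Dom C g \<Longrightarrow> Cod C f = Dom C m \<Longrightarrow>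
      Cod C g = Dom C m \<Longrightarrow> m \<cdot> f = m \<cdot> g \<Longrightarrow> f = g"
  shows "monic C m"
  using assms unfolding monic_def hom_def by auto

lemma coequalizer_desc:
  assumes "is_coequalizer C u v e" "h \<in> hom C (Cod C u) Z" "h \<cdot> u = h \<cdot> v"
  shows "\<exists>!k. k \<in> hom C (Cod C e) Z \<and> k \<cdot> e = h"
  using assms unfolding is_coequalizer_def by blast

lemma pullback_typing:
  assumes "is_pullback C f g p q"
  shows "f \<in> Arr C" "g \<in> Arr C" "p \<in> Arr C" "q \<in> Arr C" "Cod C f = Cod C g"
    "Cod C p = Dom C f" "Cod C q = Dom C g" "Dom C q = Dom C p" "f \<cdot> p = g \<cdot> q"
  using assms by (auto simp: is_pullback_def hom_def)

lemma pullback_lift: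
  assumes "is_pullback C f g p q" "u \<in> Arr C" "v \<in> Arr C" "Dom C u = Dom C v"
    "Cod C u = Dom C f" "Cod C v = Dom C g" "f \<cdot> u = g \<cdot> v"
  obtains h where "h \<in> Arr C" "Dom C h = Dom C u" "Cod C h = Dom C p" "p \<cdot> h = u" "q \<cdot> h = v"
proof -
  have "u \<in> hom C (Dom C u) (Dom C f)" "v \<in> hom C (Dom C u) (Dom C g)"
    using assms by (simp_all add: hom_def)
  then have "\<exists>!h. h \<in> hom C (Dom C u) (Dom C p) \<and> p \<cdot> h = u \<and> q \<cdot> h = v"
    using assms(1,7) unfolding is_pullback_def by blast
  then show ?thesis using that by (auto simp: hom_def)
qed

lemma pullback_joint_cancel:
  assumes pb: "is_pullback C f g p q" and "h \<in> Arr C" "k \<in> Arr C" "Dom C h = Dom C k"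
    "Cod C h = Dom C p" "Cod C k = Dom C p" "p \<cdot> h = p \<cdot> k" "q \<cdot> h = q \<cdot> k"
  shows "h = k"
proof -
  note t = pullback_typing[OF pb]
  have "f \<cdot> p \<cdot> h = g \<cdot> q \<cdot> h"
    using t(1-8) assms(2,5) Comp_assoc_seq[of h p f] Comp_assoc_seq[of h q g] t(9) by simp
  moreover have "p \<cdot> h \<in> hom C (Dom C h) (Dom C f)" "q \<cdot> h \<in> hom C (Dom C h) (Dom C g)"
    using t(1-8) assms(2,5) by (simp_all add: hom_def)
  ultimately have "\<exists>!l. l \<in> hom C (Dom C h) (Dom C p) \<and> p \<cdot> l = p \<cdot> h \<and> q \<cdot> l = q \<cdot> h"
    using pb unfolding is_pullback_def by blast
  moreover have "h \<in> hom C (Dom C h) (Dom C p)" "k \<in> hom C (Dom C h) (Dom C p)"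
    using assms by (simp_all add: hom_def)
  ultimately show ?thesis using assms(7,8) by metis
qed

lemma pullback_monic:
  assumes pb: "is_pullback C f m p q" and "monic C m"
  shows "monic C p"
proof (rule monicI)
  note t = pullback_typing[OF pb]
  show "p \<in> Arr C" by (fact t)
  fix h k assume a: "h \<in> Arr C" "k \<in> Arr C" "Dom C h = Dom C k" "Cod C h = Dom C p" "Cod C k = Dom C p"
    "p \<cdot> h = p \<cdot> k"
  have "m \<cdot> q \<cdot> h = f \<cdot> p \<cdot> h"
    using t(1-8) a Comp_assoc_seq[of h p f] Comp_assoc_seq[of h q m] t(9) by simp
  also have "\<dots> = m \<cdot> q \<cdot> k"
    using t(1-8) a Comp_assoc_seq[of k p f] Comp_assoc_seq[of k q m] t(9) by simp
  finally have "q \<cdot> h = q \<cdot> k"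
    by (rule monic_cancel[OF assms(2)]) (use t a in simp_all)
  then show "h = k" using pullback_joint_cancel[OF pb] a by blast
qed

end

text \<open>Index category of cospans: \<open>0, 1, 2\<close> are the objects and their identities,
  \<open>3 : 0 \<rightarrow> 2\<close> and \<open>4 : 1 \<rightarrow> 2\<close> the two legs.\<close>

definition cospan_index :: "(nat, nat) category" where
  "cospan_index = \<lparr>Obj = {0, 1, 2}, Arr = {0, 1, 2, 3, 4},
    Dom = (\<lambda>n. if n = 3 then 0 else if n = 4 then 1 else n),
    Cod = (\<lambda>n. if n = 3 \<or> n = 4 then 2 else n),
    Id = (\<lambda>n. n), Comp = (\<lambda>g f. if f = 3 \<or> f = 4 then f else g)\<rparr>"

lemma category_cospan_index: "category cospan_index"
proof
  fix f assume "f \<in> Arr cospan_index"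
  then show "Dom cospan_index f \<in> Obj cospan_index" "Cod cospan_index f \<in> Obj cospan_index"
    by (auto simp: cospan_index_def)
next
  fix f g X Y Z assume "f \<in> hom cospan_index X Y" "g \<in> hom cospan_index Y Z"
  then show "g \<cdot>\<^bsub>cospan_index\<^esub> f \<in> hom cospan_index X Z"
    by (cases "f = 3 \<or> f = 4") (auto simp: cospan_index_def hom_def)
next
  fix f g h W X Y Z
  show "(h \<cdot>\<^bsub>cospan_index\<^esub> g) \<cdot>\<^bsub>cospan_index\<^esub> f = h \<cdot>\<^bsub>cospan_index\<^esub> (g \<cdot>\<^bsub>cospan_index\<^esub> f)"
    by (cases "f = 3 \<or> f = 4") (simp_all add: cospan_index_def)
qed (auto simp: cospan_index_def hom_def)

lemma (in category) pullback_exists: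
  assumes "has_finite_limits C" and fg: "f \<in> Arr C" "g \<in> Arr C" "Cod C f = Cod C g"
  obtains p q where "is_pullback C f g p q"
proof -
  let ?J = cospan_index
  define Fo where "Fo = (\<lambda>n::nat. if n = 0 then Dom C f else if n = 1 then Dom C g else Cod C g)"
  define Fm where "Fm = (\<lambda>n::nat. if n = 3 then f else if n = 4 then g else Id C (Fo n))"
  have F: "is_functor ?J C Fo Fm"
    using fg by (auto simp: is_functor_def cospan_index_def Fo_def Fm_def hom_def)
  have fin: "finite (Obj ?J)" "finite (Arr ?J)" by (simp_all add: cospan_index_def)
  obtain P \<pi> where L: "is_limit ?J C Fo Fm P \<pi>"
    using assms(1) category_cospan_index F fin unfolding has_finite_limits_def by blast
  have cone_iff: "is_cone ?J C Fo Fm X \<psi> \<longleftrightarrow> \<psi> 0 \<in> hom C X (Dom C f) \<and> \<psi> 1 \<in> hom C X (Dom C g) \<and>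
      \<psi> 2 = f \<cdot> \<psi> 0 \<and> \<psi> 2 = g \<cdot> \<psi> 1" for X \<psi>
    using fg by (auto simp: is_cone_def cospan_index_def Fo_def Fm_def hom_def)
  have c: "is_cone ?J C Fo Fm P \<pi>" using L by (simp add: is_limit_def)
  then have \<pi>: "\<pi> 0 \<in> hom C P (Dom C f)" "\<pi> 1 \<in> hom C P (Dom C g)"
      "\<pi> 2 = f \<cdot> \<pi> 0" "f \<cdot> \<pi> 0 = g \<cdot> \<pi> 1"
    unfolding cone_iff by metis+
  have P: "Dom C (\<pi> 0) = P" using \<pi>(1) by (simp add: hom_def)
  have "\<exists>!h. h \<in> hom C X P \<and> \<pi> 0 \<cdot> h = u \<and> \<pi> 1 \<cdot> h = v"
    if u: "u \<in> hom C X (Dom C f)" and v: "v \<in> hom C X (Dom C g)" and e: "f \<cdot> u = g \<cdot> v" for X u v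
  proof -
    define \<psi> where "\<psi> = (\<lambda>n::nat. if n = 0 then u else if n = 1 then v else f \<cdot> u)"
    have "is_cone ?J C Fo Fm X \<psi>" using u v e by (simp add: cone_iff \<psi>_def)
    then have ex: "\<exists>!h. h \<in> hom C X P \<and> (\<forall>i \<in> Obj ?J. \<pi> i \<cdot> h = \<psi> i)"
      using L by (simp add: is_limit_def)
    have "(h \<in> hom C X P \<and> (\<forall>i \<in> Obj ?J. \<pi> i \<cdot> h = \<psi> i)) \<longleftrightarrow>
        (h \<in> hom C X P \<and> \<pi> 0 \<cdot> h = u \<and> \<pi> 1 \<cdot> h = v)" for h
    proof -
      have Obj: "Obj ?J = {0, 1, 2}" by (simp add: cospan_index_def)
      have "\<pi> 2 \<cdot> h = f \<cdot> \<pi> 0 \<cdot> h" if "h \<in> hom C X P"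
        unfolding \<pi>(3) using that \<pi>(1) fg(1) by (simp add: hom_def)
      then show ?thesis unfolding Obj \<psi>_def by auto
    qed
    then show ?thesis using ex by presburger
  qed
  then have "is_pullback C f g (\<pi> 0) (\<pi> 1)"
    unfolding is_pullback_def P using fg \<pi> by blast
  then show ?thesis by (rule that)
qed

section \<open>Pairings into chosen products\<close>

locale cartesian_regular_category = regular_category C + chosen_finite_products C
  for C :: "('o, 'm, 'z) cartesian_category_scheme" (structure)
begin

declare Terminal_in_Obj [simp] Prod_in_Obj [simp]

lemma Pr_typing [simp]:
  assumes "A \<in> Obj C" "B \<in> Obj C"
  shows "Pr1 C A B \<in> Arr C" "Dom C (Pr1 C A B) = Prod C A B" "Cod C (Pr1 C A B) = A"
    "Pr2 C A B \<in> Arr C" "Dom C (Pr2 C A B) = Prod C A B" "Cod C (Pr2 C A B) = B"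
  using Pr1_in_hom[OF assms] Pr2_in_hom[OF assms] by (auto simp: hom_def)

lemma pairing_spec:
  assumes "f \<in> Arr C" "g \<in> Arr C" "Dom C f = Dom C g"
  shows "pairing C f g \<in> hom C (Dom C f) (Prod C (Cod C f) (Cod C g)) \<and>
    Pr1 C (Cod C f) (Cod C g) \<cdot> pairing C f g = f \<and> Pr2 C (Cod C f) (Cod C g) \<cdot> pairing C f g = g"
  unfolding pairing_def
  by (rule theI') (rule Prod_universal, use assms in \<open>auto simp: hom_def\<close>)

lemma pairing_typing [simp]:
  assumes "f \<in> Arr C" "g \<in> Arr C" "Dom C f = Dom C g"
  shows "pairing C f g \<in> Arr C" "Dom C (pairing C f g) = Dom C g"
    "Cod C (pairing C f g) = Prod C (Cod C f) (Cod C g)"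
  using pairing_spec[OF assms] assms by (auto simp: hom_def)

lemma Pr_pairing [simp]:
  assumes "f \<in> Arr C" "g \<in> Arr C" "Dom C f = Dom C g" "Cod C f = A" "Cod C g = B"
  shows "Pr1 C A B \<cdot> pairing C f g = f" "Pr2 C A B \<cdot> pairing C f g = g"
  using pairing_spec[OF assms(1-3)] assms(4,5) by auto

lemma Pr_pairing_Comp [simp]:
  assumes "f \<in> Arr C" "g \<in> Arr C" "Dom C f = Dom C g" "Cod C f = A" "Cod C g = B"
    "h \<in> Arr C" "Cod C h = Dom C f"
  shows "Pr1 C A B \<cdot> pairing C f g \<cdot> h = f \<cdot> h" "Pr2 C A B \<cdot> pairing C f g \<cdot> h = g \<cdot> h"
proof -
  have "A \<in> Obj C" "B \<in> Obj C" using assms by auto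
  then show "Pr1 C A B \<cdot> pairing C f g \<cdot> h = f \<cdot> h" "Pr2 C A B \<cdot> pairing C f g \<cdot> h = g \<cdot> h"
    using assms Comp_assoc_seq[of h "pairing C f g" "Pr1 C A B"]
      Comp_assoc_seq[of h "pairing C f g" "Pr2 C A B"] by (auto simp del: Comp_assoc_seq)
qed

text \<open>The projections are jointly monic: this is the uniqueness half of the universal property,
  with the mediating arrow eliminated.\<close>

lemma pairing_unique:
  assumes "h \<in> Arr C" "k \<in> Arr C" "Dom C h = Dom C k" "Cod C h = Prod C A B" "Cod C k = Prod C A B"
    "A \<in> Obj C" "B \<in> Obj C"
    "Pr1 C A B \<cdot> h = Pr1 C A B \<cdot> k" "Pr2 C A B \<cdot> h = Pr2 C A B \<cdot> k"
  shows "h = k"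
proof -
  have "Pr1 C A B \<cdot> h \<in> hom C (Dom C h) A" "Pr2 C A B \<cdot> h \<in> hom C (Dom C h) B"
    using assms(1,4,6,7) by (simp_all add: hom_def)
  from Prod_universal[OF assms(6,7) this]
  have "\<exists>!l. l \<in> hom C (Dom C h) (Prod C A B) \<and> Pr1 C A B \<cdot> l = Pr1 C A B \<cdot> h \<and>
      Pr2 C A B \<cdot> l = Pr2 C A B \<cdot> h" .
  moreover have "h \<in> hom C (Dom C h) (Prod C A B)" "k \<in> hom C (Dom C h) (Prod C A B)"
    using assms by (simp_all add: hom_def)
  ultimately show ?thesis using assms(8,9) by metis
qed

lemma pairing_eta [simp]:
  assumes "h \<in> Arr C" "Cod C h = Prod C A B" "A \<in> Obj C" "B \<in> Obj C"
  shows "pairing C (Pr1 C A B \<cdot> h) (Pr2 C A B \<cdot> h) = h"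
  by (rule pairing_unique[of _ _ A B]) (use assms in simp_all)

lemma pairing_Comp [simp]:
  assumes "f \<in> Arr C" "g \<in> Arr C" "Dom C f = Dom C g" "h \<in> Arr C" "Cod C h = Dom C f"
  shows "pairing C f g \<cdot> h = pairing C (f \<cdot> h) (g \<cdot> h)"
  by (rule pairing_unique[of _ _ "Cod C f" "Cod C g"]) (use assms in simp_all)

lemma pairing_eq_iff [simp]:
  assumes "f \<in> Arr C" "g \<in> Arr C" "Dom C f = Dom C g" "f' \<in> Arr C" "g' \<in> Arr C" "Dom C f' = Dom C g'"
    "Cod C f = Cod C f'" "Cod C g = Cod C g'"
  shows "pairing C f g = pairing C f' g' \<longleftrightarrow> f = f' \<and> g = g'"
proof
  assume eq: "pairing C f g = pairing C f' g'"
  show "f = f' \<and> g = g'"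
    using Pr_pairing[OF assms(1-3) refl refl] Pr_pairing[OF assms(4-6) refl refl]
    unfolding eq assms(7,8) by auto
qed auto

lemma pairing_cases:
  assumes "h \<in> Arr C" "Cod C h = Prod C A B" "A \<in> Obj C" "B \<in> Obj C"
  obtains f g where "h = pairing C f g" "f \<in> Arr C" "g \<in> Arr C" "Dom C f = Dom C g"
    "Cod C f = A" "Cod C g = B"
proof (rule that)
  show "h = pairing C (Pr1 C A B \<cdot> h) (Pr2 C A B \<cdot> h)" using assms by simp
qed (use assms in simp_all)

lemma Terminal_eq:
  assumes "f \<in> Arr C" "g \<in> Arr C" "Dom C f = Dom C g" "Cod C f = Terminal C" "Cod C g = Terminal C"
  shows "f = g"
  using Terminal_universal[of "Dom C f"] assms by (auto simp: hom_def)

definition bang :: "'o \<Rightarrow> 'm" where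
  "bang X = (THE h. h \<in> hom C X (Terminal C))"

lemma bang_typing [simp]:
  assumes "X \<in> Obj C"
  shows "bang X \<in> Arr C" "Dom C (bang X) = X" "Cod C (bang X) = Terminal C"
  using theI'[OF Terminal_universal[OF assms]] unfolding bang_def by (auto simp: hom_def)

lemma diag_simps [simp]:
  assumes "A \<in> Obj C"
  shows "diag C A \<in> Arr C" "Dom C (diag C A) = A" "Cod C (diag C A) = Prod C A A"
    "Cod C f = A \<Longrightarrow> f \<in> Arr C \<Longrightarrow> diag C A \<cdot> f = pairing C f f"
  using assms by (simp_all add: diag_def)

lemma diag_monic: "A \<in> Obj C \<Longrightarrow> monic C (diag C A)"
  by (rule monicI) simp_all

section \<open>Covers and image factorizations\<close>

lemma factors_through_iff:
  "f \<in> Arr C \<Longrightarrow> factors_through C f m \<longleftrightarrow>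
    (\<exists>h. h \<in> Arr C \<and> Dom C h = Dom C f \<and> Cod C h = Dom C m \<and> m \<cdot> h = f)"
  by (auto simp: factors_through_def hom_def)

lemma factors_through_Comp:
  assumes "factors_through C f m" "f \<in> Arr C" "m \<in> Arr C" "c \<in> Arr C" "Cod C c = Dom C f"
  shows "factors_through C (f \<cdot> c) m"
proof -
  obtain h where h: "h \<in> Arr C" "Dom C h = Dom C f" "Cod C h = Dom C m" "m \<cdot> h = f"
    using assms(1,2) by (auto simp: factors_through_iff)
  have "(m \<cdot> h) \<cdot> c = m \<cdot> (h \<cdot> c)" using h(1-3) assms(3-5) by simp
  then have "h \<cdot> c \<in> Arr C \<and> Dom C (h \<cdot> c) = Dom C (f \<cdot> c) \<and> Cod C (h \<cdot> c) = Dom C m \<and> m \<cdot> (h \<cdot> c) = f \<cdot> c"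
    using h assms(2-5) by simp
  then show ?thesis using assms(2,4,5) by (subst factors_through_iff) auto
qed

lemma factors_through_trans:
  assumes "factors_through C f m" "factors_through C m n" "f \<in> Arr C" "m \<in> Arr C" "n \<in> Arr C"
  shows "factors_through C f n"
proof -
  obtain h where h: "h \<in> Arr C" "Dom C h = Dom C f" "Cod C h = Dom C m" "m \<cdot> h = f"
    using assms(1,3) by (auto simp: factors_through_iff)
  obtain k where k: "k \<in> Arr C" "Dom C k = Dom C m" "Cod C k = Dom C n" "n \<cdot> k = m"
    using assms(2,4) by (auto simp: factors_through_iff)
  have "(n \<cdot> k) \<cdot> h = n \<cdot> (k \<cdot> h)" using h(1-3) k(1-3) assms(5) by simp
  then have "k \<cdot> h \<in> Arr C \<and> Dom C (k \<cdot> h) = Dom C f \<and> Cod C (k \<cdot> h) = Dom C n \<and> n \<cdot> (k \<cdot> h) = f"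
    using h k assms(5) by simp
  then show ?thesis using assms(3) by (subst factors_through_iff) auto
qed

text \<open>Covers are the arrows orthogonal to monomorphisms, in the weak form that is enough for descent:
  a subobject that contains \<open>k\<close> after restriction along \<open>c\<close> already contains \<open>k\<close>. Regular epimorphisms have this
  property, and unlike for them, closure under composition is immediate; witnesses of nested existential
  statements live over composites.\<close>

definition cover :: "'m \<Rightarrow> bool" where
  "cover c \<longleftrightarrow> c \<in> Arr C \<and> (\<forall>k m. k \<in> Arr C \<longrightarrow> Dom C k = Cod C c \<longrightarrow> monic C m \<longrightarrow>
    Cod C m = Cod C k \<longrightarrow> factors_through C (k \<cdot> c) m \<longrightarrow> factors_through C k m)"

lemma cover_Arr [simp]: "cover c \<Longrightarrow> c \<in> Arr C"
  by (simp add: cover_def)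

lemma cover_factors_through:
  "cover c \<Longrightarrow> factors_through C (k \<cdot> c) m \<Longrightarrow> k \<in> Arr C \<Longrightarrow> Dom C k = Cod C c \<Longrightarrow> monic C m \<Longrightarrow>
    Cod C m = Cod C k \<Longrightarrow> factors_through C k m"
  unfolding cover_def by blast

lemma cover_Id: "X \<in> Obj C \<Longrightarrow> cover (Id C X)"
  unfolding cover_def by simp

lemma cover_Comp: "cover c \<Longrightarrow> cover d \<Longrightarrow> Cod C d = Dom C c \<Longrightarrow> cover (c \<cdot> d)"
  unfolding cover_def[of "c \<cdot> d"]
proof (intro conjI allI impI)
  fix k m
  assume cd: "cover c" "cover d" "Cod C d = Dom C c"
    and k: "k \<in> Arr C" "Dom C k = Cod C (c \<cdot> d)" "monic C m" "Cod C m = Cod C k"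
      "factors_through C (k \<cdot> c \<cdot> d) m"
  have "factors_through C ((k \<cdot> c) \<cdot> d) m" using cd k by simp
  then have "factors_through C (k \<cdot> c) m"
    by (rule cover_factors_through[OF cd(2)]) (use cd k in simp_all)
  then show "factors_through C k m"
    by (rule cover_factors_through[OF cd(1)]) (use cd k in simp_all)
qed simp

text \<open>Equality of \<open>f\<close> and \<open>g\<close> means that \<open>\<langle>f, g\<rangle>\<close> lies in the diagonal, a subobject, so it descends along covers.\<close>

lemma cover_epi:
  assumes c: "cover c" and "f \<cdot> c = g \<cdot> c" "f \<in> Arr C" "g \<in> Arr C"
    "Dom C f = Cod C c" "Dom C g = Cod C c" "Cod C f = Cod C g"
  shows "f = g"
proof -
  have "factors_through C (pairing C f g \<cdot> c) (diag C (Cod C f))"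
    using assms by (auto simp: factors_through_iff intro!: exI[of _ "f \<cdot> c"])
  then have "factors_through C (pairing C f g) (diag C (Cod C f))"
    by (rule cover_factors_through[OF c]) (use assms in \<open>auto intro: diag_monic\<close>)
  then obtain h where "h \<in> Arr C" "Dom C h = Dom C f" "Cod C h = Cod C f" "pairing C h h = pairing C f g"
    using assms by (auto simp: factors_through_iff)
  then show ?thesis using assms by auto
qed

text \<open>If \<open>k e = m h\<close> and \<open>e\<close> coequalizes \<open>u\<close> and \<open>v\<close>, then so does \<open>h\<close> because \<open>m\<close> is monic; hence \<open>h\<close> factors
  through \<open>e\<close>, and cancelling \<open>e\<close> exhibits \<open>k\<close> as a multiple of \<open>m\<close>.\<close>

lemma regular_epi_cover:
  assumes "regular_epi C e"
  shows "cover e"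
proof -
  obtain u v where uv: "is_coequalizer C u v e" using assms unfolding regular_epi_def by blast
  then have t: "u \<in> Arr C" "v \<in> Arr C" "e \<in> Arr C" "Dom C v = Dom C u" "Cod C v = Cod C u"
      "Dom C e = Cod C u" "e \<cdot> u = e \<cdot> v"
    by (auto simp: is_coequalizer_def hom_def)
  note U = coequalizer_desc[OF uv]
  have "factors_through C k m"
    if k: "k \<in> Arr C" "Dom C k = Cod C e" and m: "monic C m" "Cod C m = Cod C k"
      and ke: "factors_through C (k \<cdot> e) m" for k m
  proof -
    obtain h where h: "h \<in> Arr C" "Dom C h = Dom C e" "Cod C h = Dom C m" "m \<cdot> h = k \<cdot> e"
      using k t ke by (auto simp: factors_through_iff)
    have "m \<cdot> (h \<cdot> u) = k \<cdot> e \<cdot> u"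
      using h(1-3) m k t(1-6) Comp_assoc_seq[of u h m] Comp_assoc_seq[of u e k] by (simp add: h(4))
    moreover have "m \<cdot> (h \<cdot> v) = k \<cdot> e \<cdot> v"
      using h(1-3) m k t(1-6) Comp_assoc_seq[of v h m] Comp_assoc_seq[of v e k] by (simp add: h(4))
    ultimately have "m \<cdot> (h \<cdot> u) = m \<cdot> (h \<cdot> v)" by (simp add: t(7))
    then have "h \<cdot> u = h \<cdot> v"
      by (rule monic_cancel[OF m(1)]) (use h(1-3) t in simp_all)
    then obtain s where s: "s \<in> Arr C" "Dom C s = Cod C e" "Cod C s = Dom C m" "s \<cdot> e = h"
      using U[of h "Dom C m"] h t by (auto simp: hom_def)
    have "(m \<cdot> s) \<cdot> e = k \<cdot> e" using s(1-3) m t(1-6) by (simp add: s(4) h(4))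
    moreover have "k \<cdot> e \<cdot> u = k \<cdot> e \<cdot> v" by (simp add: t(7))
    then have "\<exists>!l. l \<in> hom C (Cod C e) (Cod C k) \<and> l \<cdot> e = k \<cdot> e"
      using k t(1-6) by (intro U) (simp_all add: hom_def)
    moreover have "m \<cdot> s \<in> hom C (Cod C e) (Cod C k)" "k \<in> hom C (Cod C e) (Cod C k)"
      using s(1-3) m k by (simp_all add: hom_def)
    ultimately have "m \<cdot> s = k" by blast
    then show ?thesis using s k by (auto simp: factors_through_iff)
  qed
  then show ?thesis unfolding cover_def using t(3) by blast
qed

text \<open>Elements of the codomain of a regular epimorphism have preimages after passing to a cover. This is the
  only use of pullback stability.\<close>

lemma cover_lift:
  assumes e: "regular_epi C e" and f: "f \<in> Arr C" "Cod C f = Cod C e"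
  obtains c g where "cover c" "g \<in> Arr C" "Dom C g = Dom C c" "Cod C c = Dom C f" "Cod C g = Dom C e"
    "f \<cdot> c = e \<cdot> g"
proof -
  have "e \<in> Arr C" using regular_epi_cover[OF e] by simp
  then obtain p q where pb: "is_pullback C f e p q"
    using pullback_exists[OF finite_limits] f by metis
  show ?thesis
    using that[of p q] pullback_typing[OF pb] regular_epi_stable[OF e pb] regular_epi_cover by auto
qed

text \<open>The image is the coequalizer of the kernel pair. To see that the induced \<open>m\<close> is monic, lift two elements that
  \<open>m\<close> identifies to the domain of \<open>f\<close>, over a cover; there they form a pair in the kernel pair of \<open>f\<close>, which \<open>e\<close>
  identifies.\<close>

lemma image_exists:
  assumes f: "f \<in> Arr C"
  obtains m where "m \<in> image_subobject C f"
proof -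
  obtain p q where pb: "is_pullback C f f p q"
    using pullback_exists[OF finite_limits] f by metis
  note t = pullback_typing[OF pb]
  obtain e where e: "is_coequalizer C p q e"
    using kernel_pair_coequalizer pb unfolding is_kernel_pair_def by blast
  then have re: "regular_epi C e" by (auto simp: regular_epi_def)
  have te: "e \<in> Arr C" "Dom C e = Dom C f" "e \<cdot> p = e \<cdot> q"
    using e t by (auto simp: is_coequalizer_def hom_def)
  have "f \<in> hom C (Cod C p) (Cod C f)" using t by (simp add: hom_def)
  then have "\<exists>!k. k \<in> hom C (Cod C e) (Cod C f) \<and> k \<cdot> e = f"
    by (rule coequalizer_desc[OF e _ t(9)])
  then obtain m where m: "m \<in> Arr C" "Dom C m = Cod C e" "Cod C m = Cod C f" "m \<cdot> e = f"
    by (auto simp: hom_def)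
  have "monic C m"
  proof (rule monicI)
    fix a b assume ab: "a \<in> Arr C" "b \<in> Arr C" "Dom C a = Dom C b" "Cod C a = Dom C m" "Cod C b = Dom C m"
      "m \<cdot> a = m \<cdot> b"
    obtain c a' where c: "cover c" "a' \<in> Arr C" "Dom C a' = Dom C c" "Cod C c = Dom C a"
        "Cod C a' = Dom C e" "a \<cdot> c = e \<cdot> a'"
      using cover_lift[OF re, of a] ab m by metis
    obtain d b' where d: "cover d" "b' \<in> Arr C" "Dom C b' = Dom C d" "Cod C d = Dom C c"
        "Cod C b' = Dom C e" "(b \<cdot> c) \<cdot> d = e \<cdot> b'"
      using cover_lift[OF re, of "b \<cdot> c"] ab c m by (metis Comp_typing cover_Arr)
    have *: "f \<cdot> x = m \<cdot> e \<cdot> x" if "x \<in> Arr C" "Cod C x = Dom C e" for x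
      using that m te by (metis Comp_assoc_seq)
    have "f \<cdot> (a' \<cdot> d) = m \<cdot> (e \<cdot> a') \<cdot> d" using * c d te m by simp
    also have "\<dots> = m \<cdot> a \<cdot> c \<cdot> d" unfolding c(6)[symmetric] using c(1-5) d(1-5) ab(1-5) by simp
    also have "\<dots> = (m \<cdot> a) \<cdot> c \<cdot> d" using c(1-5) d(1-5) ab(1-5) m by simp
    also have "\<dots> = m \<cdot> (b \<cdot> c) \<cdot> d" unfolding ab(6) using c(1-5) d(1-5) ab(1-5) m by simp
    also have "\<dots> = f \<cdot> b'" using d * by simp
    finally obtain h where h: "h \<in> Arr C" "Dom C h = Dom C d" "Cod C h = Dom C p" "p \<cdot> h = a' \<cdot> d"
        "q \<cdot> h = b'"
      using pullback_lift[OF pb, of "a' \<cdot> d" b'] c d te by (metis Comp_typing cover_Arr)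
    have "a \<cdot> (c \<cdot> d) = (a \<cdot> c) \<cdot> d" using c(1-5) d(1-5) ab(1-5) by simp
    also have "\<dots> = e \<cdot> p \<cdot> h" unfolding c(6) h(4) using c(1-5) d(1-5) te by simp
    also have "\<dots> = (e \<cdot> p) \<cdot> h" using h(1-3) t te(1,2) by simp
    also have "\<dots> = e \<cdot> q \<cdot> h" unfolding te(3) using h(1-3) t te(1,2) by simp
    also have "\<dots> = (b \<cdot> c) \<cdot> d" unfolding h(5) d(6) ..
    also have "\<dots> = b \<cdot> (c \<cdot> d)" using c(1-5) d(1-5) ab(1-5) by simp
    finally show "a = b"
      by (rule cover_epi[OF cover_Comp[OF c(1) d(1) d(4)]]) (use ab c(1-5) d(1-5) in simp_all)
  qed (fact m)
  then have "m \<in> image_subobject C f"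
    unfolding image_subobject_def using m re te by (auto simp: hom_def)
  then show ?thesis by (rule that)
qed

text \<open>The image is the existential quantifier: an element lies in it iff it comes from an element of the
  domain after passing to a cover.\<close>

lemma factors_through_image_iff:
  assumes m: "m \<in> image_subobject C f" and "f \<in> Arr C" "k \<in> Arr C" "Cod C k = Cod C f"
  shows "factors_through C k m \<longleftrightarrow> (\<exists>c. cover c \<and> Cod C c = Dom C k \<and> factors_through C (k \<cdot> c) f)"
proof -
  obtain e where e: "monic C m" "Cod C m = Cod C f" "e \<in> Arr C" "Dom C e = Dom C f" "Cod C e = Dom C m"
      "regular_epi C e" "m \<cdot> e = f"
    using m by (auto simp: image_subobject_def hom_def)
  show ?thesis
  proof
    assume "factors_through C k m"
    then obtain h where h: "h \<in> Arr C" "Dom C h = Dom C k" "Cod C h = Dom C m" "m \<cdot> h = k"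
      using assms by (auto simp: factors_through_iff)
    obtain c g where c: "cover c" "g \<in> Arr C" "Dom C g = Dom C c" "Cod C c = Dom C h"
        "Cod C g = Dom C e" "h \<cdot> c = e \<cdot> g"
      using cover_lift[OF e(6), of h] h e by metis
    have "f \<cdot> g = m \<cdot> h \<cdot> c" unfolding c(6) e(7)[symmetric] using c(1-5) e(1-5) by simp
    also have "\<dots> = k \<cdot> c" unfolding h(4)[symmetric] using c(1-5) e(1-5) h(1-3) by simp
    finally show "\<exists>c. cover c \<and> Cod C c = Dom C k \<and> factors_through C (k \<cdot> c) f"
      using c(1-5) h(1-3) e(4) assms(3) by (intro exI[of _ c]) (auto simp: factors_through_iff)
  next
    assume "\<exists>c. cover c \<and> Cod C c = Dom C k \<and> factors_through C (k \<cdot> c) f"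
    then obtain c where c: "cover c" "Cod C c = Dom C k" "factors_through C (k \<cdot> c) f" by blast
    have "factors_through C f m" using e assms by (auto simp: factors_through_iff)
    then have "factors_through C (k \<cdot> c) m"
      by (rule factors_through_trans[OF c(3)]) (use c(1,2) e assms in simp_all)
    then show "factors_through C k m"
      by (rule cover_factors_through[OF c(1)]) (use c(1,2) e assms in simp_all)
  qed
qed

section \<open>Subobjects and relations on generalized elements\<close>

lemma factors_through_refl: "m \<in> Arr C \<Longrightarrow> factors_through C m m"
  by (subst factors_through_iff) (auto intro!: exI[of _ "Id C (Dom C m)"])

lemma subobject_mem:
  assumes "n \<in> subobject C m"
  shows "monic C n" "Cod C n = Cod C m" "factors_through C n m" "factors_through C m n"
  using assms by (auto simp: subobject_def)

lemma subobject_refl: "monic C m \<Longrightarrow> m \<in> subobject C m"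
  using factors_through_refl by (simp add: subobject_def)

lemma factors_through_subobject_iff:
  assumes "n \<in> subobject C m" "m \<in> Arr C" "k \<in> Arr C"
  shows "factors_through C k n \<longleftrightarrow> factors_through C k m"
  using factors_through_trans[of k n m] factors_through_trans[of k m n] subobject_mem[OF assms(1)] assms
  by auto

text \<open>Subobjects are determined by their generalized elements: test on the two monomorphisms themselves.\<close>

lemma subobject_eqI:
  assumes "m \<in> Arr C" "n \<in> Arr C" "Cod C m = Cod C n"
    and "\<And>k. k \<in> Arr C \<Longrightarrow> Cod C k = Cod C n \<Longrightarrow> factors_through C k m \<longleftrightarrow> factors_through C k n"
  shows "subobject C m = subobject C n"
proof -
  have mn: "factors_through C m n" "factors_through C n m"
    using assms(4)[of m] assms(4)[of n] assms(1-3) factors_through_refl by auto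
  have "factors_through C k m \<and> factors_through C m k \<longleftrightarrow> factors_through C k n \<and> factors_through C n k"
    if "k \<in> Arr C" "Cod C k = Cod C n" for k
    using assms(4)[OF that] factors_through_trans[OF mn(1) _ assms(1,2) that(1)]
      factors_through_trans[OF mn(2) _ assms(2,1) that(1)] by blast
  then show ?thesis unfolding subobject_def assms(3) by (intro Collect_cong) (use monic_Arr in blast)
qed

lemma regular_epi_iso_Comp:
  assumes e: "regular_epi C e" and i: "i \<in> Arr C" "j \<in> Arr C" "Dom C i = Cod C e" "Dom C j = Cod C i"
    "Cod C j = Dom C i" "j \<cdot> i = Id C (Dom C i)" "i \<cdot> j = Id C (Dom C j)"
  shows "regular_epi C (i \<cdot> e)"
proof -
  obtain u v where uv: "is_coequalizer C u v e" using e unfolding regular_epi_def by blast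
  then have t: "u \<in> Arr C" "v \<in> Arr C" "e \<in> Arr C" "Dom C v = Dom C u" "Cod C v = Cod C u"
      "Dom C e = Cod C u" and eq: "e \<cdot> u = e \<cdot> v"
    by (auto simp: is_coequalizer_def hom_def)
  have "\<exists>!k. k \<in> hom C (Cod C (i \<cdot> e)) Z \<and> k \<cdot> i \<cdot> e = h"
    if h: "h \<in> hom C (Cod C u) Z" "h \<cdot> u = h \<cdot> v" for h Z
  proof -
    have U: "\<exists>!k. k \<in> hom C (Cod C e) Z \<and> k \<cdot> e = h" by (rule coequalizer_desc[OF uv h])
    then obtain k where k: "k \<in> Arr C" "Dom C k = Cod C e" "Cod C k = Z" "k \<cdot> e = h"
      by (auto simp: hom_def)
    show ?thesis
    proof (rule ex1I[of _ "k \<cdot> j"], intro conjI)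
      show "k \<cdot> j \<in> hom C (Cod C (i \<cdot> e)) Z" using k(1-3) i(1-5) t by (simp add: hom_def)
      have "(k \<cdot> j) \<cdot> i \<cdot> e = k \<cdot> (j \<cdot> i) \<cdot> e" using k(1-3) i(1-5) t by simp
      also have "\<dots> = h" using i(1-6) k t by simp
      finally show "(k \<cdot> j) \<cdot> i \<cdot> e = h" .
    next
      fix l assume "l \<in> hom C (Cod C (i \<cdot> e)) Z \<and> l \<cdot> i \<cdot> e = h"
      then have l: "l \<in> Arr C" "Dom C l = Cod C i" "Cod C l = Z" "l \<cdot> i \<cdot> e = h"
        using i t by (auto simp: hom_def)
      have "l \<cdot> i \<in> hom C (Cod C e) Z \<and> (l \<cdot> i) \<cdot> e = h" "k \<in> hom C (Cod C e) Z \<and> k \<cdot> e = h"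
        using l i(1-5) t k by (simp_all add: hom_def)
      with U have li: "l \<cdot> i = k" by blast
      have "l = l \<cdot> (i \<cdot> j)" using l(1-3) i(2-4) unfolding i(7) by simp
      also have "\<dots> = (l \<cdot> i) \<cdot> j" using l(1-3) i(1-5) by simp
      finally show "l = k \<cdot> j" unfolding li .
    qed
  qed
  moreover have "(i \<cdot> e) \<cdot> u = (i \<cdot> e) \<cdot> v" using t i eq by simp
  ultimately have "is_coequalizer C u v (i \<cdot> e)"
    unfolding is_coequalizer_def using t i by (simp add: hom_def)
  then show ?thesis unfolding regular_epi_def by blast
qed

text \<open>All images of one arrow have the same elements, hence are isomorphic; conversely, composing the regular
  epimorphism with an isomorphism moves the factorization to any other representative of the subobject.\<close>

lemma image_subobject_eq:
  assumes m: "m \<in> image_subobject C f" and f: "f \<in> Arr C"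
  shows "image_subobject C f = subobject C m"
proof (intro equalityI subsetI)
  have mm: "monic C m" "Cod C m = Cod C f" using m by (auto simp: image_subobject_def)
  fix n assume n: "n \<in> image_subobject C f"
  have nn: "monic C n" "Cod C n = Cod C f" using n by (auto simp: image_subobject_def)
  have "factors_through C k n \<longleftrightarrow> factors_through C k m" if "k \<in> Arr C" "Cod C k = Cod C f" for k
    using factors_through_image_iff[OF n f that] factors_through_image_iff[OF m f that] by simp
  from this[of m] this[of n] show "n \<in> subobject C m"
    using mm nn factors_through_refl by (simp add: subobject_def)
next
  obtain e where e: "monic C m" "Cod C m = Cod C f" "e \<in> Arr C" "Dom C e = Dom C f" "Cod C e = Dom C m"
      "regular_epi C e" "m \<cdot> e = f"
    using m by (auto simp: image_subobject_def hom_def)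
  fix n assume n: "n \<in> subobject C m"
  note n' = subobject_mem[OF n]
  obtain i where i: "i \<in> Arr C" "Dom C i = Dom C m" "Cod C i = Dom C n" "n \<cdot> i = m"
    using n'(4) e(1) by (auto simp: factors_through_iff)
  obtain j where j: "j \<in> Arr C" "Dom C j = Dom C n" "Cod C j = Dom C m" "m \<cdot> j = n"
    using n'(1,3) by (auto simp: factors_through_iff)
  have "m \<cdot> (j \<cdot> i) = (m \<cdot> j) \<cdot> i" using i(1-3) j(1-3) e(1) by simp
  also have "\<dots> = m \<cdot> Id C (Dom C m)" unfolding j(4) i(4) using e(1) by simp
  finally have ji: "j \<cdot> i = Id C (Dom C i)"
    unfolding i(2) by (rule monic_cancel[OF e(1)]) (use i j e(1) in simp_all)
  have "n \<cdot> (i \<cdot> j) = (n \<cdot> i) \<cdot> j" using i(1-3) j(1-3) n'(1) by simp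
  also have "\<dots> = n \<cdot> Id C (Dom C n)" unfolding j(4) i(4) using n'(1) by simp
  finally have ij: "i \<cdot> j = Id C (Dom C j)"
    unfolding j(2) by (rule monic_cancel[OF n'(1)]) (use i j n'(1) in simp_all)
  have "regular_epi C (i \<cdot> e)"
    by (rule regular_epi_iso_Comp[OF e(6) i(1) j(1) _ _ _ ji ij]) (use i j e in simp_all)
  moreover have "n \<cdot> (i \<cdot> e) = (n \<cdot> i) \<cdot> e" using i(1-3) e(1-5) n'(1) by simp
  then have "n \<cdot> (i \<cdot> e) = f" unfolding i(4) e(7) .
  ultimately show "n \<in> image_subobject C f"
    unfolding image_subobject_def hom_def using n' e(1-5) i(1-3)
    by (auto intro!: exI[of _ "i \<cdot> e"])
qed

text \<open>Stated with some representative of the subobject; it does not matter which, see \<open>related_subobject\<close> below.\<close>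

definition related :: "'o \<times> 'm set \<times> 'o \<Rightarrow> 'm \<Rightarrow> 'm \<Rightarrow> bool" where
  "related F f g \<longleftrightarrow> (\<exists>r \<in> fst (snd F). factors_through C (pairing C f g) r)"

lemma hom_Rel_iff:
  "F \<in> hom (Rel C) A B \<longleftrightarrow> A \<in> Obj C \<and> B \<in> Obj C \<and>
    (\<exists>r. monic C r \<and> Cod C r = Prod C A B \<and> F = (A, subobject C r, B))"
  by (auto simp: hom_def Rel_def rel_arrows_def)

lemma hom_Rel_cases:
  assumes "F \<in> hom (Rel C) A B"
  obtains r where "A \<in> Obj C" "B \<in> Obj C" "monic C r" "Cod C r = Prod C A B" "F = (A, subobject C r, B)"
  using assms unfolding hom_Rel_iff by blast

lemma related_subobject:
  assumes "monic C r" "f \<in> Arr C" "g \<in> Arr C" "Dom C f = Dom C g"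
  shows "related (A, subobject C r, B) f g \<longleftrightarrow> factors_through C (pairing C f g) r"
proof -
  have "factors_through C (pairing C f g) n \<longleftrightarrow> factors_through C (pairing C f g) r"
    if "n \<in> subobject C r" for n
    by (rule factors_through_subobject_iff[OF that]) (use assms in simp_all)
  then show ?thesis using subobject_refl[OF assms(1)] unfolding related_def fst_conv snd_conv by blast
qed

text \<open>The principle that turns equations in \<open>Rel C\<close> into statements about elements.\<close>

lemma Rel_eqI:
  assumes F: "F \<in> hom (Rel C) A B" and G: "G \<in> hom (Rel C) A B"
    and eq: "\<And>f g. f \<in> Arr C \<Longrightarrow> g \<in> Arr C \<Longrightarrow> Dom C f = Dom C g \<Longrightarrow> Cod C f = A \<Longrightarrow> Cod C g = B \<Longrightarrow>
      related F f g \<longleftrightarrow> related G f g"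
  shows "F = G"
proof -
  obtain r where r: "A \<in> Obj C" "B \<in> Obj C" "monic C r" "Cod C r = Prod C A B" "F = (A, subobject C r, B)"
    using F by (rule hom_Rel_cases)
  obtain s where s: "monic C s" "Cod C s = Prod C A B" "G = (A, subobject C s, B)"
    using G by (rule hom_Rel_cases)
  have "subobject C r = subobject C s"
  proof (rule subobject_eqI)
    fix k assume k: "k \<in> Arr C" "Cod C k = Cod C s"
    obtain f g where k: "k = pairing C f g" "f \<in> Arr C" "g \<in> Arr C" "Dom C f = Dom C g"
         "Cod C f = A" "Cod C g = B"
      using pairing_cases[of k A B] k r s by metis
    then show "factors_through C k r \<longleftrightarrow> factors_through C k s"
      using eq[of f g] related_subobject[OF r(3), of f g] related_subobject[OF s(1), of f g]
      unfolding r(5) s(3) by simp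
  qed (use r s in simp_all)
  then show ?thesis unfolding r s by simp
qed

lemma related_stable:
  assumes "related F f g" "F \<in> hom (Rel C) A B" "f \<in> Arr C" "g \<in> Arr C" "Dom C f = Dom C g"
    "Cod C f = A" "Cod C g = B" "c \<in> Arr C" "Cod C c = Dom C f"
  shows "related F (f \<cdot> c) (g \<cdot> c)"
proof -
  obtain r where r: "monic C r" "Cod C r = Prod C A B" "F = (A, subobject C r, B)"
    using assms(2) by (rule hom_Rel_cases)
  have "factors_through C (pairing C f g \<cdot> c) r"
    by (rule factors_through_Comp) (use assms r related_subobject[OF r(1), of f g] in simp_all)
  then show ?thesis using assms r by (simp add: related_subobject)
qed

lemma related_local:
  assumes "related F (f \<cdot> c) (g \<cdot> c)" "cover c" "F \<in> hom (Rel C) A B" "f \<in> Arr C" "g \<in> Arr C"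
    "Dom C f = Dom C g" "Cod C f = A" "Cod C g = B" "Cod C c = Dom C f"
  shows "related F f g"
proof -
  obtain r where r: "monic C r" "Cod C r = Prod C A B" "F = (A, subobject C r, B)"
    using assms(3) by (rule hom_Rel_cases)
  have "factors_through C (pairing C f g \<cdot> c) r"
    using assms r by (simp add: related_subobject)
  then have "factors_through C (pairing C f g) r"
    by (rule cover_factors_through[OF assms(2)]) (use assms r in simp_all)
  then show ?thesis using assms r by (simp add: related_subobject)
qed

section \<open>Composition, tensor, converse and graphs on generalized elements\<close>

text \<open>The middle element \<open>b\<close> is the common value, at an element of the pullback, of the two legs into \<open>B\<close>.\<close>

lemma factors_through_composite_iff:
  assumes r: "r \<in> Arr C" "Cod C r = Prod C A B" and s: "s \<in> Arr C" "Cod C s = Prod C B D"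
    and Obj: "A \<in> Obj C" "B \<in> Obj C" "D \<in> Obj C"
    and pb: "is_pullback C (Pr2 C A B \<cdot> r) (Pr1 C B D \<cdot> s) p q"
    and fg: "f \<in> Arr C" "g \<in> Arr C" "Dom C f = Dom C g" "Cod C f = A" "Cod C g = D"
  shows "factors_through C (pairing C f g) (pairing C (Pr1 C A B \<cdot> r \<cdot> p) (Pr2 C B D \<cdot> s \<cdot> q)) \<longleftrightarrow>
    (\<exists>b. b \<in> Arr C \<and> Dom C b = Dom C f \<and> Cod C b = B \<and>
      factors_through C (pairing C f b) r \<and> factors_through C (pairing C b g) s)"
proof -
  note t = pullback_typing[OF pb]
  have t': "p \<in> Arr C" "q \<in> Arr C" "Cod C p = Dom C r" "Cod C q = Dom C s" "Dom C q = Dom C p"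
    using t r s Obj by simp_all
  have eq: "Pr2 C A B \<cdot> r \<cdot> p = Pr1 C B D \<cdot> s \<cdot> q"
    using t(9) t' r s Obj by simp
  show ?thesis
  proof
    assume "factors_through C (pairing C f g) (pairing C (Pr1 C A B \<cdot> r \<cdot> p) (Pr2 C B D \<cdot> s \<cdot> q))"
    then obtain h where h: "h \<in> Arr C" "Dom C h = Dom C f" "Cod C h = Dom C p"
        "pairing C (Pr1 C A B \<cdot> r \<cdot> p) (Pr2 C B D \<cdot> s \<cdot> q) \<cdot> h = pairing C f g"
      using t' r s Obj fg by (auto simp: factors_through_iff)
    have hf: "Pr1 C A B \<cdot> r \<cdot> p \<cdot> h = f" "Pr2 C B D \<cdot> s \<cdot> q \<cdot> h = g"
      using h t' r s Obj fg by simp_all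
    define b where "b = Pr2 C A B \<cdot> r \<cdot> p \<cdot> h"
    have "b = (Pr2 C A B \<cdot> r \<cdot> p) \<cdot> h" unfolding b_def using h(1-3) t' r s Obj by simp
    also have "\<dots> = Pr1 C B D \<cdot> s \<cdot> q \<cdot> h" unfolding eq using h(1-3) t' r s Obj by simp
    finally have b': "b = Pr1 C B D \<cdot> s \<cdot> q \<cdot> h" .
    have bt: "b \<in> Arr C" "Dom C b = Dom C f" "Cod C b = B"
      unfolding b_def using h(1-3) t' r s Obj by simp_all
    have rph: "r \<cdot> (p \<cdot> h) = pairing C f b"
      unfolding b_def hf(1)[symmetric] using h(1-3) t' r s Obj by simp
    have sqh: "s \<cdot> (q \<cdot> h) = pairing C b g"
      unfolding b' hf(2)[symmetric] using h(1-3) t' r s Obj by simp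
    have "factors_through C (pairing C f b) r"
      using rph bt fg h(1-3) t' by (auto simp: factors_through_iff intro!: exI[of _ "p \<cdot> h"])
    moreover have "factors_through C (pairing C b g) s"
      using sqh bt fg h(1-3) t' by (auto simp: factors_through_iff intro!: exI[of _ "q \<cdot> h"])
    ultimately show "\<exists>b. b \<in> Arr C \<and> Dom C b = Dom C f \<and> Cod C b = B \<and>
        factors_through C (pairing C f b) r \<and> factors_through C (pairing C b g) s"
      using bt by blast
  next
    assume "\<exists>b. b \<in> Arr C \<and> Dom C b = Dom C f \<and> Cod C b = B \<and>
        factors_through C (pairing C f b) r \<and> factors_through C (pairing C b g) s"
    then obtain b where b: "b \<in> Arr C" "Dom C b = Dom C f" "Cod C b = B"
        "factors_through C (pairing C f b) r" "factors_through C (pairing C b g) s" by blast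
    obtain x where x: "x \<in> Arr C" "Dom C x = Dom C f" "Cod C x = Dom C r" "r \<cdot> x = pairing C f b"
      using b fg by (auto simp: factors_through_iff)
    obtain y where y: "y \<in> Arr C" "Dom C y = Dom C f" "Cod C y = Dom C s" "s \<cdot> y = pairing C b g"
      using b fg by (auto simp: factors_through_iff)
    obtain h where h: "h \<in> Arr C" "Dom C h = Dom C f" "Cod C h = Dom C p" "p \<cdot> h = x" "q \<cdot> h = y"
      by (rule pullback_lift[OF pb, of x y]) (use x y b fg r s Obj in simp_all)
    have "pairing C (Pr1 C A B \<cdot> r \<cdot> p) (Pr2 C B D \<cdot> s \<cdot> q) \<cdot> h = pairing C f g"
      using h x y b(1-3) fg r s Obj t' by simp
    then show "factors_through C (pairing C f g) (pairing C (Pr1 C A B \<cdot> r \<cdot> p) (Pr2 C B D \<cdot> s \<cdot> q))"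
      using h(1-3) fg r s Obj t' by (auto simp: factors_through_iff intro!: exI[of _ h])
  qed
qed

text \<open>A composite is a union over all representatives and all choices of pullback. Whatever the choice, membership
  in the image is described by the right-hand side of the second claim, which mentions only \<open>F\<close> and \<open>G\<close>; so all the
  images in the union represent one and the same subobject.\<close>

lemma
  assumes F: "F \<in> hom (Rel C) A B" and G: "G \<in> hom (Rel C) B D"
  shows rel_comp_in_hom: "rel_comp C G F \<in> hom (Rel C) A D"
    and related_rel_comp_iff: "f \<in> Arr C \<Longrightarrow> g \<in> Arr C \<Longrightarrow> Dom C f = Dom C g \<Longrightarrow> Cod C f = A \<Longrightarrow> Cod C g = D \<Longrightarrow>
      related (rel_comp C G F) f g \<longleftrightarrow>
      (\<exists>c b. cover c \<and> Cod C c = Dom C f \<and> b \<in> Arr C \<and> Dom C b = Dom C c \<and> Cod C b = B \<and>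
        related F (f \<cdot> c) b \<and> related G b (g \<cdot> c))"
proof -
  obtain r0 where r0: "A \<in> Obj C" "B \<in> Obj C" "monic C r0" "Cod C r0 = Prod C A B" "F = (A, subobject C r0, B)"
    using F by (rule hom_Rel_cases)
  obtain s0 where s0: "D \<in> Obj C" "monic C s0" "Cod C s0 = Prod C B D" "G = (B, subobject C s0, D)"
    using G by (rule hom_Rel_cases)
  define h where "h r s p q = pairing C (Pr1 C A B \<cdot> r \<cdot> p) (Pr2 C B D \<cdot> s \<cdot> q)" for r s p q
  define ok where "ok r s p q \<longleftrightarrow> r \<in> subobject C r0 \<and> s \<in> subobject C s0 \<and>
    is_pullback C (Pr2 C A B \<cdot> r) (Pr1 C B D \<cdot> s) p q" for r s p q
  have h_typing: "h r s p q \<in> Arr C" "Cod C (h r s p q) = Prod C A D" if "ok r s p q" for r s p q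
  proof -
    from that have r: "r \<in> Arr C" "Cod C r = Prod C A B" and s: "s \<in> Arr C" "Cod C s = Prod C B D"
      and pb: "is_pullback C (Pr2 C A B \<cdot> r) (Pr1 C B D \<cdot> s) p q"
      using subobject_mem[of r r0] subobject_mem[of s s0] r0 s0 unfolding ok_def by auto
    show "h r s p q \<in> Arr C" "Cod C (h r s p q) = Prod C A D"
      unfolding h_def using pullback_typing[OF pb] r s r0(1,2) s0(1) by simp_all
  qed
  have key: "factors_through C (pairing C f g) m \<longleftrightarrow>
      (\<exists>c b. cover c \<and> Cod C c = Dom C f \<and> b \<in> Arr C \<and> Dom C b = Dom C c \<and> Cod C b = B \<and>
        related F (f \<cdot> c) b \<and> related G b (g \<cdot> c))"
    if ok: "ok r s p q" and m: "m \<in> image_subobject C (h r s p q)"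
      and fg: "f \<in> Arr C" "g \<in> Arr C" "Dom C f = Dom C g" "Cod C f = A" "Cod C g = D"
    for r s p q m f g
  proof -
    from ok have r: "r \<in> Arr C" "Cod C r = Prod C A B" "r \<in> subobject C r0"
      and s: "s \<in> Arr C" "Cod C s = Prod C B D" "s \<in> subobject C s0"
      and pb: "is_pullback C (Pr2 C A B \<cdot> r) (Pr1 C B D \<cdot> s) p q"
      using subobject_mem[of r r0] subobject_mem[of s s0] r0 s0 unfolding ok_def by auto
    have "factors_through C (pairing C f g \<cdot> c) (h r s p q) \<longleftrightarrow>
        (\<exists>b. b \<in> Arr C \<and> Dom C b = Dom C c \<and> Cod C b = B \<and> related F (f \<cdot> c) b \<and> related G b (g \<cdot> c))"
      if c: "cover c" "Cod C c = Dom C f" for c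
    proof -
      have "factors_through C (pairing C (f \<cdot> c) b) r \<longleftrightarrow> related F (f \<cdot> c) b"
        "factors_through C (pairing C b (g \<cdot> c)) s \<longleftrightarrow> related G b (g \<cdot> c)"
        if "b \<in> Arr C" "Dom C b = Dom C c" "Cod C b = B" for b
        using that c fg r0 s0 factors_through_subobject_iff[OF r(3), of "pairing C (f \<cdot> c) b"]
          factors_through_subobject_iff[OF s(3), of "pairing C b (g \<cdot> c)"]
        by (simp_all add: related_subobject)
      moreover have "pairing C f g \<cdot> c = pairing C (f \<cdot> c) (g \<cdot> c)" using fg c by simp
      moreover have "factors_through C (pairing C (f \<cdot> c) (g \<cdot> c)) (h r s p q) \<longleftrightarrow>
          (\<exists>b. b \<in> Arr C \<and> Dom C b = Dom C (f \<cdot> c) \<and> Cod C b = B \<and>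
            factors_through C (pairing C (f \<cdot> c) b) r \<and> factors_through C (pairing C b (g \<cdot> c)) s)"
        unfolding h_def by (rule factors_through_composite_iff[OF r(1,2) s(1,2) _ _ _ pb])
          (use fg c r0 s0 in simp_all)
      moreover have "Dom C (f \<cdot> c) = Dom C c" using fg c by simp
      ultimately show ?thesis by auto
    qed
    moreover have "factors_through C (pairing C f g) m \<longleftrightarrow>
        (\<exists>c. cover c \<and> Cod C c = Dom C (pairing C f g) \<and> factors_through C (pairing C f g \<cdot> c) (h r s p q))"
      by (rule factors_through_image_iff[OF m h_typing(1)[OF ok]]) (use h_typing(2)[OF ok] fg in simp_all)
    moreover have "Dom C (pairing C f g) = Dom C f" using fg by simp
    ultimately show ?thesis by auto
  qed
  have r0s0: "r0 \<in> subobject C r0" "s0 \<in> subobject C s0" using subobject_refl r0 s0 by auto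
  obtain p0 q0 where ok0: "ok r0 s0 p0 q0"
    unfolding ok_def using pullback_exists[OF finite_limits, of "Pr2 C A B \<cdot> r0" "Pr1 C B D \<cdot> s0"] r0s0 r0 s0
    by auto
  obtain m where m: "m \<in> image_subobject C (h r0 s0 p0 q0)"
    using image_exists[OF h_typing(1)[OF ok0]] .
  have mm: "monic C m" "Cod C m = Prod C A D"
    using m h_typing[OF ok0] by (auto simp: image_subobject_def)
  have img: "image_subobject C (h r s p q) = subobject C m" if ok: "ok r s p q" for r s p q
  proof -
    obtain n where n: "n \<in> image_subobject C (h r s p q)"
      using image_exists[OF h_typing(1)[OF ok]] .
    have nn: "monic C n" "Cod C n = Prod C A D"
      using n h_typing[OF ok] by (auto simp: image_subobject_def)
    have "subobject C n = subobject C m"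
    proof (rule subobject_eqI)
      fix k assume k: "k \<in> Arr C" "Cod C k = Cod C m"
      obtain f g where k: "k = pairing C f g" "f \<in> Arr C" "g \<in> Arr C" "Dom C f = Dom C g"
           "Cod C f = A" "Cod C g = D"
        using pairing_cases[of k A D] k r0(1) s0(1) mm by metis
      from key[OF ok n k(2-6)] key[OF ok0 m k(2-6)]
      show "factors_through C k n \<longleftrightarrow> factors_through C k m" unfolding k(1) by simp
    qed (use mm nn in simp_all)
    then show ?thesis using image_subobject_eq[OF n h_typing(1)[OF ok]] by simp
  qed
  have "rel_comp C G F = (A, \<Union>{image_subobject C (h r s p q) | r s p q. ok r s p q}, D)"
    unfolding r0(5) s0(4) by (simp add: h_def ok_def)
  also have "\<dots> = (A, subobject C m, D)" using img ok0 by blast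
  finally have eq: "rel_comp C G F = (A, subobject C m, D)" .
  show "rel_comp C G F \<in> hom (Rel C) A D" unfolding eq hom_Rel_iff using r0 s0 mm by blast
  assume fg: "f \<in> Arr C" "g \<in> Arr C" "Dom C f = Dom C g" "Cod C f = A" "Cod C g = D"
  show "related (rel_comp C G F) f g \<longleftrightarrow>
      (\<exists>c b. cover c \<and> Cod C c = Dom C f \<and> b \<in> Arr C \<and> Dom C b = Dom C c \<and> Cod C b = B \<and>
        related F (f \<cdot> c) b \<and> related G b (g \<cdot> c))"
    unfolding eq related_subobject[OF mm(1) fg(1-3)] by (rule key[OF ok0 m fg])
qed

text \<open>The product \<open>r \<times> r'\<close>, followed by the interchange of the two middle factors of its codomain
  \<open>(A \<times> B) \<times> (A' \<times> B')\<close>.\<close>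

definition tensor_mono :: "'o \<Rightarrow> 'o \<Rightarrow> 'o \<Rightarrow> 'o \<Rightarrow> 'm \<Rightarrow> 'm \<Rightarrow> 'm" where
  "tensor_mono A B A' B' r r' =
    (let p = Pr1 C (Dom C r) (Dom C r'); p' = Pr2 C (Dom C r) (Dom C r') in
      pairing C
        (pairing C (Pr1 C A B \<cdot> r \<cdot> p) (Pr1 C A' B' \<cdot> r' \<cdot> p'))
        (pairing C (Pr2 C A B \<cdot> r \<cdot> p) (Pr2 C A' B' \<cdot> r' \<cdot> p')))"

lemma tensor_mono_props:
  assumes Obj: "A \<in> Obj C" "B \<in> Obj C" "A' \<in> Obj C" "B' \<in> Obj C"
    and r: "monic C r" "Cod C r = Prod C A B" and r': "monic C r'" "Cod C r' = Prod C A' B'"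
  shows "tensor_mono A B A' B' r r' \<in> Arr C"
    and "Cod C (tensor_mono A B A' B' r r') = Prod C (Prod C A A') (Prod C B B')"
    and "monic C (tensor_mono A B A' B' r r')"
    and "f \<in> Arr C \<Longrightarrow> g \<in> Arr C \<Longrightarrow> f' \<in> Arr C \<Longrightarrow> g' \<in> Arr C \<Longrightarrow> Dom C f = Dom C g \<Longrightarrow>
      Dom C f' = Dom C g \<Longrightarrow> Dom C g' = Dom C g \<Longrightarrow> Cod C f = A \<Longrightarrow> Cod C g = B \<Longrightarrow> Cod C f' = A' \<Longrightarrow>
      Cod C g' = B' \<Longrightarrow>
      factors_through C (pairing C (pairing C f f') (pairing C g g')) (tensor_mono A B A' B' r r') \<longleftrightarrow>
        factors_through C (pairing C f g) r \<and> factors_through C (pairing C f' g') r'"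
proof -
  let ?t = "tensor_mono A B A' B' r r'" and ?R = "Dom C r" and ?R' = "Dom C r'"
  have R: "?R \<in> Obj C" "?R' \<in> Obj C" using r r' by simp_all
  note ty = Obj r r' R
  show t: "?t \<in> Arr C" and "Cod C ?t = Prod C (Prod C A A') (Prod C B B')"
    using ty by (simp_all add: tensor_mono_def Let_def)
  have d: "Dom C ?t = Prod C ?R ?R'" using ty by (simp add: tensor_mono_def Let_def)
  have comp: "?t \<cdot> h = pairing C
        (pairing C (Pr1 C A B \<cdot> r \<cdot> Pr1 C ?R ?R' \<cdot> h) (Pr1 C A' B' \<cdot> r' \<cdot> Pr2 C ?R ?R' \<cdot> h))
        (pairing C (Pr2 C A B \<cdot> r \<cdot> Pr1 C ?R ?R' \<cdot> h) (Pr2 C A' B' \<cdot> r' \<cdot> Pr2 C ?R ?R' \<cdot> h))"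
    if "h \<in> Arr C" "Cod C h = Prod C ?R ?R'" for h
    using ty that by (simp add: tensor_mono_def Let_def)
  show "monic C ?t"
  proof (rule monicI[OF t])
    fix a b assume ab: "a \<in> Arr C" "b \<in> Arr C" "Dom C a = Dom C b" "Cod C a = Dom C ?t" "Cod C b = Dom C ?t"
      and eq: "?t \<cdot> a = ?t \<cdot> b"
    note ab' = ab(1-3) ab(4,5)[unfolded d]
    have *: "Pr1 C A B \<cdot> r \<cdot> Pr1 C ?R ?R' \<cdot> a = Pr1 C A B \<cdot> r \<cdot> Pr1 C ?R ?R' \<cdot> b"
      "Pr1 C A' B' \<cdot> r' \<cdot> Pr2 C ?R ?R' \<cdot> a = Pr1 C A' B' \<cdot> r' \<cdot> Pr2 C ?R ?R' \<cdot> b"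
      "Pr2 C A B \<cdot> r \<cdot> Pr1 C ?R ?R' \<cdot> a = Pr2 C A B \<cdot> r \<cdot> Pr1 C ?R ?R' \<cdot> b"
      "Pr2 C A' B' \<cdot> r' \<cdot> Pr2 C ?R ?R' \<cdot> a = Pr2 C A' B' \<cdot> r' \<cdot> Pr2 C ?R ?R' \<cdot> b"
      using eq unfolding comp[OF ab'(1,4)] comp[OF ab'(2,5)] using ty ab' by simp_all
    have "r \<cdot> Pr1 C ?R ?R' \<cdot> a = r \<cdot> Pr1 C ?R ?R' \<cdot> b"
      by (rule pairing_unique[OF _ _ _ _ _ Obj(1,2) *(1,3)]) (use ty ab' in simp_all)
    then have 1: "Pr1 C ?R ?R' \<cdot> a = Pr1 C ?R ?R' \<cdot> b"
      by (rule monic_cancel[OF r(1)]) (use ty ab' in simp_all)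
    have "r' \<cdot> Pr2 C ?R ?R' \<cdot> a = r' \<cdot> Pr2 C ?R ?R' \<cdot> b"
      by (rule pairing_unique[OF _ _ _ _ _ Obj(3,4) *(2,4)]) (use ty ab' in simp_all)
    then have 2: "Pr2 C ?R ?R' \<cdot> a = Pr2 C ?R ?R' \<cdot> b"
      by (rule monic_cancel[OF r'(1)]) (use ty ab' in simp_all)
    show "a = b" by (rule pairing_unique[OF ab'(1-5) R 1 2])
  qed
  assume fg: "f \<in> Arr C" "g \<in> Arr C" "f' \<in> Arr C" "g' \<in> Arr C" "Dom C f = Dom C g"
    "Dom C f' = Dom C g" "Dom C g' = Dom C g" "Cod C f = A" "Cod C g = B" "Cod C f' = A'" "Cod C g' = B'"
  show "factors_through C (pairing C (pairing C f f') (pairing C g g')) ?t \<longleftrightarrow>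
        factors_through C (pairing C f g) r \<and> factors_through C (pairing C f' g') r'" (is "?lhs \<longleftrightarrow> ?rhs")
  proof
    assume ?lhs
    then obtain h where h: "h \<in> Arr C" "Dom C h = Dom C g" "Cod C h = Prod C ?R ?R'"
        "?t \<cdot> h = pairing C (pairing C f f') (pairing C g g')"
      using fg d by (auto simp: factors_through_iff)
    have *: "Pr1 C A B \<cdot> r \<cdot> Pr1 C ?R ?R' \<cdot> h = f" "Pr2 C A B \<cdot> r \<cdot> Pr1 C ?R ?R' \<cdot> h = g"
      "Pr1 C A' B' \<cdot> r' \<cdot> Pr2 C ?R ?R' \<cdot> h = f'" "Pr2 C A' B' \<cdot> r' \<cdot> Pr2 C ?R ?R' \<cdot> h = g'"
      using h(4) unfolding comp[OF h(1,3)] using ty fg h(1-3) by simp_all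
    have "r \<cdot> (Pr1 C ?R ?R' \<cdot> h) = pairing C f g" "r' \<cdot> (Pr2 C ?R ?R' \<cdot> h) = pairing C f' g'"
      unfolding *[symmetric] using ty h(1-3) by simp_all
    then have "\<exists>x. x \<in> Arr C \<and> Dom C x = Dom C g \<and> Cod C x = ?R \<and> r \<cdot> x = pairing C f g"
      "\<exists>x. x \<in> Arr C \<and> Dom C x = Dom C g \<and> Cod C x = ?R' \<and> r' \<cdot> x = pairing C f' g'"
      using h(1-3) R by (force intro: exI[of _ "Pr1 C ?R ?R' \<cdot> h"], force intro: exI[of _ "Pr2 C ?R ?R' \<cdot> h"])
    then show ?rhs using fg by (simp add: factors_through_iff)
  next
    assume ?rhs
    then obtain x y where x: "x \<in> Arr C" "Dom C x = Dom C g" "Cod C x = ?R" "r \<cdot> x = pairing C f g"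
      and y: "y \<in> Arr C" "Dom C y = Dom C g" "Cod C y = ?R'" "r' \<cdot> y = pairing C f' g'"
      using fg by (auto simp: factors_through_iff)
    have "?t \<cdot> pairing C x y = pairing C (pairing C f f') (pairing C g g')"
      by (subst comp) (use ty fg x y in simp_all)
    moreover have "pairing C x y \<in> Arr C" "Dom C (pairing C x y) = Dom C g" "Cod C (pairing C x y) = Dom C ?t"
      using x y d by simp_all
    ultimately show ?lhs using fg by (subst factors_through_iff) auto
  qed
qed

lemma
  assumes F: "F \<in> hom (Rel C) A B" and F': "F' \<in> hom (Rel C) A' B'"
  shows rel_tensor_in_hom: "rel_tensor C F F' \<in> hom (Rel C) (Prod C A A') (Prod C B B')"
    and related_rel_tensor_iff: "f \<in> Arr C \<Longrightarrow> g \<in> Arr C \<Longrightarrow> f' \<in> Arr C \<Longrightarrow> g' \<in> Arr C \<Longrightarrow> Dom C f = Dom C g \<Longrightarrow>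
      Dom C f' = Dom C g \<Longrightarrow> Dom C g' = Dom C g \<Longrightarrow> Cod C f = A \<Longrightarrow> Cod C g = B \<Longrightarrow> Cod C f' = A' \<Longrightarrow>
      Cod C g' = B' \<Longrightarrow>
      related (rel_tensor C F F') (pairing C f f') (pairing C g g') \<longleftrightarrow> related F f g \<and> related F' f' g'"
proof -
  obtain r where r: "A \<in> Obj C" "B \<in> Obj C" "monic C r" "Cod C r = Prod C A B" "F = (A, subobject C r, B)"
    using F by (rule hom_Rel_cases)
  obtain r' where r': "A' \<in> Obj C" "B' \<in> Obj C" "monic C r'" "Cod C r' = Prod C A' B'"
      "F' = (A', subobject C r', B')"
    using F' by (rule hom_Rel_cases)
  note Obj = r(1,2) r'(1,2)
  let ?t = "tensor_mono A B A' B'"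
  note t = tensor_mono_props[OF Obj r(3,4) r'(3,4)]
  have sub: "subobject C (?t s s') = subobject C (?t r r')"
    if s: "s \<in> subobject C r" and s': "s' \<in> subobject C r'" for s s'
  proof -
    have Cods: "Cod C s = Prod C A B" "Cod C s' = Prod C A' B'"
      using subobject_mem(2)[OF s] subobject_mem(2)[OF s'] r r' by simp_all
    note ts = tensor_mono_props[OF Obj subobject_mem(1)[OF s] Cods(1) subobject_mem(1)[OF s'] Cods(2)]
    show ?thesis
    proof (rule subobject_eqI)
      fix k assume k: "k \<in> Arr C" "Cod C k = Cod C (?t r r')"
      obtain u v where u: "u \<in> Arr C" "v \<in> Arr C" "Dom C u = Dom C v" "Cod C u = Prod C A A'"
          "Cod C v = Prod C B B'" "k = pairing C u v"
        using pairing_cases[OF k(1) k(2)[unfolded t(2)]] Obj by (metis Prod_in_Obj)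
      obtain f f' where f: "f \<in> Arr C" "f' \<in> Arr C" "Dom C f = Dom C f'" "Cod C f = A" "Cod C f' = A'"
          "u = pairing C f f'"
        using pairing_cases[OF u(1,4) Obj(1,3)] by metis
      obtain g g' where g: "g \<in> Arr C" "g' \<in> Arr C" "Dom C g = Dom C g'" "Cod C g = B" "Cod C g' = B'"
          "v = pairing C g g'"
        using pairing_cases[OF u(2,5) Obj(2,4)] by metis
      have d: "Dom C f' = Dom C g'" using u(3) unfolding f(6) g(6) using f(1-5) g(1-5) by simp
      have dd: "Dom C f = Dom C g" "Dom C f' = Dom C g" "Dom C g' = Dom C g"
        using d f(3) g(3) by simp_all
      have "factors_through C (pairing C f g) s \<longleftrightarrow> factors_through C (pairing C f g) r"
        by (rule factors_through_subobject_iff[OF s]) (use r f g d in simp_all)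
      moreover have "factors_through C (pairing C f' g') s' \<longleftrightarrow> factors_through C (pairing C f' g') r'"
        by (rule factors_through_subobject_iff[OF s']) (use r' f g d in simp_all)
      ultimately show "factors_through C k (?t s s') \<longleftrightarrow> factors_through C k (?t r r')"
        unfolding u(6) f(6) g(6) t(4)[OF f(1) g(1) f(2) g(2) dd f(4) g(4) f(5) g(5)]
          ts(4)[OF f(1) g(1) f(2) g(2) dd f(4) g(4) f(5) g(5)] by simp
    qed (use t ts in simp_all)
  qed
  have "rel_tensor C F F' = (Prod C A A', \<Union>s \<in> subobject C r. \<Union>s' \<in> subobject C r'. subobject C (?t s s'), Prod C B B')"
    unfolding r(5) r'(5) by (simp add: tensor_mono_def Let_def)
  also have "(\<Union>s \<in> subobject C r. \<Union>s' \<in> subobject C r'. subobject C (?t s s')) = subobject C (?t r r')"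
    using sub subobject_refl[OF r(3)] subobject_refl[OF r'(3)] by blast
  finally have eq: "rel_tensor C F F' = (Prod C A A', subobject C (?t r r'), Prod C B B')" .
  show "rel_tensor C F F' \<in> hom (Rel C) (Prod C A A') (Prod C B B')"
    unfolding eq hom_Rel_iff using t(2,3) Obj by auto
  assume fg: "f \<in> Arr C" "g \<in> Arr C" "f' \<in> Arr C" "g' \<in> Arr C" "Dom C f = Dom C g"
    "Dom C f' = Dom C g" "Dom C g' = Dom C g" "Cod C f = A" "Cod C g = B" "Cod C f' = A'" "Cod C g' = B'"
  show "related (rel_tensor C F F') (pairing C f f') (pairing C g g') \<longleftrightarrow> related F f g \<and> related F' f' g'"
    unfolding eq unfolding r(5) r'(5) using fg t(3) r(3) r'(3)
    by (simp add: related_subobject t(4)[OF fg])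
qed

lemma
  assumes F: "F \<in> hom (Rel C) A B"
  shows rel_dagger_in_hom: "rel_dagger C F \<in> hom (Rel C) B A"
    and related_rel_dagger_iff: "f \<in> Arr C \<Longrightarrow> g \<in> Arr C \<Longrightarrow> Dom C f = Dom C g \<Longrightarrow> Cod C f = B \<Longrightarrow> Cod C g = A \<Longrightarrow>
      related (rel_dagger C F) f g \<longleftrightarrow> related F g f"
proof -
  obtain r where r: "A \<in> Obj C" "B \<in> Obj C" "monic C r" "Cod C r = Prod C A B" "F = (A, subobject C r, B)"
    using F by (rule hom_Rel_cases)
  define sw where "sw s = pairing C (Pr2 C A B \<cdot> s) (Pr1 C A B \<cdot> s)" for s
  have ty: "sw s \<in> Arr C" "Cod C (sw s) = Prod C B A" "Dom C (sw s) = Dom C s"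
    if "monic C s" "Cod C s = Prod C A B" for s
    using that r unfolding sw_def by simp_all
  have fac: "factors_through C (pairing C f g) (sw s) \<longleftrightarrow> factors_through C (pairing C g f) s"
    if s: "monic C s" "Cod C s = Prod C A B"
      and fg: "f \<in> Arr C" "g \<in> Arr C" "Dom C f = Dom C g" "Cod C f = B" "Cod C g = A" for s f g
  proof -
    have "sw s \<cdot> h = pairing C f g \<longleftrightarrow> s \<cdot> h = pairing C g f"
      if h: "h \<in> Arr C" "Cod C h = Dom C s" "Dom C h = Dom C f" for h
    proof -
      have "sw s \<cdot> h = pairing C f g \<longleftrightarrow> Pr2 C A B \<cdot> s \<cdot> h = f \<and> Pr1 C A B \<cdot> s \<cdot> h = g"
        using h s fg r(1,2) by (simp add: sw_def)
      also have "\<dots> \<longleftrightarrow> pairing C (Pr1 C A B \<cdot> s \<cdot> h) (Pr2 C A B \<cdot> s \<cdot> h) = pairing C g f"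
        using h s fg r(1,2) by (subst pairing_eq_iff) auto
      also have "\<dots> \<longleftrightarrow> s \<cdot> h = pairing C g f"
        using h s r(1,2) by simp
      finally show ?thesis .
    qed
    then show ?thesis using fg ty[OF s] by (auto simp: factors_through_iff)
  qed
  have mon: "monic C (sw s)" if s: "monic C s" "Cod C s = Prod C A B" for s
  proof (rule monicI)
    show "sw s \<in> Arr C" using ty[OF s] by simp
    fix a b assume ab: "a \<in> Arr C" "b \<in> Arr C" "Dom C a = Dom C b" "Cod C a = Dom C (sw s)"
      "Cod C b = Dom C (sw s)" and eq: "sw s \<cdot> a = sw s \<cdot> b"
    note ab' = ab[unfolded ty(3)[OF s]]
    have *: "Pr1 C A B \<cdot> s \<cdot> a = Pr1 C A B \<cdot> s \<cdot> b" "Pr2 C A B \<cdot> s \<cdot> a = Pr2 C A B \<cdot> s \<cdot> b"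
      using eq ab' s r(1,2) by (simp_all add: sw_def)
    have "s \<cdot> a = s \<cdot> b"
      by (rule pairing_unique[OF _ _ _ _ _ r(1,2) *]) (use s ab' in simp_all)
    then show "a = b" by (rule monic_cancel[OF s(1)]) (use ab' in simp_all)
  qed
  have sub: "subobject C (sw s) = subobject C (sw r)" if s: "s \<in> subobject C r" for s
  proof -
    have s': "monic C s" "Cod C s = Prod C A B" using subobject_mem[OF s] r by simp_all
    show ?thesis
    proof (rule subobject_eqI)
      fix k assume k: "k \<in> Arr C" "Cod C k = Cod C (sw r)"
      obtain f g where f: "f \<in> Arr C" "g \<in> Arr C" "Dom C f = Dom C g" "Cod C f = B" "Cod C g = A"
          "k = pairing C f g"
        using pairing_cases[OF k(1) k(2)[unfolded ty(2)[OF r(3,4)]] r(2,1)] by metis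
      show "factors_through C k (sw s) \<longleftrightarrow> factors_through C k (sw r)"
        unfolding f(6) fac[OF s' f(1-5)] fac[OF r(3,4) f(1-5)]
        by (rule factors_through_subobject_iff[OF s]) (use f r in simp_all)
    qed (use ty s' r in simp_all)
  qed
  have "rel_dagger C F = (B, \<Union>s \<in> subobject C r. subobject C (sw s), A)"
    unfolding r(5) by (simp add: sw_def)
  also have "(\<Union>s \<in> subobject C r. subobject C (sw s)) = subobject C (sw r)"
    using sub subobject_refl[OF r(3)] by blast
  finally have eq: "rel_dagger C F = (B, subobject C (sw r), A)" .
  show "rel_dagger C F \<in> hom (Rel C) B A"
    unfolding eq hom_Rel_iff using mon[OF r(3,4)] ty[OF r(3,4)] r by auto
  assume fg: "f \<in> Arr C" "g \<in> Arr C" "Dom C f = Dom C g" "Cod C f = B" "Cod C g = A"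
  show "related (rel_dagger C F) f g \<longleftrightarrow> related F g f"
    unfolding eq unfolding r(5) related_subobject[OF mon[OF r(3,4)] fg(1-3)]
      related_subobject[OF r(3) fg(2,1) fg(3)[symmetric]] by (rule fac[OF r(3,4) fg])
qed

lemma graph_props:
  assumes \<phi>: "\<phi> \<in> Arr C" "Dom C \<phi> = A" "Cod C \<phi> = B"
  shows "graph C \<phi> \<in> hom (Rel C) A B"
    and "f \<in> Arr C \<Longrightarrow> g \<in> Arr C \<Longrightarrow> Dom C f = Dom C g \<Longrightarrow> Cod C f = A \<Longrightarrow> Cod C g = B \<Longrightarrow>
      related (graph C \<phi>) f g \<longleftrightarrow> \<phi> \<cdot> f = g"
proof -
  let ?m = "pairing C (Id C A) \<phi>"
  have A: "A \<in> Obj C" "B \<in> Obj C" using \<phi> by auto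
  have m: "monic C ?m" by (rule monicI) (use \<phi> A in simp_all)
  have eq: "graph C \<phi> = (A, subobject C ?m, B)" using \<phi> by (simp add: graph_def)
  show "graph C \<phi> \<in> hom (Rel C) A B" unfolding eq hom_Rel_iff using m \<phi> A by auto
  assume fg: "f \<in> Arr C" "g \<in> Arr C" "Dom C f = Dom C g" "Cod C f = A" "Cod C g = B"
  show "related (graph C \<phi>) f g \<longleftrightarrow> \<phi> \<cdot> f = g"
    unfolding eq related_subobject[OF m fg(1-3)] using fg \<phi> A by (auto simp: factors_through_iff)
qed

lemma
  assumes A: "A \<in> Obj C"
  shows rel_id_in_hom: "rel_id C A \<in> hom (Rel C) A A"
    and related_rel_id_iff: "f \<in> Arr C \<Longrightarrow> g \<in> Arr C \<Longrightarrow> Dom C f = Dom C g \<Longrightarrow> Cod C f = A \<Longrightarrow> Cod C g = A \<Longrightarrow>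
      related (rel_id C A) f g \<longleftrightarrow> f = g"
proof -
  have "rel_id C A = graph C (Id C A)" using A by (simp add: rel_id_def graph_def diag_def)
  then show "rel_id C A \<in> hom (Rel C) A A"
    and "f \<in> Arr C \<Longrightarrow> g \<in> Arr C \<Longrightarrow> Dom C f = Dom C g \<Longrightarrow> Cod C f = A \<Longrightarrow> Cod C g = A \<Longrightarrow>
      related (rel_id C A) f g \<longleftrightarrow> f = g"
    using graph_props[of "Id C A" A A] A by simp_all
qed

section \<open>Difunctionality in Mal'cev categories\<close>

text \<open>The pairs related by \<open>F\<close> are the elements of the domain \<open>R\<close> of a representing monomorphism. On \<open>R\<close>, let
  \<open>(a, b) S (a', b')\<close> mean that \<open>F\<close> relates \<open>a\<close> to \<open>b'\<close>. This is a reflexive relation, hence symmetric, and symmetry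
  exchanges \<open>F(a, b')\<close> with \<open>F(a', b)\<close>.\<close>

lemma malcev_difunctional:
  assumes mal: "malcev C" and F: "F \<in> hom (Rel C) A B"
    and ty: "a \<in> Arr C" "b \<in> Arr C" "a' \<in> Arr C" "b' \<in> Arr C" "Dom C b = Dom C a" "Dom C a' = Dom C a"
      "Dom C b' = Dom C a" "Cod C a = A" "Cod C a' = A" "Cod C b = B" "Cod C b' = B"
    and "related F a b" "related F a' b'" "related F a b'"
  shows "related F a' b"
proof -
  obtain r where r: "A \<in> Obj C" "B \<in> Obj C" "monic C r" "Cod C r = Prod C A B" "F = (A, subobject C r, B)"
    using F by (rule hom_Rel_cases)
  let ?R = "Dom C r"
  have R: "?R \<in> Obj C" using r by simp
  have fac: "factors_through C (pairing C a b) r" "factors_through C (pairing C a' b') r"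
      "factors_through C (pairing C a b') r"
    using assms(14-16) r ty by (simp_all add: related_subobject)
  obtain x where x: "x \<in> Arr C" "Dom C x = Dom C a" "Cod C x = ?R" "r \<cdot> x = pairing C a b"
    using fac(1) ty by (auto simp: factors_through_iff)
  obtain y where y: "y \<in> Arr C" "Dom C y = Dom C a" "Cod C y = ?R" "r \<cdot> y = pairing C a' b'"
    using fac(2) ty by (auto simp: factors_through_iff)
  obtain z where z: "z \<in> Arr C" "Dom C z = Dom C a" "Cod C z = ?R" "r \<cdot> z = pairing C a b'"
    using fac(3) ty by (auto simp: factors_through_iff)
  define \<psi> where "\<psi> = pairing C (Pr1 C A B \<cdot> r \<cdot> Pr1 C ?R ?R) (Pr2 C A B \<cdot> r \<cdot> Pr2 C ?R ?R)"
  have \<psi>: "\<psi> \<in> Arr C" "Dom C \<psi> = Prod C ?R ?R" "Cod C \<psi> = Prod C A B"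
    unfolding \<psi>_def using r R by simp_all
  \<comment> \<open>The relation \<open>S\<close> on \<open>R\<close>, as the inverse image of \<open>F\<close> along \<open>((a, b), (a', b')) \<mapsto> (a, b')\<close>.\<close>
  obtain s t where pb: "is_pullback C \<psi> r s t"
    using pullback_exists[OF finite_limits, of \<psi> r] \<psi> r by auto
  have s: "monic C s" "Cod C s = Prod C ?R ?R" "t \<in> Arr C" "Dom C t = Dom C s" "Cod C t = ?R" "\<psi> \<cdot> s = r \<cdot> t"
    using pullback_monic[OF pb r(3)] pullback_typing[OF pb] \<psi> by simp_all
  have int: "internal_relation C ?R s" using s by (simp add: internal_relation_def)
  have "\<psi> \<cdot> diag C ?R = r \<cdot> Id C ?R"
    unfolding \<psi>_def diag_def using r R by simp
  then obtain d where "d \<in> Arr C" "Dom C d = ?R" "Cod C d = Dom C s" "s \<cdot> d = diag C ?R"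
    using pullback_lift[OF pb, of "diag C ?R" "Id C ?R"] \<psi> r R by auto
  then have "factors_through C (diag C ?R) s" using R by (auto simp: factors_through_iff)
  then have "reflexive_relation C ?R s" using int by (simp add: reflexive_relation_def)
  then have "equivalence_relation C ?R s" using mal R by (simp add: malcev_def)
  then have "factors_through C (pairing C (Pr2 C ?R ?R \<cdot> s) (Pr1 C ?R ?R \<cdot> s)) s"
    by (simp add: equivalence_relation_def symmetric_relation_def)
  then obtain h where h: "h \<in> Arr C" "Dom C h = Dom C s" "Cod C h = Dom C s"
      "s \<cdot> h = pairing C (Pr2 C ?R ?R \<cdot> s) (Pr1 C ?R ?R \<cdot> s)"
    using s R by (auto simp: factors_through_iff)
  have "\<psi> \<cdot> pairing C x y = r \<cdot> z"
    unfolding \<psi>_def using x y z ty r R by simp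
  then obtain k where k: "k \<in> Arr C" "Dom C k = Dom C a" "Cod C k = Dom C s" "s \<cdot> k = pairing C x y"
    using pullback_lift[OF pb, of "pairing C x y" z] \<psi> r x y z R by auto
  have "s \<cdot> h \<cdot> k = (s \<cdot> h) \<cdot> k" using s(1-5) h(1-3) k(1-3) by simp
  also have "\<dots> = pairing C (Pr2 C ?R ?R \<cdot> s \<cdot> k) (Pr1 C ?R ?R \<cdot> s \<cdot> k)"
    unfolding h(4) using s(1-5) k(1-3) R by simp
  also have "\<dots> = pairing C y x" unfolding k(4) using x y by simp
  finally have yx: "pairing C y x = s \<cdot> h \<cdot> k" ..
  have "pairing C a' b = \<psi> \<cdot> pairing C y x"
    unfolding \<psi>_def using x y ty r R by simp
  also have "\<dots> = (\<psi> \<cdot> s) \<cdot> h \<cdot> k" unfolding yx using s(1-5) \<psi> h(1-3) k(1-3) by simp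
  also have "\<dots> = r \<cdot> (t \<cdot> h \<cdot> k)" unfolding s(6) using s(1-5) r(3,4) h(1-3) k(1-3) by simp
  finally have "r \<cdot> (t \<cdot> h \<cdot> k) = pairing C a' b" ..
  then have "factors_through C (pairing C a' b) r"
    using ty s(1-5) h(1-3) k(1-3) by (auto simp: factors_through_iff intro!: exI[of _ "t \<cdot> h \<cdot> k"])
  then show ?thesis using r ty by (simp add: related_subobject)
qed

section \<open>Composites with graphs and the coherence isomorphisms\<close>

text \<open>Elements are now typed by hom-sets: the types of a composed rule are then fixed by the facts it is applied to.\<close>

lemma pairing_in_hom: "f \<in> hom C X A \<Longrightarrow> g \<in> hom C X B \<Longrightarrow> pairing C f g \<in> hom C X (Prod C A B)"
  by (simp add: hom_def)

lemma hom_Obj: "f \<in> hom C X A \<Longrightarrow> X \<in> Obj C" "f \<in> hom C X A \<Longrightarrow> A \<in> Obj C"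
  by (auto simp: hom_def)

lemma pairing_hom_Comp:
  "f \<in> hom C X A \<Longrightarrow> g \<in> hom C X B \<Longrightarrow> c \<in> hom C Y X \<Longrightarrow> pairing C f g \<cdot> c = pairing C (f \<cdot> c) (g \<cdot> c)"
  by (simp add: hom_def)

lemma hom_Prod_cases:
  assumes "h \<in> hom C X (Prod C A B)" "A \<in> Obj C" "B \<in> Obj C"
  obtains f g where "f \<in> hom C X A" "g \<in> hom C X B" "h = pairing C f g"
  using that[of "Pr1 C A B \<cdot> h" "Pr2 C A B \<cdot> h"] assms by (simp add: hom_def)

lemma pairing_inject:
  assumes "pairing C f g = pairing C f' g'"
    "f \<in> hom C X A" "f' \<in> hom C X A" "g \<in> hom C X B" "g' \<in> hom C X B"
  shows "f = f'" "g = g'"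
  using assms pairing_eq_iff[of f g f' g'] by (simp_all add: hom_def)

lemma related_cover:
  assumes "related F f g" "F \<in> hom (Rel C) A B" "f \<in> hom C X A" "g \<in> hom C X B" "c \<in> hom C Y X"
  shows "related F (f \<cdot> c) (g \<cdot> c)"
  using related_stable[OF assms(1,2)] assms(3-5) by (simp add: hom_def)

lemma related_uncover:
  assumes "related F (f \<cdot> c) (g \<cdot> c)" "cover c" "F \<in> hom (Rel C) A B"
    "f \<in> hom C X A" "g \<in> hom C X B" "c \<in> hom C Y X"
  shows "related F f g"
  using related_local[OF assms(1-3)] assms(4-6) by (simp add: hom_def)

lemma related_compI:
  assumes "related F f b" "related G b g" "F \<in> hom (Rel C) A B" "G \<in> hom (Rel C) B D"
    "f \<in> hom C X A" "b \<in> hom C X B" "g \<in> hom C X D"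
  shows "related (rel_comp C G F) f g"
proof -
  have ty: "f \<in> Arr C" "g \<in> Arr C" "Dom C f = X" "Dom C g = X" "Cod C f = A" "Cod C g = D"
      "b \<in> Arr C" "Dom C b = X" "Cod C b = B"
    using assms(5-7) by (auto simp: hom_def)
  then have X: "X \<in> Obj C" by auto
  have "cover (Id C X) \<and> Cod C (Id C X) = Dom C f \<and> b \<in> Arr C \<and> Dom C b = Dom C (Id C X) \<and> Cod C b = B \<and>
      related F (f \<cdot> Id C X) b \<and> related G b (g \<cdot> Id C X)"
    using ty X assms(1,2) cover_Id[OF X] by simp
  moreover have "Dom C f = Dom C g" using ty by simp
  ultimately show ?thesis using related_rel_comp_iff[OF assms(3,4) ty(1,2) _ ty(5,6)] by blast
qed

lemma related_compE:
  assumes "related (rel_comp C G F) f g" "F \<in> hom (Rel C) A B" "G \<in> hom (Rel C) B D"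
    "f \<in> hom C X A" "g \<in> hom C X D"
  obtains Y c b where "cover c" "c \<in> hom C Y X" "b \<in> hom C Y B" "related F (f \<cdot> c) b" "related G b (g \<cdot> c)"
proof -
  obtain c b where "cover c" "Cod C c = X" "b \<in> Arr C" "Dom C b = Dom C c" "Cod C b = B"
      "related F (f \<cdot> c) b" "related G b (g \<cdot> c)"
    using related_rel_comp_iff[OF assms(2,3), of f g] assms(1,4,5) unfolding hom_def by auto
  then show ?thesis using that[of c "Dom C c" b] by (simp add: hom_def)
qed

lemma related_tensor:
  assumes "F \<in> hom (Rel C) A B" "F' \<in> hom (Rel C) A' B'"
    "f \<in> hom C X A" "g \<in> hom C X B" "f' \<in> hom C X A'" "g' \<in> hom C X B'"
  shows "related (rel_tensor C F F') (pairing C f f') (pairing C g g') \<longleftrightarrow> related F f g \<and> related F' f' g'"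
  by (rule related_rel_tensor_iff[OF assms(1,2)]) (use assms(3-6) in \<open>simp_all add: hom_def\<close>)

lemma related_dagger:
  assumes "F \<in> hom (Rel C) A B" "f \<in> hom C X B" "g \<in> hom C X A"
  shows "related (rel_dagger C F) f g \<longleftrightarrow> related F g f"
  using related_rel_dagger_iff[OF assms(1), of f g] assms(2,3) by (simp add: hom_def)

lemma related_graph:
  assumes "\<phi> \<in> hom C A B" "f \<in> hom C X A" "g \<in> hom C X B"
  shows "related (graph C \<phi>) f g \<longleftrightarrow> \<phi> \<cdot> f = g"
  using graph_props(2)[of \<phi> A B f g] assms by (simp add: hom_def)

lemma graph_in_hom: "\<phi> \<in> hom C A B \<Longrightarrow> graph C \<phi> \<in> hom (Rel C) A B"
  using graph_props(1)[of \<phi> A B] by (simp add: hom_def)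

lemma related_id:
  assumes "f \<in> hom C X A" "g \<in> hom C X A"
  shows "related (rel_id C A) f g \<longleftrightarrow> f = g"
  using related_rel_id_iff[OF hom_Obj(2)[OF assms(1)], of f g] assms by (simp add: hom_def)

lemmas rel_in_hom = rel_comp_in_hom rel_tensor_in_hom rel_dagger_in_hom graph_in_hom rel_id_in_hom

text \<open>Composites with graphs, and with converses of graphs on the other side, need no cover, since the witness
  is given by the map; for the remaining two sides this holds when the map is monic and the outer element is a value
  of it.\<close>

lemma related_comp_graph:
  assumes "\<phi> \<in> hom C A B" "F \<in> hom (Rel C) B D" "f \<in> hom C X A" "h \<in> hom C X D"
  shows "related (rel_comp C F (graph C \<phi>)) f h \<longleftrightarrow> related F (\<phi> \<cdot> f) h"
proof
  assume "related (rel_comp C F (graph C \<phi>)) f h"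
  then obtain Y c b where c: "cover c" "c \<in> hom C Y X" "b \<in> hom C Y B" "related (graph C \<phi>) (f \<cdot> c) b"
      "related F b (h \<cdot> c)"
    by (rule related_compE) (use assms in \<open>auto intro: graph_in_hom\<close>)
  have "\<phi> \<cdot> f \<cdot> c = b"
    using c(4) related_graph[OF assms(1) Comp_in_hom[OF c(2) assms(3)] c(3)] by simp
  moreover have "\<phi> \<cdot> f \<cdot> c = (\<phi> \<cdot> f) \<cdot> c" using assms(1,3) c(2) by (simp add: hom_def)
  ultimately have "related F ((\<phi> \<cdot> f) \<cdot> c) (h \<cdot> c)" using c(5) by simp
  then show "related F (\<phi> \<cdot> f) h"
    by (rule related_uncover[OF _ c(1) assms(2) Comp_in_hom[OF assms(3,1)] assms(4) c(2)])
next
  assume "related F (\<phi> \<cdot> f) h"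
  moreover have "related (graph C \<phi>) f (\<phi> \<cdot> f)"
    using related_graph[OF assms(1,3) Comp_in_hom[OF assms(3,1)]] by simp
  ultimately show "related (rel_comp C F (graph C \<phi>)) f h"
    using related_compI graph_in_hom[OF assms(1)] assms(2-4) Comp_in_hom[OF assms(3,1)] by blast
qed

lemma related_cograph_comp:
  assumes "\<phi> \<in> hom C D B" "F \<in> hom (Rel C) A B" "f \<in> hom C X A" "h \<in> hom C X D"
  shows "related (rel_comp C (rel_dagger C (graph C \<phi>)) F) f h \<longleftrightarrow> related F f (\<phi> \<cdot> h)"
proof
  note g = graph_in_hom[OF assms(1)]
  assume "related (rel_comp C (rel_dagger C (graph C \<phi>)) F) f h"
  then obtain Y c b where c: "cover c" "c \<in> hom C Y X" "b \<in> hom C Y B"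
      "related F (f \<cdot> c) b" "related (rel_dagger C (graph C \<phi>)) b (h \<cdot> c)"
    by (rule related_compE) (use assms in \<open>auto intro: rel_in_hom\<close>)
  have "\<phi> \<cdot> h \<cdot> c = b"
    using c(5) related_dagger[OF g c(3)] related_graph[OF assms(1)] Comp_in_hom[OF c(2) assms(4)] c(3) by blast
  moreover have "\<phi> \<cdot> h \<cdot> c = (\<phi> \<cdot> h) \<cdot> c" using assms(1,4) c(2) by (simp add: hom_def)
  ultimately have "related F (f \<cdot> c) ((\<phi> \<cdot> h) \<cdot> c)" using c(4) by simp
  then show "related F f (\<phi> \<cdot> h)"
    by (rule related_uncover[OF _ c(1) assms(2,3) Comp_in_hom[OF assms(4,1)] c(2)])
next
  note g = graph_in_hom[OF assms(1)]
  assume "related F f (\<phi> \<cdot> h)"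
  moreover have "related (rel_dagger C (graph C \<phi>)) (\<phi> \<cdot> h) h"
    using related_dagger[OF g Comp_in_hom[OF assms(4,1)] assms(4)]
      related_graph[OF assms(1,4) Comp_in_hom[OF assms(4,1)]] by simp
  ultimately show "related (rel_comp C (rel_dagger C (graph C \<phi>)) F) f h"
    using related_compI rel_dagger_in_hom[OF g] assms(2-4) Comp_in_hom[OF assms(4,1)] by blast
qed

lemma related_monic_graph_comp:
  assumes "monic C \<phi>" "\<phi> \<in> hom C B D" "F \<in> hom (Rel C) A B" "f \<in> hom C X A" "h \<in> hom C X B"
  shows "related (rel_comp C (graph C \<phi>) F) f (\<phi> \<cdot> h) \<longleftrightarrow> related F f h"
proof
  note g = graph_in_hom[OF assms(2)] and ph = Comp_in_hom[OF assms(5,2)]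
  assume "related (rel_comp C (graph C \<phi>) F) f (\<phi> \<cdot> h)"
  then obtain Y c b where c: "cover c" "c \<in> hom C Y X" "b \<in> hom C Y B"
      "related F (f \<cdot> c) b" "related (graph C \<phi>) b ((\<phi> \<cdot> h) \<cdot> c)"
    by (rule related_compE[OF _ assms(3) g assms(4) ph])
  have "\<phi> \<cdot> b = (\<phi> \<cdot> h) \<cdot> c"
    using c(5) related_graph[OF assms(2) c(3) Comp_in_hom[OF c(2) ph]] by simp
  then have "\<phi> \<cdot> b = \<phi> \<cdot> (h \<cdot> c)" using assms(2,5) c(2) by (simp add: hom_def)
  then have "b = h \<cdot> c" by (rule monic_cancel[OF assms(1)]) (use assms c in \<open>simp_all add: hom_def\<close>)
  then have "related F (f \<cdot> c) (h \<cdot> c)" using c(4) by simp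
  then show "related F f h" by (rule related_uncover[OF _ c(1) assms(3-5) c(2)])
next
  note g = graph_in_hom[OF assms(2)] and ph = Comp_in_hom[OF assms(5,2)]
  assume "related F f h"
  moreover have "related (graph C \<phi>) h (\<phi> \<cdot> h)" using related_graph[OF assms(2,5) ph] by simp
  ultimately show "related (rel_comp C (graph C \<phi>) F) f (\<phi> \<cdot> h)"
    using related_compI g assms(3-5) ph by blast
qed

lemma related_comp_monic_cograph:
  assumes "monic C \<phi>" "\<phi> \<in> hom C A B" "F \<in> hom (Rel C) A D" "f \<in> hom C X A" "h \<in> hom C X D"
  shows "related (rel_comp C F (rel_dagger C (graph C \<phi>))) (\<phi> \<cdot> f) h \<longleftrightarrow> related F f h"
proof
  note g = graph_in_hom[OF assms(2)] and pf = Comp_in_hom[OF assms(4,2)]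
  assume "related (rel_comp C F (rel_dagger C (graph C \<phi>))) (\<phi> \<cdot> f) h"
  then obtain Y c b where c: "cover c" "c \<in> hom C Y X" "b \<in> hom C Y A"
      "related (rel_dagger C (graph C \<phi>)) ((\<phi> \<cdot> f) \<cdot> c) b" "related F b (h \<cdot> c)"
    by (rule related_compE[OF _ rel_dagger_in_hom[OF g] assms(3) pf assms(5)])
  have "\<phi> \<cdot> b = (\<phi> \<cdot> f) \<cdot> c"
    using c(4) related_dagger[OF g Comp_in_hom[OF c(2) pf] c(3)]
      related_graph[OF assms(2) c(3) Comp_in_hom[OF c(2) pf]] by simp
  then have "\<phi> \<cdot> b = \<phi> \<cdot> (f \<cdot> c)" using assms(2,4) c(2) by (simp add: hom_def)
  then have "b = f \<cdot> c" by (rule monic_cancel[OF assms(1)]) (use assms c in \<open>simp_all add: hom_def\<close>)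
  then have "related F (f \<cdot> c) (h \<cdot> c)" using c(5) by simp
  then show "related F f h" by (rule related_uncover[OF _ c(1) assms(3-5) c(2)])
next
  note g = graph_in_hom[OF assms(2)] and pf = Comp_in_hom[OF assms(4,2)]
  assume "related F f h"
  moreover have "related (rel_dagger C (graph C \<phi>)) (\<phi> \<cdot> f) f"
    using related_dagger[OF g pf assms(4)] related_graph[OF assms(2,4) pf] by simp
  ultimately show "related (rel_comp C F (rel_dagger C (graph C \<phi>))) (\<phi> \<cdot> f) h"
    using related_compI rel_dagger_in_hom[OF g] assms(3-5) pf by blast
qed

lemma prod_assoc_props:
  assumes "A \<in> Obj C" "B \<in> Obj C" "D \<in> Obj C"
  shows "prod_assoc C A B D \<in> hom C (Prod C (Prod C A B) D) (Prod C A (Prod C B D))"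
    and "f \<in> hom C X A \<Longrightarrow> g \<in> hom C X B \<Longrightarrow> h \<in> hom C X D \<Longrightarrow>
      prod_assoc C A B D \<cdot> pairing C (pairing C f g) h = pairing C f (pairing C g h)"
    and "monic C (prod_assoc C A B D)"
proof -
  show ty: "prod_assoc C A B D \<in> hom C (Prod C (Prod C A B) D) (Prod C A (Prod C B D))"
    using assms by (simp add: prod_assoc_def Let_def hom_def)
  have comp: "prod_assoc C A B D \<cdot> pairing C (pairing C f g) h = pairing C f (pairing C g h)"
    if "f \<in> hom C X A" "g \<in> hom C X B" "h \<in> hom C X D" for f g h X
    using that assms by (simp add: prod_assoc_def Let_def hom_def)
  then show "f \<in> hom C X A \<Longrightarrow> g \<in> hom C X B \<Longrightarrow> h \<in> hom C X D \<Longrightarrow>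
      prod_assoc C A B D \<cdot> pairing C (pairing C f g) h = pairing C f (pairing C g h)" .
  have dec: "\<exists>f g h. f \<in> hom C X A \<and> g \<in> hom C X B \<and> h \<in> hom C X D \<and> k = pairing C (pairing C f g) h"
    if k: "k \<in> hom C X (Prod C (Prod C A B) D)" for k X
    using hom_Prod_cases[OF k Prod_in_Obj[OF assms(1,2)] assms(3)] hom_Prod_cases[OF _ assms(1,2)] by metis
  show "monic C (prod_assoc C A B D)"
  proof (rule monicI)
    show "prod_assoc C A B D \<in> Arr C" using ty by (simp add: hom_def)
    fix k l assume kl: "k \<in> Arr C" "l \<in> Arr C" "Dom C k = Dom C l" "Cod C k = Dom C (prod_assoc C A B D)"
      "Cod C l = Dom C (prod_assoc C A B D)" and eq: "prod_assoc C A B D \<cdot> k = prod_assoc C A B D \<cdot> l"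
    let ?X = "Dom C l"
    have h: "k \<in> hom C ?X (Prod C (Prod C A B) D)" "l \<in> hom C ?X (Prod C (Prod C A B) D)"
      using kl ty by (simp_all add: hom_def)
    obtain f g h where f: "f \<in> hom C ?X A" "g \<in> hom C ?X B" "h \<in> hom C ?X D" "k = pairing C (pairing C f g) h"
      using dec[OF h(1)] by blast
    obtain f' g' h' where f': "f' \<in> hom C ?X A" "g' \<in> hom C ?X B" "h' \<in> hom C ?X D"
        "l = pairing C (pairing C f' g') h'"
      using dec[OF h(2)] by blast
    have "pairing C f (pairing C g h) = pairing C f' (pairing C g' h')"
      using eq unfolding f(4) f'(4) comp[OF f(1-3)] comp[OF f'(1-3)] .
    then have "f = f'" "pairing C g h = pairing C g' h'"
      using pairing_inject[of f "pairing C g h" f' "pairing C g' h'"] f(1-3) f'(1-3) pairing_in_hom by blast+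
    moreover from this(2) have "g = g'" "h = h'" using pairing_inject f(1-3) f'(1-3) by blast+
    ultimately show "k = l" unfolding f(4) f'(4) by simp
  qed
qed

lemma prod_swap_props:
  assumes "A \<in> Obj C" "B \<in> Obj C"
  shows "prod_swap C A B \<in> hom C (Prod C A B) (Prod C B A)"
    and "f \<in> hom C X A \<Longrightarrow> g \<in> hom C X B \<Longrightarrow> prod_swap C A B \<cdot> pairing C f g = pairing C g f"
  using assms by (simp_all add: prod_swap_def hom_def)

lemma Rel_simps [simp]:
  "Obj (Rel C) = Obj C" "Comp (Rel C) = rel_comp C" "Id (Rel C) = rel_id C" "TensorObj (Rel C) = Prod C"
  "Tensor (Rel C) = rel_tensor C" "Unit (Rel C) = Terminal C"
  "Assoc (Rel C) A B D = graph C (prod_assoc C A B D)"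
  "Lunit (Rel C) A = graph C (Pr2 C (Terminal C) A)" "Runit (Rel C) A = graph C (Pr1 C A (Terminal C))"
  "Swap (Rel C) A B = graph C (prod_swap C A B)" "Dagger (Rel C) = rel_dagger C"
  by (simp_all add: Rel_def)

text \<open>The map \<open>((a, b), (a', b')) \<mapsto> ((a, a'), (b, b'))\<close>.\<close>

definition middle_swap :: "'o \<Rightarrow> 'o \<Rightarrow> 'm" where
  "middle_swap A B = (let P = Prod C A B; l = Pr1 C P P; r = Pr2 C P P in
    pairing C (pairing C (Pr1 C A B \<cdot> l) (Pr1 C A B \<cdot> r)) (pairing C (Pr2 C A B \<cdot> l) (Pr2 C A B \<cdot> r)))"

lemma middle_swap_props:
  assumes "A \<in> Obj C" "B \<in> Obj C"
  shows "middle_swap A B \<in> hom C (Prod C (Prod C A B) (Prod C A B)) (Prod C (Prod C A A) (Prod C B B))"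
    and "a \<in> hom C X A \<Longrightarrow> b \<in> hom C X B \<Longrightarrow> a' \<in> hom C X A \<Longrightarrow> b' \<in> hom C X B \<Longrightarrow>
      middle_swap A B \<cdot> pairing C (pairing C a b) (pairing C a' b') =
        pairing C (pairing C a a') (pairing C b b')"
  using assms by (simp_all add: middle_swap_def Let_def hom_def)

text \<open>Chase an element through the composite from the outside in, removing one coherence isomorphism at a time.\<close>

lemma interchange_Rel:
  assumes A: "A \<in> Obj C" and B: "B \<in> Obj C"
  shows "interchange (Rel C) A B = graph C (middle_swap A B)"
proof (rule Rel_eqI)
  let ?P = "Prod C A B"
  let ?S = "rel_tensor C (graph C (prod_swap C B A)) (rel_id C B)"
  let ?X = "rel_comp C (graph C (prod_assoc C A B B)) (rel_comp C ?S (rel_dagger C (graph C (prod_assoc C B A B))))"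
  note PO = Prod_in_Obj
  note as1 = prod_assoc_props[OF A B B] and as2 = prod_assoc_props[OF B A B]
    and as3 = prod_assoc_props[OF A B PO[OF A B]] and as4 = prod_assoc_props[OF A A PO[OF B B]]
  have S: "?S \<in> hom (Rel C) (Prod C (Prod C B A) B) (Prod C (Prod C A B) B)"
    using A B by (intro rel_in_hom prod_swap_props)
  have SA: "rel_comp C ?S (rel_dagger C (graph C (prod_assoc C B A B))) \<in> hom (Rel C) (Prod C B ?P) (Prod C ?P B)"
    by (rule rel_comp_in_hom[OF rel_dagger_in_hom[OF graph_in_hom[OF as2(1)]] S])
  have X: "?X \<in> hom (Rel C) (Prod C B ?P) (Prod C A (Prod C B B))"
    by (rule rel_comp_in_hom[OF SA graph_in_hom[OF as1(1)]])
  have IX: "rel_tensor C (rel_id C A) ?X \<in> hom (Rel C) (Prod C A (Prod C B ?P)) (Prod C A (Prod C A (Prod C B B)))"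
    by (rule rel_tensor_in_hom[OF rel_id_in_hom[OF A] X])
  let ?I1 = "rel_comp C (rel_tensor C (rel_id C A) ?X) (graph C (prod_assoc C A B ?P))"
  have I1: "?I1 \<in> hom (Rel C) (Prod C ?P ?P) (Prod C A (Prod C A (Prod C B B)))"
    by (rule rel_comp_in_hom[OF graph_in_hom[OF as3(1)] IX])
  have I: "interchange (Rel C) A B = rel_comp C (rel_dagger C (graph C (prod_assoc C A A (Prod C B B)))) ?I1"
    by (simp add: interchange_def)
  show "interchange (Rel C) A B \<in> hom (Rel C) (Prod C ?P ?P) (Prod C (Prod C A A) (Prod C B B))"
    unfolding I by (rule rel_comp_in_hom[OF I1 rel_dagger_in_hom[OF graph_in_hom[OF as4(1)]]])
  show "graph C (middle_swap A B) \<in> hom (Rel C) (Prod C ?P ?P) (Prod C (Prod C A A) (Prod C B B))"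
    by (rule graph_in_hom[OF middle_swap_props(1)[OF A B]])
  fix f g assume fg: "f \<in> Arr C" "g \<in> Arr C" "Dom C f = Dom C g" "Cod C f = Prod C ?P ?P"
    "Cod C g = Prod C (Prod C A A) (Prod C B B)"
  define Z where "Z = Dom C g"
  have fh: "f \<in> hom C Z (Prod C ?P ?P)" and gh: "g \<in> hom C Z (Prod C (Prod C A A) (Prod C B B))"
    using fg by (simp_all add: hom_def Z_def)
  obtain f1 f2 where f12: "f1 \<in> hom C Z ?P" "f2 \<in> hom C Z ?P" "f = pairing C f1 f2"
    using hom_Prod_cases[OF fh PO[OF A B] PO[OF A B]] .
  obtain a b where ab: "a \<in> hom C Z A" "b \<in> hom C Z B" "f1 = pairing C a b"
    using hom_Prod_cases[OF f12(1) A B] .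
  obtain a' b' where ab': "a' \<in> hom C Z A" "b' \<in> hom C Z B" "f2 = pairing C a' b'"
    using hom_Prod_cases[OF f12(2) A B] .
  obtain g1 g2 where g12: "g1 \<in> hom C Z (Prod C A A)" "g2 \<in> hom C Z (Prod C B B)" "g = pairing C g1 g2"
    using hom_Prod_cases[OF gh PO[OF A A] PO[OF B B]] .
  obtain x x' where x: "x \<in> hom C Z A" "x' \<in> hom C Z A" "g1 = pairing C x x'"
    using hom_Prod_cases[OF g12(1) A A] .
  obtain y y' where y: "y \<in> hom C Z B" "y' \<in> hom C Z B" "g2 = pairing C y y'"
    using hom_Prod_cases[OF g12(2) B B] .
  note p = pairing_in_hom
  have "related (interchange (Rel C) A B) f g \<longleftrightarrow> related ?I1 f (prod_assoc C A A (Prod C B B) \<cdot> g)"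
    unfolding I by (rule related_cograph_comp[OF as4(1) I1 fh gh])
  also have "prod_assoc C A A (Prod C B B) \<cdot> g = pairing C x (pairing C x' (pairing C y y'))"
    unfolding g12(3) x(3) y(3) using as4(2) x y p by blast
  also have "related ?I1 f \<dots> \<longleftrightarrow> related (rel_tensor C (rel_id C A) ?X) (prod_assoc C A B ?P \<cdot> f) \<dots>"
    by (rule related_comp_graph[OF as3(1) IX fh p[OF x(1) p[OF x(2) p[OF y(1,2)]]]])
  also have "prod_assoc C A B ?P \<cdot> f = pairing C a (pairing C b (pairing C a' b'))"
    unfolding f12(3) ab(3) ab'(3) using as3(2) ab ab' p by blast
  also have "related (rel_tensor C (rel_id C A) ?X) \<dots> (pairing C x (pairing C x' (pairing C y y'))) \<longleftrightarrow>
      related (rel_id C A) a x \<and> related ?X (pairing C b (pairing C a' b')) (pairing C x' (pairing C y y'))"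
    by (rule related_tensor[OF rel_id_in_hom[OF A] X ab(1) x(1) p[OF ab(2) p[OF ab'(1,2)]] p[OF x(2) p[OF y(1,2)]]])
  also have "related (rel_id C A) a x \<longleftrightarrow> a = x" by (rule related_id[OF ab(1) x(1)])
  also have "pairing C x' (pairing C y y') = prod_assoc C A B B \<cdot> pairing C (pairing C x' y) y'"
    using as1(2)[OF x(2) y(1,2)] ..
  also have "related ?X (pairing C b (pairing C a' b')) \<dots> \<longleftrightarrow>
      related (rel_comp C ?S (rel_dagger C (graph C (prod_assoc C B A B)))) (pairing C b (pairing C a' b'))
        (pairing C (pairing C x' y) y')"
    by (rule related_monic_graph_comp[OF as1(3,1) SA p[OF ab(2) p[OF ab'(1,2)]] p[OF p[OF x(2) y(1)] y(2)]])
  also have "pairing C b (pairing C a' b') = prod_assoc C B A B \<cdot> pairing C (pairing C b a') b'"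
    using as2(2)[OF ab(2) ab'(1,2)] ..
  also have "related (rel_comp C ?S (rel_dagger C (graph C (prod_assoc C B A B)))) \<dots>
        (pairing C (pairing C x' y) y') \<longleftrightarrow>
      related ?S (pairing C (pairing C b a') b') (pairing C (pairing C x' y) y')"
    by (rule related_comp_monic_cograph[OF as2(3,1) S p[OF p[OF ab(2) ab'(1)] ab'(2)] p[OF p[OF x(2) y(1)] y(2)]])
  also have "\<dots> \<longleftrightarrow> related (graph C (prod_swap C B A)) (pairing C b a') (pairing C x' y) \<and> related (rel_id C B) b' y'"
    by (rule related_tensor[OF graph_in_hom[OF prod_swap_props(1)[OF B A]] rel_id_in_hom[OF B]
          p[OF ab(2) ab'(1)] p[OF x(2) y(1)] ab'(2) y(2)])
  also have "related (rel_id C B) b' y' \<longleftrightarrow> b' = y'" by (rule related_id[OF ab'(2) y(2)])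
  also have "related (graph C (prod_swap C B A)) (pairing C b a') (pairing C x' y) \<longleftrightarrow>
      prod_swap C B A \<cdot> pairing C b a' = pairing C x' y"
    by (rule related_graph[OF prod_swap_props(1)[OF B A] p[OF ab(2) ab'(1)] p[OF x(2) y(1)]])
  also have "prod_swap C B A \<cdot> pairing C b a' = pairing C a' b"
    by (rule prod_swap_props(2)[OF B A ab(2) ab'(1)])
  also have "pairing C a' b = pairing C x' y \<longleftrightarrow> a' = x' \<and> b = y"
    using ab ab' x y by (intro pairing_eq_iff) (simp_all add: hom_def)
  also have "a = x \<and> (a' = x' \<and> b = y) \<and> b' = y' \<longleftrightarrow>
      pairing C (pairing C a a') (pairing C b b') = pairing C (pairing C x x') (pairing C y y')"
    using ab(1,2) ab'(1,2) x(1,2) y(1,2) by (auto simp: hom_def)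
  also have "\<dots> \<longleftrightarrow> middle_swap A B \<cdot> f = g"
    unfolding f12(3) ab(3) ab'(3) g12(3) x(3) y(3)
      middle_swap_props(2)[OF A B ab(1,2) ab'(1,2)] ..
  also have "\<dots> \<longleftrightarrow> related (graph C (middle_swap A B)) f g"
    by (rule related_graph[OF middle_swap_props(1)[OF A B] fh gh, symmetric])
  finally show "related (interchange (Rel C) A B) f g \<longleftrightarrow> related (graph C (middle_swap A B)) f g" .
qed

section \<open>Choi relations and positivity\<close>

text \<open>On elements, the Choi relation of \<open>\<beta>\<close> relates \<open>(a, b)\<close> to \<open>(a', b')\<close> iff there are \<open>x\<close>, \<open>y\<close> with \<open>a = a' x\<close>, \<open>\<beta>(x, y)\<close> and
  \<open>y b = b'\<close>. This lemma and the next are the two directions; witnesses extracted from the relation exist only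
  over a cover.\<close>

lemma related_choiI:
  assumes Obj: "A \<in> Obj C" "B \<in> Obj C"
    and h: "\<mu>\<^sub>A \<in> hom (Rel C) (Prod C A A) A" "\<mu>\<^sub>B \<in> hom (Rel C) (Prod C B B) B" "\<beta> \<in> hom (Rel C) A B"
    and ty: "a \<in> hom C X A" "a' \<in> hom C X A" "x \<in> hom C X A" "b \<in> hom C X B" "b' \<in> hom C X B" "y \<in> hom C X B"
    and rel: "related \<mu>\<^sub>A (pairing C a' x) a" "related \<beta> x y" "related \<mu>\<^sub>B (pairing C y b) b'"
  shows "related (choi (Rel C) A \<mu>\<^sub>A B \<mu>\<^sub>B \<beta>) (pairing C a b) (pairing C a' b')"
proof -
  note p = pairing_in_hom and as = prod_assoc_props[OF Obj(1,2,2)]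
  note idA = rel_id_in_hom[OF Obj(1)] and idB = rel_id_in_hom[OF Obj(2)]
  let ?R = "rel_tensor C (rel_dagger C \<mu>\<^sub>A) (rel_id C B)"
  let ?Q = "rel_tensor C (rel_tensor C (rel_id C A) \<beta>) (rel_id C B)"
  let ?P = "rel_tensor C (rel_id C A) \<mu>\<^sub>B"
  note dA = rel_dagger_in_hom[OF h(1)] and IB = rel_tensor_in_hom[OF idA h(3)]
  note R = rel_tensor_in_hom[OF dA idB]
    and Q = rel_tensor_in_hom[OF IB idB] and P = rel_tensor_in_hom[OF idA h(2)]
  note QR = rel_comp_in_hom[OF R Q]
  note aQR = rel_comp_in_hom[OF QR graph_in_hom[OF as(1)]]
  have "related ?R (pairing C a b) (pairing C (pairing C a' x) b)"
    using related_tensor[OF dA idB ty(1) p[OF ty(2,3)] ty(4,4)] related_id[OF ty(4,4)]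
      related_dagger[OF h(1) ty(1) p[OF ty(2,3)]] rel(1) by simp
  moreover have "related ?Q (pairing C (pairing C a' x) b) (pairing C (pairing C a' y) b)"
    using related_tensor[OF IB idB p[OF ty(2,3)] p[OF ty(2,6)] ty(4,4)] related_id[OF ty(4,4)]
      related_tensor[OF idA h(3) ty(2,2,3,6)] related_id[OF ty(2,2)] rel(2) by simp
  ultimately have "related (rel_comp C ?Q ?R) (pairing C a b) (pairing C (pairing C a' y) b)"
    by (rule related_compI[OF _ _ R Q p[OF ty(1,4)] p[OF p[OF ty(2,3)] ty(4)] p[OF p[OF ty(2,6)] ty(4)]])
  then have "related (rel_comp C (graph C (prod_assoc C A B B)) (rel_comp C ?Q ?R)) (pairing C a b)
      (pairing C a' (pairing C y b))"
    using related_monic_graph_comp[OF as(3,1) QR p[OF ty(1,4)] p[OF p[OF ty(2,6)] ty(4)]] as(2)[OF ty(2,6,4)] by simp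
  moreover have "related ?P (pairing C a' (pairing C y b)) (pairing C a' b')"
    using related_tensor[OF idA h(2) ty(2,2) p[OF ty(6,4)] ty(5)] related_id[OF ty(2,2)] rel(3) by simp
  ultimately show ?thesis unfolding choi_def Rel_simps
    by (rule related_compI[OF _ _ aQR P p[OF ty(1,4)] p[OF ty(2) p[OF ty(6,4)]] p[OF ty(2,5)]])
qed

lemma related_choiE:
  assumes Obj: "A \<in> Obj C" "B \<in> Obj C"
    and h: "\<mu>\<^sub>A \<in> hom (Rel C) (Prod C A A) A" "\<mu>\<^sub>B \<in> hom (Rel C) (Prod C B B) B" "\<beta> \<in> hom (Rel C) A B"
    and ty: "a \<in> hom C X A" "a' \<in> hom C X A" "b \<in> hom C X B" "b' \<in> hom C X B"
    and rel: "related (choi (Rel C) A \<mu>\<^sub>A B \<mu>\<^sub>B \<beta>) (pairing C a b) (pairing C a' b')"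
  obtains Y c x y where "cover c" "c \<in> hom C Y X" "x \<in> hom C Y A" "y \<in> hom C Y B"
    "related \<mu>\<^sub>A (pairing C (a' \<cdot> c) x) (a \<cdot> c)" "related \<beta> x y" "related \<mu>\<^sub>B (pairing C y (b \<cdot> c)) (b' \<cdot> c)"
proof -
  note p = pairing_in_hom and as = prod_assoc_props[OF Obj(1,2,2)] and PO = Prod_in_Obj
  note idA = rel_id_in_hom[OF Obj(1)] and idB = rel_id_in_hom[OF Obj(2)]
  let ?R = "rel_tensor C (rel_dagger C \<mu>\<^sub>A) (rel_id C B)"
  let ?Q = "rel_tensor C (rel_tensor C (rel_id C A) \<beta>) (rel_id C B)"
  let ?P = "rel_tensor C (rel_id C A) \<mu>\<^sub>B"
  note dA = rel_dagger_in_hom[OF h(1)] and IB = rel_tensor_in_hom[OF idA h(3)]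
  note R = rel_tensor_in_hom[OF dA idB]
    and Q = rel_tensor_in_hom[OF IB idB] and P = rel_tensor_in_hom[OF idA h(2)]
  note QR = rel_comp_in_hom[OF R Q]
  note aQR = rel_comp_in_hom[OF QR graph_in_hom[OF as(1)]]
  obtain Y1 c1 e where c1: "cover c1" "c1 \<in> hom C Y1 X" "e \<in> hom C Y1 (Prod C A (Prod C B B))"
      "related (rel_comp C (graph C (prod_assoc C A B B)) (rel_comp C ?Q ?R)) (pairing C a b \<cdot> c1) e"
      "related ?P e (pairing C a' b' \<cdot> c1)"
    using related_compE[OF rel[unfolded choi_def Rel_simps] aQR P p[OF ty(1,3)] p[OF ty(2,4)]] .
  obtain e1 e23 where e': "e1 \<in> hom C Y1 A" "e23 \<in> hom C Y1 (Prod C B B)" "e = pairing C e1 e23"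
    using hom_Prod_cases[OF c1(3) Obj(1) PO[OF Obj(2,2)]] .
  obtain e2 e3 where e'': "e2 \<in> hom C Y1 B" "e3 \<in> hom C Y1 B" "e23 = pairing C e2 e3"
    using hom_Prod_cases[OF e'(2) Obj(2,2)] .
  note e = e'(1) e''(1,2)
  note t1 = Comp_in_hom[OF c1(2) ty(1)] Comp_in_hom[OF c1(2) ty(2)] Comp_in_hom[OF c1(2) ty(3)]
    Comp_in_hom[OF c1(2) ty(4)]
  have "related (rel_comp C (graph C (prod_assoc C A B B)) (rel_comp C ?Q ?R)) (pairing C (a \<cdot> c1) (b \<cdot> c1))
      (prod_assoc C A B B \<cdot> pairing C (pairing C e1 e2) e3)"
    using c1(4) unfolding as(2)[OF e] pairing_hom_Comp[OF ty(1,3) c1(2)] e'(3) e''(3) .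
  then have QR1: "related (rel_comp C ?Q ?R) (pairing C (a \<cdot> c1) (b \<cdot> c1)) (pairing C (pairing C e1 e2) e3)"
    using related_monic_graph_comp[OF as(3,1) QR p[OF t1(1,3)] p[OF p[OF e(1,2)] e(3)]] by simp
  have "related ?P (pairing C e1 (pairing C e2 e3)) (pairing C (a' \<cdot> c1) (b' \<cdot> c1))"
    using c1(5) unfolding pairing_hom_Comp[OF ty(2,4) c1(2)] e'(3) e''(3) .
  then have e1: "e1 = a' \<cdot> c1" and m1: "related \<mu>\<^sub>B (pairing C e2 e3) (b' \<cdot> c1)"
    using related_tensor[OF idA h(2) e(1) t1(2) p[OF e(2,3)] t1(4)] related_id[OF e(1) t1(2)] by simp_all
  obtain Y c2 k where c2: "cover c2" "c2 \<in> hom C Y Y1" "k \<in> hom C Y (Prod C (Prod C A A) B)"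
      "related ?R (pairing C (a \<cdot> c1) (b \<cdot> c1) \<cdot> c2) k" "related ?Q k (pairing C (pairing C e1 e2) e3 \<cdot> c2)"
    using related_compE[OF QR1 R Q p[OF t1(1,3)] p[OF p[OF e(1,2)] e(3)]] .
  obtain k12 k3 where k': "k12 \<in> hom C Y (Prod C A A)" "k3 \<in> hom C Y B" "k = pairing C k12 k3"
    using hom_Prod_cases[OF c2(3) PO[OF Obj(1,1)] Obj(2)] .
  obtain k1 k2 where k'': "k1 \<in> hom C Y A" "k2 \<in> hom C Y A" "k12 = pairing C k1 k2"
    using hom_Prod_cases[OF k'(1) Obj(1,1)] .
  note k = k''(1,2) k'(2)
  note t2 = Comp_in_hom[OF c2(2) t1(1)] Comp_in_hom[OF c2(2) t1(2)] Comp_in_hom[OF c2(2) t1(3)]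
    Comp_in_hom[OF c2(2) t1(4)]
  note e2 = Comp_in_hom[OF c2(2) e(1)] Comp_in_hom[OF c2(2) e(2)] Comp_in_hom[OF c2(2) e(3)]
  have "related ?R (pairing C ((a \<cdot> c1) \<cdot> c2) ((b \<cdot> c1) \<cdot> c2)) (pairing C (pairing C k1 k2) k3)"
    using c2(4) unfolding pairing_hom_Comp[OF t1(1,3) c2(2)] k'(3) k''(3) .
  then have 1: "related \<mu>\<^sub>A (pairing C k1 k2) ((a \<cdot> c1) \<cdot> c2)" "(b \<cdot> c1) \<cdot> c2 = k3"
    using related_tensor[OF dA idB t2(1) p[OF k(1,2)] t2(3) k(3)] related_id[OF t2(3) k(3)]
      related_dagger[OF h(1) t2(1) p[OF k(1,2)]] by simp_all
  have "related ?Q (pairing C (pairing C k1 k2) k3) (pairing C (pairing C (e1 \<cdot> c2) (e2 \<cdot> c2)) (e3 \<cdot> c2))"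
    using c2(5) unfolding pairing_hom_Comp[OF p[OF e(1,2)] e(3) c2(2)] pairing_hom_Comp[OF e(1,2) c2(2)] k'(3) k''(3) .
  then have 2: "k1 = e1 \<cdot> c2" "related \<beta> k2 (e2 \<cdot> c2)" "k3 = e3 \<cdot> c2"
    using related_tensor[OF IB idB p[OF k(1,2)] p[OF e2(1,2)] k(3) e2(3)] related_id[OF k(3) e2(3)]
      related_tensor[OF idA h(3) k(1) e2(1) k(2) e2(2)] related_id[OF k(1) e2(1)] by simp_all
  have m2: "related \<mu>\<^sub>B (pairing C (e2 \<cdot> c2) (e3 \<cdot> c2)) ((b' \<cdot> c1) \<cdot> c2)"
    using related_cover[OF m1 h(2) p[OF e(2,3)] t1(4) c2(2)] unfolding pairing_hom_Comp[OF e(2,3) c2(2)] .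
  have shift: "(f \<cdot> c1) \<cdot> c2 = f \<cdot> (c1 \<cdot> c2)" if "f \<in> hom C X Z" for f Z
    using that c1(2) c2(2) by (simp add: hom_def)
  show ?thesis
  proof (rule that)
    show "cover (c1 \<cdot> c2)" using c1(1,2) c2(1,2) by (intro cover_Comp) (simp_all add: hom_def)
    show "c1 \<cdot> c2 \<in> hom C Y X" by (rule Comp_in_hom[OF c2(2) c1(2)])
    show "k2 \<in> hom C Y A" "e2 \<cdot> c2 \<in> hom C Y B" by fact+
    show "related \<mu>\<^sub>A (pairing C (a' \<cdot> c1 \<cdot> c2) k2) (a \<cdot> c1 \<cdot> c2)"
      using 1(1) 2(1) unfolding e1 shift[OF ty(1)] shift[OF ty(2)] by simp
    show "related \<beta> k2 (e2 \<cdot> c2)" by fact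
    show "related \<mu>\<^sub>B (pairing C (e2 \<cdot> c2) (b \<cdot> c1 \<cdot> c2)) (b' \<cdot> c1 \<cdot> c2)"
      using m2 1(2) 2(3) unfolding shift[OF ty(3)] shift[OF ty(4)] by simp
  qed
qed

text \<open>If \<open>f\<close> and \<open>h\<close> have a common \<open>g\<close>-image \<open>x\<close>, then each of them shares \<open>x\<close> with itself.\<close>

lemma positive_diagonal:
  assumes "g \<in> hom (Rel C) P Q" "related (rel_comp C (rel_dagger C g) g) f h" "f \<in> hom C X P" "h \<in> hom C X P"
  shows "related (rel_comp C (rel_dagger C g) g) f f" "related (rel_comp C (rel_dagger C g) g) h h"
proof -
  note d = rel_dagger_in_hom[OF assms(1)]
  note gg = rel_comp_in_hom[OF assms(1) d]
  obtain Y c x where c: "cover c" "c \<in> hom C Y X" "x \<in> hom C Y Q" "related g (f \<cdot> c) x"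
      "related (rel_dagger C g) x (h \<cdot> c)"
    using related_compE[OF assms(2,1) d assms(3,4)] .
  note fc = Comp_in_hom[OF c(2) assms(3)] and hc = Comp_in_hom[OF c(2) assms(4)]
  have hx: "related g (h \<cdot> c) x" using c(5) related_dagger[OF assms(1) c(3) hc] by simp
  have fx: "related (rel_dagger C g) x (f \<cdot> c)" using c(4) related_dagger[OF assms(1) c(3) fc] by simp
  show "related (rel_comp C (rel_dagger C g) g) f f"
    by (rule related_uncover[OF related_compI[OF c(4) fx assms(1) d fc c(3) fc] c(1) gg assms(3,3) c(2)])
  show "related (rel_comp C (rel_dagger C g) g) h h"
    by (rule related_uncover[OF related_compI[OF hx c(5) assms(1) d hc c(3) hc] c(1) gg assms(4,4) c(2)])
qed

end

section \<open>Frobenius structures as partial multiplications\<close>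

locale frobenius_in_Rel = cartesian_regular_category C
  for C :: "('o, 'm, 'z) cartesian_category_scheme" (structure) +
  fixes A :: 'o and \<mu> \<eta> :: "'o \<times> 'm set \<times> 'o"
  assumes frobenius: "special_dagger_frobenius (Rel C) A \<mu> \<eta>"
begin

definition mult :: "'m \<Rightarrow> 'm \<Rightarrow> 'm \<Rightarrow> bool" where
  "mult a b c \<longleftrightarrow> related \<mu> (pairing C a b) c"

text \<open>The unit is a relation from the terminal object, i.e. a subobject of \<open>A\<close>; the first component of a pair in it
  carries no information.\<close>

definition unit :: "'m \<Rightarrow> bool" where
  "unit u \<longleftrightarrow> related \<eta> (bang (Dom C u)) u"

lemma A_Obj: "A \<in> Obj C"
  and \<mu>_hom: "\<mu> \<in> hom (Rel C) (Prod C A A) A"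
  and \<eta>_hom: "\<eta> \<in> hom (Rel C) (Terminal C) A"
  and unit_right_law: "rel_comp C \<mu> (rel_tensor C (rel_id C A) \<eta>) = graph C (Pr1 C A (Terminal C))"
  and unit_left_law: "rel_comp C \<mu> (rel_tensor C \<eta> (rel_id C A)) = graph C (Pr2 C (Terminal C) A)"
  and assoc_law: "rel_comp C \<mu> (rel_tensor C \<mu> (rel_id C A)) =
    rel_comp C \<mu> (rel_comp C (rel_tensor C (rel_id C A) \<mu>) (graph C (prod_assoc C A A A)))"
  and special_law: "rel_comp C \<mu> (rel_dagger C \<mu>) = rel_id C A"
  using frobenius by (simp_all add: special_dagger_frobenius_def)

lemma bang_in_hom: "X \<in> Obj C \<Longrightarrow> bang X \<in> hom C X (Terminal C)"
  by (simp add: hom_def)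

lemma bang_Comp: "c \<in> hom C Y X \<Longrightarrow> bang X \<cdot> c = bang Y"
  by (rule Terminal_eq) (auto simp: hom_def)

lemma unit_iff: "u \<in> hom C X A \<Longrightarrow> unit u \<longleftrightarrow> related \<eta> (bang X) u"
  by (simp add: unit_def hom_def)

lemma unit_stable: "unit u \<Longrightarrow> u \<in> hom C X A \<Longrightarrow> c \<in> hom C Y X \<Longrightarrow> unit (u \<cdot> c)"
  using related_cover[OF _ \<eta>_hom bang_in_hom, of X u c Y] Comp_in_hom[of c Y X u A]
  by (simp add: unit_iff bang_Comp hom_Obj)

lemma mult_stable:
  assumes "mult a b d" "a \<in> hom C X A" "b \<in> hom C X A" "d \<in> hom C X A" "c \<in> hom C Y X"
  shows "mult (a \<cdot> c) (b \<cdot> c) (d \<cdot> c)"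
  using related_cover[OF _ \<mu>_hom pairing_in_hom[OF assms(2,3)] assms(4,5)] assms(1)
  by (simp add: mult_def pairing_hom_Comp[OF assms(2,3,5)])

lemma mult_local:
  assumes "mult (a \<cdot> c) (b \<cdot> c) (d \<cdot> c)" "cover c"
    and "a \<in> hom C X A" "b \<in> hom C X A" "d \<in> hom C X A" "c \<in> hom C Y X"
  shows "mult a b d"
  using related_uncover[OF _ assms(2) \<mu>_hom pairing_in_hom[OF assms(3,4)] assms(5,6)] assms(1)
  by (simp add: mult_def pairing_hom_Comp[OF assms(3,4,6)])

lemma unit_right_eq:
  assumes "mult a u d" "unit u" "a \<in> hom C X A" "u \<in> hom C X A" "d \<in> hom C X A"
  shows "d = a"
proof -
  have X: "X \<in> Obj C" using assms(3) by (rule hom_Obj)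
  note b = bang_in_hom[OF X]
  have "related (rel_tensor C (rel_id C A) \<eta>) (pairing C a (bang X)) (pairing C a u)"
    using related_tensor[OF rel_id_in_hom[OF A_Obj] \<eta>_hom assms(3,3) b assms(4)]
      related_id[OF assms(3,3)] assms(2) unit_iff[OF assms(4)] by simp
  then have "related (graph C (Pr1 C A (Terminal C))) (pairing C a (bang X)) d"
    unfolding unit_right_law[symmetric]
    by (rule related_compI[OF _ assms(1)[unfolded mult_def] rel_tensor_in_hom[OF rel_id_in_hom[OF A_Obj] \<eta>_hom]
          \<mu>_hom pairing_in_hom[OF assms(3) b] pairing_in_hom[OF assms(3,4)] assms(5)])
  then show ?thesis
    using related_graph[OF Pr1_in_hom[OF A_Obj Terminal_in_Obj] pairing_in_hom[OF assms(3) b] assms(5)]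
      assms(3) b by (simp add: hom_def)
qed

lemma unit_left_eq:
  assumes "mult u a d" "unit u" "a \<in> hom C X A" "u \<in> hom C X A" "d \<in> hom C X A"
  shows "d = a"
proof -
  have X: "X \<in> Obj C" using assms(3) by (rule hom_Obj)
  note b = bang_in_hom[OF X]
  have "related (rel_tensor C \<eta> (rel_id C A)) (pairing C (bang X) a) (pairing C u a)"
    using related_tensor[OF \<eta>_hom rel_id_in_hom[OF A_Obj] b assms(4,3,3)]
      related_id[OF assms(3,3)] assms(2) unit_iff[OF assms(4)] by simp
  then have "related (graph C (Pr2 C (Terminal C) A)) (pairing C (bang X) a) d"
    unfolding unit_left_law[symmetric]
    by (rule related_compI[OF _ assms(1)[unfolded mult_def] rel_tensor_in_hom[OF \<eta>_hom rel_id_in_hom[OF A_Obj]]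
          \<mu>_hom pairing_in_hom[OF b assms(3)] pairing_in_hom[OF assms(4,3)] assms(5)])
  then show ?thesis
    using related_graph[OF Pr2_in_hom[OF Terminal_in_Obj A_Obj] pairing_in_hom[OF b assms(3)] assms(5)]
      assms(3) b by (simp add: hom_def)
qed

lemma unit_right_exists:
  assumes a: "a \<in> hom C X A"
  obtains Y c u where "cover c" "c \<in> hom C Y X" "u \<in> hom C Y A" "unit u" "mult (a \<cdot> c) u (a \<cdot> c)"
proof -
  have X: "X \<in> Obj C" using a by (rule hom_Obj)
  note b = bang_in_hom[OF X]
  note T = rel_tensor_in_hom[OF rel_id_in_hom[OF A_Obj] \<eta>_hom]
  have "related (graph C (Pr1 C A (Terminal C))) (pairing C a (bang X)) a"
    using related_graph[OF Pr1_in_hom[OF A_Obj Terminal_in_Obj] pairing_in_hom[OF a b] a]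
      a b by (simp add: hom_def)
  then obtain Y c e where c: "cover c" "c \<in> hom C Y X" "e \<in> hom C Y (Prod C A A)"
      "related (rel_tensor C (rel_id C A) \<eta>) (pairing C a (bang X) \<cdot> c) e" "related \<mu> e (a \<cdot> c)"
    unfolding unit_right_law[symmetric] by (rule related_compE[OF _ T \<mu>_hom pairing_in_hom[OF a b] a])
  obtain e1 e2 where e: "e1 \<in> hom C Y A" "e2 \<in> hom C Y A" "e = pairing C e1 e2"
    using hom_Prod_cases[OF c(3) A_Obj A_Obj] .
  note ac = Comp_in_hom[OF c(2) a] and bY = bang_in_hom[OF hom_Obj(1)[OF c(2)]]
  have "related (rel_tensor C (rel_id C A) \<eta>) (pairing C (a \<cdot> c) (bang Y)) (pairing C e1 e2)"
    using c(4) unfolding e(3) pairing_hom_Comp[OF a b c(2)] bang_Comp[OF c(2)] .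
  then have "a \<cdot> c = e1" "unit e2"
    using related_tensor[OF rel_id_in_hom[OF A_Obj] \<eta>_hom ac e(1) bY e(2)]
      related_id[OF ac e(1)] unit_iff[OF e(2)] by simp_all
  then show ?thesis using that[OF c(1,2) e(2)] c(5) unfolding e(3) mult_def by simp
qed

lemma unit_left_exists:
  assumes a: "a \<in> hom C X A"
  obtains Y c u where "cover c" "c \<in> hom C Y X" "u \<in> hom C Y A" "unit u" "mult u (a \<cdot> c) (a \<cdot> c)"
proof -
  have X: "X \<in> Obj C" using a by (rule hom_Obj)
  note b = bang_in_hom[OF X]
  note T = rel_tensor_in_hom[OF \<eta>_hom rel_id_in_hom[OF A_Obj]]
  have "related (graph C (Pr2 C (Terminal C) A)) (pairing C (bang X) a) a"
    using related_graph[OF Pr2_in_hom[OF Terminal_in_Obj A_Obj] pairing_in_hom[OF b a] a]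
      a b by (simp add: hom_def)
  then obtain Y c e where c: "cover c" "c \<in> hom C Y X" "e \<in> hom C Y (Prod C A A)"
      "related (rel_tensor C \<eta> (rel_id C A)) (pairing C (bang X) a \<cdot> c) e" "related \<mu> e (a \<cdot> c)"
    unfolding unit_left_law[symmetric] by (rule related_compE[OF _ T \<mu>_hom pairing_in_hom[OF b a] a])
  obtain e1 e2 where e: "e1 \<in> hom C Y A" "e2 \<in> hom C Y A" "e = pairing C e1 e2"
    using hom_Prod_cases[OF c(3) A_Obj A_Obj] .
  note ac = Comp_in_hom[OF c(2) a] and bY = bang_in_hom[OF hom_Obj(1)[OF c(2)]]
  have "related (rel_tensor C \<eta> (rel_id C A)) (pairing C (bang Y) (a \<cdot> c)) (pairing C e1 e2)"
    using c(4) unfolding e(3) pairing_hom_Comp[OF b a c(2)] bang_Comp[OF c(2)] .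
  then have "a \<cdot> c = e2" "unit e1"
    using related_tensor[OF \<eta>_hom rel_id_in_hom[OF A_Obj] bY e(1) ac e(2)]
      related_id[OF ac e(2)] unit_iff[OF e(1)] by simp_all
  then show ?thesis using that[OF c(1,2) e(1)] c(5) unfolding e(3) mult_def by simp
qed

lemma mult_functional:
  assumes "mult a b d" "mult a b d'" and ty: "a \<in> hom C X A" "b \<in> hom C X A" "d \<in> hom C X A" "d' \<in> hom C X A"
  shows "d = d'"
proof -
  note ab = pairing_in_hom[OF ty(1,2)]
  have "related (rel_dagger C \<mu>) d (pairing C a b)"
    using assms(1) related_dagger[OF \<mu>_hom ty(3) ab] by (simp add: mult_def)
  then have "related (rel_id C A) d d'"
    unfolding special_law[symmetric]
    by (rule related_compI[OF _ assms(2)[unfolded mult_def] rel_dagger_in_hom[OF \<mu>_hom] \<mu>_hom ty(3) ab ty(4)])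
  then show ?thesis using related_id[OF ty(3,4)] by simp
qed

text \<open>The intermediate product of the other bracketing is only obtained over a cover.\<close>

lemma mult_assoc:
  assumes "mult a b d" "mult d b' e"
    and ty: "a \<in> hom C X A" "b \<in> hom C X A" "b' \<in> hom C X A" "d \<in> hom C X A" "e \<in> hom C X A"
  obtains Y c d' where "cover c" "c \<in> hom C Y X" "d' \<in> hom C Y A"
    "mult (b \<cdot> c) (b' \<cdot> c) d'" "mult (a \<cdot> c) d' (e \<cdot> c)"
proof -
  note p = pairing_in_hom
  note id = rel_id_in_hom[OF A_Obj] and as = prod_assoc_props[OF A_Obj A_Obj A_Obj]
  note abb = p[OF ty(1) p[OF ty(2,3)]]
  note T = rel_tensor_in_hom[OF id \<mu>_hom] and T' = rel_tensor_in_hom[OF \<mu>_hom id]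
  have "related (rel_tensor C \<mu> (rel_id C A)) (pairing C (pairing C a b) b') (pairing C d b')"
    using related_tensor[OF \<mu>_hom id p[OF ty(1,2)] ty(4,3,3)] related_id[OF ty(3,3)] assms(1)
    by (simp add: mult_def)
  then have "related (rel_comp C \<mu> (rel_tensor C \<mu> (rel_id C A))) (pairing C (pairing C a b) b') e"
    by (rule related_compI[OF _ assms(2)[unfolded mult_def] T' \<mu>_hom p[OF p[OF ty(1,2)] ty(3)] p[OF ty(4,3)] ty(5)])
  then obtain Y c f where c: "cover c" "c \<in> hom C Y X" "f \<in> hom C Y (Prod C A A)"
      "related (rel_comp C (rel_tensor C (rel_id C A) \<mu>) (graph C (prod_assoc C A A A)))
        (pairing C (pairing C a b) b' \<cdot> c) f" "related \<mu> f (e \<cdot> c)"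
    unfolding assoc_law
    by (rule related_compE[OF _ rel_comp_in_hom[OF graph_in_hom[OF as(1)] T] \<mu>_hom p[OF p[OF ty(1,2)] ty(3)] ty(5)])
  obtain f1 f2 where f: "f1 \<in> hom C Y A" "f2 \<in> hom C Y A" "f = pairing C f1 f2"
    using hom_Prod_cases[OF c(3) A_Obj A_Obj] .
  note tc = Comp_in_hom[OF c(2) ty(1)] Comp_in_hom[OF c(2) ty(2)] Comp_in_hom[OF c(2) ty(3)]
  have "pairing C (pairing C a b) b' \<cdot> c = pairing C (pairing C (a \<cdot> c) (b \<cdot> c)) (b' \<cdot> c)"
    using pairing_hom_Comp[OF p[OF ty(1,2)] ty(3) c(2)] pairing_hom_Comp[OF ty(1,2) c(2)] by simp
  then have "related (rel_tensor C (rel_id C A) \<mu>) (pairing C (a \<cdot> c) (pairing C (b \<cdot> c) (b' \<cdot> c))) (pairing C f1 f2)"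
    using c(4) related_comp_graph[OF as(1) T p[OF p[OF tc(1,2)] tc(3)] c(3)] as(2)[OF tc] by (simp add: f(3))
  then have "a \<cdot> c = f1" "mult (b \<cdot> c) (b' \<cdot> c) f2"
    using related_tensor[OF id \<mu>_hom tc(1) f(1) p[OF tc(2,3)] f(2)] related_id[OF tc(1) f(1)]
    by (simp_all add: mult_def)
  then show ?thesis using that[OF c(1,2) f(2)] c(5) unfolding f(3) mult_def by simp
qed

lemma related_tensor_mult:
  assumes "a \<in> hom C X A" "a' \<in> hom C X A" "b \<in> hom C X A" "b' \<in> hom C X A" "d \<in> hom C X A" "d' \<in> hom C X A"
  shows "related (tensor_mult (Rel C) A \<mu> A \<mu>) (pairing C (pairing C a b) (pairing C a' b')) (pairing C d d')
    \<longleftrightarrow> mult a a' d \<and> mult b b' d'"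
proof -
  note p = pairing_in_hom and ms = middle_swap_props[OF A_Obj A_Obj]
  have "related (tensor_mult (Rel C) A \<mu> A \<mu>) (pairing C (pairing C a b) (pairing C a' b')) (pairing C d d') \<longleftrightarrow>
      related (rel_tensor C \<mu> \<mu>) (pairing C (pairing C a a') (pairing C b b')) (pairing C d d')"
    unfolding tensor_mult_def interchange_Rel[OF A_Obj A_Obj] Rel_simps
      ms(2)[OF assms(1,3,2,4), symmetric]
    by (rule related_comp_graph[OF ms(1) rel_tensor_in_hom[OF \<mu>_hom \<mu>_hom]
          p[OF p[OF assms(1,3)] p[OF assms(2,4)]] p[OF assms(5,6)]])
  also have "\<dots> \<longleftrightarrow> mult a a' d \<and> mult b b' d'"
    unfolding mult_def
    by (rule related_tensor[OF \<mu>_hom \<mu>_hom p[OF assms(1,2)] assms(5) p[OF assms(3,4)] assms(6)])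
  finally show ?thesis .
qed

lemma tensor_mult_hom:
  "tensor_mult (Rel C) A \<mu> A \<mu> \<in> hom (Rel C) (Prod C (Prod C A A) (Prod C A A)) (Prod C A A)"
  unfolding tensor_mult_def interchange_Rel[OF A_Obj A_Obj] Rel_simps
  by (rule rel_comp_in_hom[OF graph_in_hom[OF middle_swap_props(1)[OF A_Obj A_Obj]]
        rel_tensor_in_hom[OF \<mu>_hom \<mu>_hom]])

end

section \<open>Broadcasting maps\<close>

locale broadcasting_in_Rel = frobenius_in_Rel C A \<mu> \<eta>
  for C :: "('o, 'm, 'z) cartesian_category_scheme" (structure)
    and A :: 'o and \<mu> \<eta> :: "'o \<times> 'm set \<times> 'o" +
  fixes \<beta> :: "'o \<times> 'm set \<times> 'o"
  assumes broadcasting: "broadcasting_map (Rel C) A \<mu> \<eta> \<beta>"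
begin

lemma \<beta>_hom: "\<beta> \<in> hom (Rel C) A (Prod C A A)"
  and marginal_right_law: "rel_comp C (graph C (Pr1 C A (Terminal C)))
    (rel_comp C (rel_tensor C (rel_id C A) (rel_dagger C \<eta>)) \<beta>) = rel_id C A"
  and marginal_left_law: "rel_comp C (graph C (Pr2 C (Terminal C) A))
    (rel_comp C (rel_tensor C (rel_dagger C \<eta>) (rel_id C A)) \<beta>) = rel_id C A"
  using broadcasting by (simp_all add: broadcasting_map_def completely_positive_def)

text \<open>Discarding an output that is a unit leaves a pair of the identity relation.\<close>

lemma marginal_right_eq:
  assumes rel: "related \<beta> a (pairing C b u)" and u: "unit u"
    and ty: "a \<in> hom C X A" "b \<in> hom C X A" "u \<in> hom C X A"
  shows "b = a"
proof -
  note p = pairing_in_hom and bX = bang_in_hom[OF hom_Obj(1)[OF ty(1)]]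
  note id = rel_id_in_hom[OF A_Obj] and d\<eta> = rel_dagger_in_hom[OF \<eta>_hom]
    and Pr = Pr1_in_hom[OF A_Obj Terminal_in_Obj]
  note T = rel_tensor_in_hom[OF id d\<eta>]
  have "related (rel_tensor C (rel_id C A) (rel_dagger C \<eta>)) (pairing C b u) (pairing C b (bang X))"
    using related_tensor[OF id d\<eta> ty(2,2,3) bX] related_id[OF ty(2,2)] related_dagger[OF \<eta>_hom ty(3) bX]
      u unit_iff[OF ty(3)] by simp
  then have 1: "related (rel_comp C (rel_tensor C (rel_id C A) (rel_dagger C \<eta>)) \<beta>) a (pairing C b (bang X))"
    by (rule related_compI[OF rel _ \<beta>_hom T ty(1) p[OF ty(2,3)] p[OF ty(2) bX]])
  have "related (graph C (Pr1 C A (Terminal C))) (pairing C b (bang X)) b"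
    using related_graph[OF Pr p[OF ty(2) bX] ty(2)] ty(2) bX by (simp add: hom_def)
  then have "related (rel_comp C (graph C (Pr1 C A (Terminal C))) (rel_comp C (rel_tensor C (rel_id C A) (rel_dagger C \<eta>)) \<beta>)) a b"
    by (rule related_compI[OF 1 _ rel_comp_in_hom[OF \<beta>_hom T] graph_in_hom[OF Pr] ty(1) p[OF ty(2) bX] ty(2)])
  then show ?thesis using related_id[OF ty(1,2)] unfolding marginal_right_law by simp
qed

lemma marginal_left_eq:
  assumes rel: "related \<beta> a (pairing C u b)" and u: "unit u"
    and ty: "a \<in> hom C X A" "b \<in> hom C X A" "u \<in> hom C X A"
  shows "b = a"
proof -
  note p = pairing_in_hom and bX = bang_in_hom[OF hom_Obj(1)[OF ty(1)]]
  note id = rel_id_in_hom[OF A_Obj] and d\<eta> = rel_dagger_in_hom[OF \<eta>_hom]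
    and Pr = Pr2_in_hom[OF Terminal_in_Obj A_Obj]
  note T = rel_tensor_in_hom[OF d\<eta> id]
  have "related (rel_tensor C (rel_dagger C \<eta>) (rel_id C A)) (pairing C u b) (pairing C (bang X) b)"
    using related_tensor[OF d\<eta> id ty(3) bX ty(2,2)] related_id[OF ty(2,2)] related_dagger[OF \<eta>_hom ty(3) bX]
      u unit_iff[OF ty(3)] by simp
  then have 1: "related (rel_comp C (rel_tensor C (rel_dagger C \<eta>) (rel_id C A)) \<beta>) a (pairing C (bang X) b)"
    by (rule related_compI[OF rel _ \<beta>_hom T ty(1) p[OF ty(3,2)] p[OF bX ty(2)]])
  have "related (graph C (Pr2 C (Terminal C) A)) (pairing C (bang X) b) b"
    using related_graph[OF Pr p[OF bX ty(2)] ty(2)] ty(2) bX by (simp add: hom_def)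
  then have "related (rel_comp C (graph C (Pr2 C (Terminal C) A)) (rel_comp C (rel_tensor C (rel_dagger C \<eta>) (rel_id C A)) \<beta>)) a b"
    by (rule related_compI[OF 1 _ rel_comp_in_hom[OF \<beta>_hom T] graph_in_hom[OF Pr] ty(1) p[OF bX ty(2)] ty(2)])
  then show ?thesis using related_id[OF ty(1,2)] unfolding marginal_left_law by simp
qed

lemma broadcast_exists:
  assumes a: "a \<in> hom C X A"
  obtains Y c u where "cover c" "c \<in> hom C Y X" "u \<in> hom C Y A" "unit u"
    "related \<beta> (a \<cdot> c) (pairing C (a \<cdot> c) u)"
proof -
  note p = pairing_in_hom
  note id = rel_id_in_hom[OF A_Obj] and d\<eta> = rel_dagger_in_hom[OF \<eta>_hom]
    and Pr = Pr1_in_hom[OF A_Obj Terminal_in_Obj]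
  note T = rel_tensor_in_hom[OF id d\<eta>]
  have "related (rel_comp C (graph C (Pr1 C A (Terminal C))) (rel_comp C (rel_tensor C (rel_id C A) (rel_dagger C \<eta>)) \<beta>)) a a"
    unfolding marginal_right_law using related_id[OF a a] by simp
  then obtain Y1 c1 e where c1: "cover c1" "c1 \<in> hom C Y1 X" "e \<in> hom C Y1 (Prod C A (Terminal C))"
      "related (rel_comp C (rel_tensor C (rel_id C A) (rel_dagger C \<eta>)) \<beta>) (a \<cdot> c1) e"
    by (rule related_compE[OF _ rel_comp_in_hom[OF \<beta>_hom T] graph_in_hom[OF Pr] a a])
  note ac1 = Comp_in_hom[OF c1(2) a]
  obtain e1 e2 where e: "e1 \<in> hom C Y1 A" "e2 \<in> hom C Y1 (Terminal C)" "e = pairing C e1 e2"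
    using hom_Prod_cases[OF c1(3) A_Obj Terminal_in_Obj] .
  obtain Y c2 k where c2: "cover c2" "c2 \<in> hom C Y Y1" "k \<in> hom C Y (Prod C A A)"
      "related \<beta> ((a \<cdot> c1) \<cdot> c2) k" "related (rel_tensor C (rel_id C A) (rel_dagger C \<eta>)) k (e \<cdot> c2)"
    using related_compE[OF c1(4) \<beta>_hom T ac1 c1(3)] .
  obtain b u where k: "b \<in> hom C Y A" "u \<in> hom C Y A" "k = pairing C b u"
    using hom_Prod_cases[OF c2(3) A_Obj A_Obj] .
  have e2: "e2 \<cdot> c2 = bang Y"
    using e(2) c2(2) by (intro Terminal_eq) (auto simp: hom_def)
  note bY = bang_in_hom[OF hom_Obj(1)[OF c2(2)]] and e1c2 = Comp_in_hom[OF c2(2) e(1)]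
  have "related (rel_tensor C (rel_id C A) (rel_dagger C \<eta>)) (pairing C b u) (pairing C (e1 \<cdot> c2) (bang Y))"
    using c2(5) unfolding e(3) k(3) pairing_hom_Comp[OF e(1,2) c2(2)] e2 .
  then have u: "unit u"
    using related_tensor[OF id d\<eta> k(1) e1c2 k(2) bY] related_dagger[OF \<eta>_hom k(2) bY] unit_iff[OF k(2)]
    by simp
  have shift: "(a \<cdot> c1) \<cdot> c2 = a \<cdot> (c1 \<cdot> c2)" using a c1(2) c2(2) by (simp add: hom_def)
  have rel: "related \<beta> (a \<cdot> c1 \<cdot> c2) (pairing C b u)" using c2(4) unfolding shift k(3) .
  note cc = Comp_in_hom[OF c2(2) c1(2)]
  have "b = a \<cdot> c1 \<cdot> c2" by (rule marginal_right_eq[OF rel u Comp_in_hom[OF cc a] k(1,2)])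
  moreover have "cover (c1 \<cdot> c2)" using c1(1,2) c2(1,2) by (intro cover_Comp) (simp_all add: hom_def)
  ultimately show ?thesis using that[OF _ cc k(2) u] rel by simp
qed

text \<open>A product decomposition \<open>a = a' x\<close>, \<open>y b = b'\<close>, \<open>z d = d'\<close> with \<open>\<beta>(x; y, z)\<close> gives an entry of the Choi relation; complete
  positivity then puts both of its ends on the diagonal.\<close>

lemma choi_diagonal:
  assumes ty: "a \<in> hom C X A" "a' \<in> hom C X A" "x \<in> hom C X A" "y \<in> hom C X A" "z \<in> hom C X A"
      "b \<in> hom C X A" "b' \<in> hom C X A" "d \<in> hom C X A" "d' \<in> hom C X A"
    and rel: "mult a' x a" "related \<beta> x (pairing C y z)" "mult y b b'" "mult z d d'"
  shows "related (choi (Rel C) A \<mu> (Prod C A A) (tensor_mult (Rel C) A \<mu> A \<mu>) \<beta>)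
      (pairing C a (pairing C b d)) (pairing C a (pairing C b d))"
    and "related (choi (Rel C) A \<mu> (Prod C A A) (tensor_mult (Rel C) A \<mu> A \<mu>) \<beta>)
      (pairing C a' (pairing C b' d')) (pairing C a' (pairing C b' d'))"
proof -
  let ?choi = "choi (Rel C) A \<mu> (Prod C A A) (tensor_mult (Rel C) A \<mu> A \<mu>) \<beta>"
  note p = pairing_in_hom
  have "related ?choi (pairing C a (pairing C b d)) (pairing C a' (pairing C b' d'))"
    using related_choiI[OF A_Obj Prod_in_Obj[OF A_Obj A_Obj] \<mu>_hom tensor_mult_hom \<beta>_hom
      ty(1,2,3) p[OF ty(6,8)] p[OF ty(7,9)] p[OF ty(4,5)] rel(1)[unfolded mult_def] rel(2)]
      related_tensor_mult[OF ty(4,6,5,8,7,9)] rel(3,4) by simp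
  moreover obtain P g where g: "g \<in> hom (Rel C) (Prod C A (Prod C A A)) P" "?choi = rel_comp C (rel_dagger C g) g"
    using broadcasting by (auto simp: broadcasting_map_def completely_positive_def)
  ultimately show "related ?choi (pairing C a (pairing C b d)) (pairing C a (pairing C b d))"
    "related ?choi (pairing C a' (pairing C b' d')) (pairing C a' (pairing C b' d'))"
    using positive_diagonal[OF g(1) _ p[OF ty(1) p[OF ty(6,8)]] p[OF ty(2) p[OF ty(7,9)]]] by simp_all
qed

lemma choi_diagonalE:
  assumes ty: "a \<in> hom C X A" "b \<in> hom C X A" "d \<in> hom C X A"
    and rel: "related (choi (Rel C) A \<mu> (Prod C A A) (tensor_mult (Rel C) A \<mu> A \<mu>) \<beta>)
      (pairing C a (pairing C b d)) (pairing C a (pairing C b d))"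
  obtains Y c x y z where "cover c" "c \<in> hom C Y X" "x \<in> hom C Y A" "y \<in> hom C Y A" "z \<in> hom C Y A"
    "mult (a \<cdot> c) x (a \<cdot> c)" "related \<beta> x (pairing C y z)" "mult y (b \<cdot> c) (b \<cdot> c)" "mult z (d \<cdot> c) (d \<cdot> c)"
proof -
  note p = pairing_in_hom
  obtain Y c x k where c: "cover c" "c \<in> hom C Y X" "x \<in> hom C Y A" "k \<in> hom C Y (Prod C A A)"
    "related \<mu> (pairing C (a \<cdot> c) x) (a \<cdot> c)" "related \<beta> x k"
    "related (tensor_mult (Rel C) A \<mu> A \<mu>) (pairing C k (pairing C b d \<cdot> c)) (pairing C b d \<cdot> c)"
    using related_choiE[OF A_Obj Prod_in_Obj[OF A_Obj A_Obj] \<mu>_hom tensor_mult_hom \<beta>_hom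
      ty(1,1) p[OF ty(2,3)] p[OF ty(2,3)] rel] .
  obtain y z where k: "y \<in> hom C Y A" "z \<in> hom C Y A" "k = pairing C y z"
    using hom_Prod_cases[OF c(4) A_Obj A_Obj] .
  note bc = Comp_in_hom[OF c(2) ty(2)] and dc = Comp_in_hom[OF c(2) ty(3)]
  have "mult y (b \<cdot> c) (b \<cdot> c)" "mult z (d \<cdot> c) (d \<cdot> c)"
    using c(7) related_tensor_mult[OF k(1) bc k(2) dc bc dc]
    unfolding k(3) pairing_hom_Comp[OF ty(2,3) c(2)] by simp_all
  then show ?thesis using that[OF c(1-3) k(1,2) _ _ ] c(5,6) unfolding mult_def k(3) by simp
qed

text \<open>Over a cover \<open>a\<close> is broadcast to \<open>(a, u)\<close> with \<open>u\<close> a unit. The equations \<open>a = l a\<close>, \<open>a r = a\<close> and \<open>u u = u\<close> then make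
  \<open>(a, (r, u))\<close> and \<open>(l, (a, u))\<close> the two ends of an entry of the Choi relation. Both \<open>l\<close> and \<open>r\<close> turn out to equal \<open>u\<close>.\<close>

lemma units_agree:
  assumes ty: "a \<in> hom C X A" "l \<in> hom C X A" "r \<in> hom C X A"
    and units: "unit l" "unit r" and la: "mult l a a" and ar: "mult a r a"
  shows "l = r"
proof -
  have agree: "l = r"
    if ty: "a \<in> hom C X A" "l \<in> hom C X A" "r \<in> hom C X A" "u \<in> hom C X A"
      and units: "unit l" "unit r" "unit u" and la: "mult l a a" and ar: "mult a r a"
      and uu: "mult u u u" and au: "related \<beta> a (pairing C a u)" for X a l r u
  proof -
    note diag = choi_diagonal[OF ty(1,2,1,1,4,3,1,4,4) la au ar uu]
    \<comment> \<open>At the diagonal point \<open>(a, (r, u))\<close> the outputs \<open>y\<close> and \<open>z\<close> satisfy \<open>y r = r\<close> and \<open>z u = u\<close>, so they are \<open>r\<close> and \<open>u\<close>.\<close>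
    have "r = u"
    proof -
      obtain Y c x y z where c: "cover c" "c \<in> hom C Y X" and t: "x \<in> hom C Y A" "y \<in> hom C Y A" "z \<in> hom C Y A"
        and m: "mult (a \<cdot> c) x (a \<cdot> c)" "related \<beta> x (pairing C y z)" "mult y (r \<cdot> c) (r \<cdot> c)" "mult z (u \<cdot> c) (u \<cdot> c)"
        by (rule choi_diagonalE[OF ty(1,3,4) diag(1)])
      note rc = Comp_in_hom[OF c(2) ty(3)] and uc = Comp_in_hom[OF c(2) ty(4)]
      note ur = unit_stable[OF units(2) ty(3) c(2)] and uu = unit_stable[OF units(3) ty(4) c(2)]
      have "r \<cdot> c = y" by (rule unit_right_eq[OF m(3) ur t(2) rc rc])
      moreover have "u \<cdot> c = z" by (rule unit_right_eq[OF m(4) uu t(3) uc uc])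
      ultimately have b: "related \<beta> x (pairing C (r \<cdot> c) (u \<cdot> c))" using m(2) by simp
      have "r \<cdot> c = x" by (rule marginal_right_eq[OF b uu t(1) rc uc])
      moreover have "u \<cdot> c = x" by (rule marginal_left_eq[OF b ur t(1) uc rc])
      ultimately have "r \<cdot> c = u \<cdot> c" by simp
      then show ?thesis by (rule cover_epi[OF c(1)]) (use ty c in \<open>simp_all add: hom_def\<close>)
    qed
    \<comment> \<open>At the diagonal point \<open>(l, (a, u))\<close> the input \<open>x\<close> satisfies \<open>l x = l\<close>, so it is \<open>l\<close>; the marginals give \<open>y = l\<close>, then \<open>u = l\<close>.\<close>
    moreover have "l = u"
    proof -
      obtain Y c x y z where c: "cover c" "c \<in> hom C Y X" and t: "x \<in> hom C Y A" "y \<in> hom C Y A" "z \<in> hom C Y A"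
        and m: "mult (l \<cdot> c) x (l \<cdot> c)" "related \<beta> x (pairing C y z)" "mult y (a \<cdot> c) (a \<cdot> c)" "mult z (u \<cdot> c) (u \<cdot> c)"
        by (rule choi_diagonalE[OF ty(2,1,4) diag(2)])
      note lc = Comp_in_hom[OF c(2) ty(2)] and uc = Comp_in_hom[OF c(2) ty(4)]
      note ul = unit_stable[OF units(1) ty(2) c(2)] and uu = unit_stable[OF units(3) ty(4) c(2)]
      have x: "l \<cdot> c = x" by (rule unit_left_eq[OF m(1) ul t(1) lc lc])
      have z: "u \<cdot> c = z" by (rule unit_right_eq[OF m(4) uu t(3) uc uc])
      have b: "related \<beta> x (pairing C y (u \<cdot> c))" using m(2) unfolding z .
      have y: "y = x" by (rule marginal_right_eq[OF b uu t(1,2) uc])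
      have "related \<beta> x (pairing C (l \<cdot> c) (u \<cdot> c))" using b unfolding y x .
      then have "u \<cdot> c = x" by (rule marginal_left_eq[OF _ ul t(1) uc lc])
      then have "l \<cdot> c = u \<cdot> c" using x by simp
      then show ?thesis by (rule cover_epi[OF c(1)]) (use ty c in \<open>simp_all add: hom_def\<close>)
    qed
    ultimately show ?thesis by simp
  qed
  obtain Y1 c1 u where c1: "cover c1" "c1 \<in> hom C Y1 X" "u \<in> hom C Y1 A" "unit u"
      "related \<beta> (a \<cdot> c1) (pairing C (a \<cdot> c1) u)"
    by (rule broadcast_exists[OF ty(1)])
  obtain Y c2 s where c2: "cover c2" "c2 \<in> hom C Y Y1" "s \<in> hom C Y A" "unit s" "mult (u \<cdot> c2) s (u \<cdot> c2)"
    by (rule unit_right_exists[OF c1(3)])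
  note uc2 = Comp_in_hom[OF c2(2) c1(3)] and uu = unit_stable[OF c1(4,3) c2(2)]
  have "u \<cdot> c2 = s" by (rule unit_left_eq[OF c2(5) uu c2(3) uc2 uc2])
  then have uuu: "mult (u \<cdot> c2) (u \<cdot> c2) (u \<cdot> c2)" using c2(5) by simp
  let ?c = "c1 \<cdot> c2"
  note ch = Comp_in_hom[OF c2(2) c1(2)]
  have c: "cover ?c" using c1(1,2) c2(1,2) by (intro cover_Comp) (simp_all add: hom_def)
  have shift: "(a \<cdot> c1) \<cdot> c2 = a \<cdot> ?c" using ty(1) c1(2) c2(2) by (simp add: hom_def)
  note ac1 = Comp_in_hom[OF c1(2) ty(1)]
  have "related \<beta> (a \<cdot> ?c) (pairing C (a \<cdot> ?c) (u \<cdot> c2))"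
    using related_cover[OF c1(5) \<beta>_hom ac1 pairing_in_hom[OF ac1 c1(3)] c2(2)]
    unfolding pairing_hom_Comp[OF ac1 c1(3) c2(2)] shift .
  then have "l \<cdot> ?c = r \<cdot> ?c"
    by (rule agree[OF Comp_in_hom[OF ch ty(1)] Comp_in_hom[OF ch ty(2)] Comp_in_hom[OF ch ty(3)] uc2
          unit_stable[OF units(1) ty(2) ch] unit_stable[OF units(2) ty(3) ch] uu
          mult_stable[OF la ty(2,1,1) ch] mult_stable[OF ar ty(1,3,1) ch] uuu])
  then show ?thesis by (rule cover_epi[OF c]) (use ty ch in \<open>simp_all add: hom_def\<close>)
qed

lemma unit_two_sided:
  assumes ty: "a \<in> hom C X A" "u \<in> hom C X A" and u: "unit u"
  shows "mult u a a \<longleftrightarrow> mult a u a"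
proof
  assume ua: "mult u a a"
  obtain Y c r where c: "cover c" "c \<in> hom C Y X" "r \<in> hom C Y A" "unit r" "mult (a \<cdot> c) r (a \<cdot> c)"
    by (rule unit_right_exists[OF ty(1)])
  note ac = Comp_in_hom[OF c(2) ty(1)] and uc = Comp_in_hom[OF c(2) ty(2)]
  have "u \<cdot> c = r"
    by (rule units_agree[OF ac uc c(3) unit_stable[OF u ty(2) c(2)] c(4) mult_stable[OF ua ty(2,1,1) c(2)] c(5)])
  then show "mult a u a" using mult_local[OF _ c(1) ty(1,2,1) c(2)] c(5) by simp
next
  assume au: "mult a u a"
  obtain Y c l where c: "cover c" "c \<in> hom C Y X" "l \<in> hom C Y A" "unit l" "mult l (a \<cdot> c) (a \<cdot> c)"
    by (rule unit_left_exists[OF ty(1)])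
  note ac = Comp_in_hom[OF c(2) ty(1)] and uc = Comp_in_hom[OF c(2) ty(2)]
  have "l = u \<cdot> c"
    by (rule units_agree[OF ac c(3) uc c(4) unit_stable[OF u ty(2) c(2)] c(5) mult_stable[OF au ty(1,2,1) c(2)]])
  then show "mult u a a" using mult_local[OF _ c(1) ty(2,1,1) c(2)] c(5) by simp
qed

text \<open>The subobject of pairs \<open>(a, b)\<close> with a common product in both orders: the composite of \<open>\<mu> \<sigma>\<close> with
  the converse of \<open>\<mu>\<close> relates \<open>(a, b)\<close> to \<open>(a', b')\<close> when \<open>b a = a' b'\<close>, and pulling it back along the diagonal of \<open>A \<times> A\<close>
  imposes \<open>(a, b) = (a', b')\<close>. Since products are unique, membership then transports any value of \<open>a b\<close> to \<open>b a\<close>.\<close>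

lemma commuting_relation:
  obtains F where "F \<in> hom (Rel C) A A"
    "\<And>X a b d. a \<in> hom C X A \<Longrightarrow> b \<in> hom C X A \<Longrightarrow> d \<in> hom C X A \<Longrightarrow> mult a b d \<Longrightarrow> mult b a d \<Longrightarrow> related F a b"
    "\<And>X a b d. a \<in> hom C X A \<Longrightarrow> b \<in> hom C X A \<Longrightarrow> d \<in> hom C X A \<Longrightarrow> related F a b \<Longrightarrow> mult a b d \<Longrightarrow> mult b a d"
proof -
  note p = pairing_in_hom and sw = prod_swap_props[OF A_Obj A_Obj]
  let ?P = "Prod C A A" and ?D = "diag C (Prod C A A)"
  have P: "?P \<in> Obj C" using A_Obj by simp
  let ?M = "rel_comp C \<mu> (graph C (prod_swap C A A))"
  let ?S = "rel_comp C (rel_dagger C \<mu>) ?M"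
  have M: "?M \<in> hom (Rel C) ?P A" by (rule rel_comp_in_hom[OF graph_in_hom[OF sw(1)] \<mu>_hom])
  note d\<mu> = rel_dagger_in_hom[OF \<mu>_hom]
  have S: "?S \<in> hom (Rel C) ?P ?P" by (rule rel_comp_in_hom[OF M d\<mu>])
  have M_iff: "related ?M (pairing C a b) d \<longleftrightarrow> mult b a d"
    if "a \<in> hom C X A" "b \<in> hom C X A" "d \<in> hom C X A" for a b d X
    unfolding mult_def sw(2)[OF that(1,2), symmetric]
    by (rule related_comp_graph[OF sw(1) \<mu>_hom p[OF that(1,2)] that(3)])
  obtain s where s: "monic C s" "Cod C s = Prod C ?P ?P" "?S = (?P, subobject C s, ?P)"
    using S by (rule hom_Rel_cases)
  obtain r t where pb: "is_pullback C ?D s r t"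
    using pullback_exists[OF finite_limits, of ?D s] s P by auto
  have r: "monic C r" "Cod C r = ?P" using pullback_monic[OF pb s(1)] pullback_typing[OF pb] P by simp_all
  define F where "F = (A, subobject C r, A)"
  have F: "F \<in> hom (Rel C) A A" unfolding F_def hom_Rel_iff using r A_Obj by blast
  have F_iff: "related F a b \<longleftrightarrow> related ?S (pairing C a b) (pairing C a b)"
    if "a \<in> hom C X A" "b \<in> hom C X A" for a b X
  proof -
    have ab: "a \<in> Arr C" "b \<in> Arr C" "Dom C a = X" "Dom C b = X" "Cod C a = A" "Cod C b = A"
      using that by (auto simp: hom_def)
    have D: "?D \<cdot> pairing C a b = pairing C (pairing C a b) (pairing C a b)"
      using ab P by simp
    have "factors_through C (pairing C a b) r \<longleftrightarrow> factors_through C (?D \<cdot> pairing C a b) s"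
    proof
      assume "factors_through C (pairing C a b) r"
      then obtain h where h: "h \<in> Arr C" "Dom C h = X" "Cod C h = Dom C r" "r \<cdot> h = pairing C a b"
        using ab by (auto simp: factors_through_iff)
      note pt = pullback_typing[OF pb]
      have "s \<cdot> (t \<cdot> h) = (s \<cdot> t) \<cdot> h" using h(1-3) pt(1-8) by simp
      also have "\<dots> = ?D \<cdot> (r \<cdot> h)" unfolding pt(9)[symmetric] using h(1-3) pt(1-8) by (intro Comp_assoc_seq) simp_all
      finally have "s \<cdot> (t \<cdot> h) = ?D \<cdot> pairing C a b" unfolding h(4) .
      moreover have "t \<cdot> h \<in> Arr C" "Dom C (t \<cdot> h) = X" "Cod C (t \<cdot> h) = Dom C s" using h(1-3) pt(1-8) by simp_all
      ultimately show "factors_through C (?D \<cdot> pairing C a b) s"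
        unfolding D using ab by (subst factors_through_iff) auto
    next
      assume "factors_through C (?D \<cdot> pairing C a b) s"
      then obtain k where k: "k \<in> Arr C" "Dom C k = X" "Cod C k = Dom C s" "?D \<cdot> pairing C a b = s \<cdot> k"
        unfolding D using ab by (auto simp: factors_through_iff)
      obtain h where "h \<in> Arr C" "Dom C h = Dom C (pairing C a b)" "Cod C h = Dom C r" "r \<cdot> h = pairing C a b"
        by (rule pullback_lift[OF pb _ k(1) _ _ k(3,4)]) (use ab k(2) P in simp_all)
      then show "factors_through C (pairing C a b) r"
        using ab by (subst factors_through_iff) auto
    qed
    then show ?thesis
      unfolding D s(3) F_def using ab r(1) s(1) by (simp add: related_subobject)
  qed
  show ?thesis
  proof (rule that[OF F])
    fix X a b d assume t: "a \<in> hom C X A" "b \<in> hom C X A" "d \<in> hom C X A" and m: "mult a b d" "mult b a d"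
    have "related (rel_dagger C \<mu>) d (pairing C a b)"
      using related_dagger[OF \<mu>_hom t(3) p[OF t(1,2)]] m(1) by (simp add: mult_def)
    then have "related ?S (pairing C a b) (pairing C a b)"
      using related_compI[OF _ _ M d\<mu> p[OF t(1,2)] t(3) p[OF t(1,2)]] M_iff[OF t] m(2) by simp
    then show "related F a b" using F_iff[OF t(1,2)] by simp
  next
    fix X a b d assume t: "a \<in> hom C X A" "b \<in> hom C X A" "d \<in> hom C X A" and rel: "related F a b" and m: "mult a b d"
    have "related ?S (pairing C a b) (pairing C a b)" using rel F_iff[OF t(1,2)] by simp
    then obtain Y c e where c: "cover c" "c \<in> hom C Y X" "e \<in> hom C Y A"
        "related ?M (pairing C a b \<cdot> c) e" "related (rel_dagger C \<mu>) e (pairing C a b \<cdot> c)"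
      by (rule related_compE[OF _ M d\<mu> p[OF t(1,2)] p[OF t(1,2)]])
    note tc = Comp_in_hom[OF c(2) t(1)] Comp_in_hom[OF c(2) t(2)] Comp_in_hom[OF c(2) t(3)]
    have "mult (b \<cdot> c) (a \<cdot> c) e"
      using c(4) M_iff[OF tc(1,2) c(3)] unfolding pairing_hom_Comp[OF t(1,2) c(2)] by simp
    moreover have "mult (a \<cdot> c) (b \<cdot> c) e"
      using c(5) related_dagger[OF \<mu>_hom c(3) p[OF tc(1,2)]]
      unfolding pairing_hom_Comp[OF t(1,2) c(2)] mult_def by simp
    then have "e = d \<cdot> c" by (rule mult_functional[OF _ mult_stable[OF m t c(2)] tc(1,2) c(3) tc(3)])
    ultimately have "mult (b \<cdot> c) (a \<cdot> c) (d \<cdot> c)" by simp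
    then show "mult b a d" by (rule mult_local[OF _ c(1) t(2,1,3) c(2)])
  qed
qed

text \<open>The pairs \<open>(a, u)\<close>, \<open>(u, u)\<close> and \<open>(u, b)\<close> commute, where \<open>u\<close> is the common unit of \<open>a\<close> and \<open>b\<close>; difunctionality
  completes the rectangle.\<close>

lemma mult_commutes:
  assumes mal: "malcev C" and m: "mult a b d"
    and ty: "a \<in> hom C X A" "b \<in> hom C X A" "d \<in> hom C X A"
  shows "mult b a d"
proof -
  obtain F where F: "F \<in> hom (Rel C) A A"
    and FI: "\<And>X a b d. a \<in> hom C X A \<Longrightarrow> b \<in> hom C X A \<Longrightarrow> d \<in> hom C X A \<Longrightarrow> mult a b d \<Longrightarrow> mult b a d \<Longrightarrow>
      related F a b"
    and FE: "\<And>X a b d. a \<in> hom C X A \<Longrightarrow> b \<in> hom C X A \<Longrightarrow> d \<in> hom C X A \<Longrightarrow> related F a b \<Longrightarrow> mult a b d \<Longrightarrow>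
      mult b a d"
    by (rule commuting_relation) (rule that)
  have step: "mult b a d"
    if m: "mult a b d" and au: "mult a u a" and ub: "mult u b b" and u: "unit u"
      and ty: "a \<in> hom C X A" "b \<in> hom C X A" "d \<in> hom C X A" "u \<in> hom C X A" for X a b d u
  proof -
    have ua: "mult u a a" and bu: "mult b u b"
      using unit_two_sided[OF ty(1,4) u] unit_two_sided[OF ty(2,4) u] au ub by simp_all
    \<comment> \<open>The right unit of \<open>u\<close> is \<open>u\<close> itself, since \<open>u\<close> is also a left unit.\<close>
    have uu: "mult u u u"
    proof -
      obtain Y c s where c: "cover c" "c \<in> hom C Y X" "s \<in> hom C Y A" "unit s" "mult (u \<cdot> c) s (u \<cdot> c)"
        by (rule unit_right_exists[OF ty(4)])
      note uc = Comp_in_hom[OF c(2) ty(4)]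
      have "u \<cdot> c = s" by (rule unit_left_eq[OF c(5) unit_stable[OF u ty(4) c(2)] c(3) uc uc])
      then show ?thesis using mult_local[OF _ c(1) ty(4,4,4) c(2)] c(5) by simp
    qed
    have 1: "related F u b" by (rule FI[OF ty(4,2,2) ub bu])
    have 2: "related F a u" by (rule FI[OF ty(1,4,1) au ua])
    have 3: "related F u u" by (rule FI[OF ty(4,4,4) uu uu])
    have "related F a b"
      by (rule malcev_difunctional[OF mal F _ _ _ _ _ _ _ _ _ _ _ 1 2 3]) (use ty in \<open>simp_all add: hom_def\<close>)
    then show ?thesis by (rule FE[OF ty(1-3) _ m])
  qed
  obtain Y1 c1 u where c1: "cover c1" "c1 \<in> hom C Y1 X" "u \<in> hom C Y1 A" "unit u" "mult (a \<cdot> c1) u (a \<cdot> c1)"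
    by (rule unit_right_exists[OF ty(1)])
  note t1 = Comp_in_hom[OF c1(2) ty(1)] Comp_in_hom[OF c1(2) ty(2)] Comp_in_hom[OF c1(2) ty(3)]
  note m1 = mult_stable[OF m ty c1(2)]
  obtain Y c2 e where c2: "cover c2" "c2 \<in> hom C Y Y1" "e \<in> hom C Y A"
      "mult (u \<cdot> c2) ((b \<cdot> c1) \<cdot> c2) e" "mult ((a \<cdot> c1) \<cdot> c2) e ((d \<cdot> c1) \<cdot> c2)"
    by (rule mult_assoc[OF c1(5) m1 t1(1) c1(3) t1(2,1,3)])
  note t2 = Comp_in_hom[OF c2(2) t1(1)] Comp_in_hom[OF c2(2) t1(2)] Comp_in_hom[OF c2(2) t1(3)]
    Comp_in_hom[OF c2(2) c1(3)]
  note u2 = unit_stable[OF c1(4,3) c2(2)]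
  have "e = (b \<cdot> c1) \<cdot> c2" by (rule unit_left_eq[OF c2(4) u2 t2(2,4) c2(3)])
  then have "mult (u \<cdot> c2) ((b \<cdot> c1) \<cdot> c2) ((b \<cdot> c1) \<cdot> c2)" using c2(4) by simp
  then have "mult ((b \<cdot> c1) \<cdot> c2) ((a \<cdot> c1) \<cdot> c2) ((d \<cdot> c1) \<cdot> c2)"
    by (rule step[OF mult_stable[OF m1 t1 c2(2)] mult_stable[OF c1(5) t1(1) c1(3) t1(1) c2(2)] _ u2 t2])
  then have "mult (b \<cdot> c1) (a \<cdot> c1) (d \<cdot> c1)" by (rule mult_local[OF _ c2(1) t1(2,1,3) c2(2)])
  then show ?thesis by (rule mult_local[OF _ c1(1) ty(2,1,3) c1(2)])
qed

lemma commutative: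
  assumes mal: "malcev C"
  shows "commutative_mult (Rel C) A \<mu>"
  unfolding commutative_mult_def Rel_simps
proof (rule Rel_eqI)
  note sw = prod_swap_props[OF A_Obj A_Obj]
  show "rel_comp C \<mu> (graph C (prod_swap C A A)) \<in> hom (Rel C) (Prod C A A) A"
    by (rule rel_comp_in_hom[OF graph_in_hom[OF sw(1)] \<mu>_hom])
  show "\<mu> \<in> hom (Rel C) (Prod C A A) A" by (fact \<mu>_hom)
  fix f d assume "f \<in> Arr C" "d \<in> Arr C" "Dom C f = Dom C d" "Cod C f = Prod C A A" "Cod C d = A"
  then have f: "f \<in> hom C (Dom C d) (Prod C A A)" and d: "d \<in> hom C (Dom C d) A"
    by (simp_all add: hom_def)
  obtain a b where ab: "a \<in> hom C (Dom C d) A" "b \<in> hom C (Dom C d) A" "f = pairing C a b"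
    using hom_Prod_cases[OF f A_Obj A_Obj] .
  have "related (rel_comp C \<mu> (graph C (prod_swap C A A))) f d \<longleftrightarrow> mult b a d"
    unfolding ab(3) mult_def sw(2)[OF ab(1,2), symmetric]
    by (rule related_comp_graph[OF sw(1) \<mu>_hom pairing_in_hom[OF ab(1,2)] d])
  also have "\<dots> \<longleftrightarrow> mult a b d"
    using mult_commutes[OF mal _ ab(1,2) d] mult_commutes[OF mal _ ab(2,1) d] by blast
  finally show "related (rel_comp C \<mu> (graph C (prod_swap C A A))) f d \<longleftrightarrow> related \<mu> f d"
    unfolding mult_def ab(3) .
qed

end

theorem proposition5p6:
  fixes C :: "('o, 'm) cartesian_category"
  assumes "regular_category C"
    and "chosen_finite_products C"
    and "malcev C"
  shows "no_broadcasting (Rel C)"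
proof -
  interpret cartesian_regular_category C
    using assms(1,2) by (rule cartesian_regular_category.intro)
  show ?thesis
    unfolding no_broadcasting_def
  proof (intro allI impI, elim conjE exE)
    fix A \<mu> \<eta> \<beta>
    assume "special_dagger_frobenius (Rel C) A \<mu> \<eta>" and "broadcasting_map (Rel C) A \<mu> \<eta> \<beta>"
    then interpret broadcasting_in_Rel C A \<mu> \<eta> \<beta> by unfold_locales
    show "commutative_mult (Rel C) A \<mu>" by (rule commutative[OF assms(3)])
  qed
qed

end
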